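(* Let $\alpha$, $\mathcal T$, $\mathcal C$ be as in the context. There exists an essentially unique functor $$\Psi\colon\mathcal T\longrightarrow\mathbf{Pres}_\infty^{\simeq}$$ sending each object $X$ to a Postnikov resolution $\Psi(X)$ of $X$ and each map $h\colon X\to Y$ to the homotopy class $\Psi(h)$ of a morphism of Postnikov resolutions with first coordinate $h$. This functor is additive, full and essentially surjective. Moreover, the kernel of $\Psi$ is the ideal $\mathcal I^\infty$ of $\infty$-$\mathcal C$-phantom maps; hence $\Psi$ induces an equivalence of categories $\mathcal T/\mathcal I^\infty\simeq\mathbf{Pres}_\infty^{\simeq}$.
   Context: Let $\alpha$ be a (infinite) regular cardinal. In a triangulated category $\mathcal T$ with coproducts and suspension $\Sigma$, an object $S$ is $\alpha$-small if any morphism $S\to\coprod_{i\in I}X_i$ factors through $\coprod_{i\in I'}X_i$ for some $I'\subset I$ with $\mathrm{card}\,I'<\alpha$. A class $\mathcal S$ of objects generates $\mathcal T$ if an object $X$ is zero if and only if $\mathcal T(S,X)=0$ for all $S\in\mathcal S$. It is perfect if, for every set $\{f_i\colon X_i\to Y_i\}_{i\in I}$ of morphisms such that $\mathcal T(S,f_i)$ is surjective for all $i$ and all $S\in\mathcal S$, the map $\mathcal T(S,\coprod_i f_i)$ is surjective for all $S\in\mathcal S$. $\mathcal T$ is $\alpha$-compactly generated if it has a perfect generating set of $\alpha$-small objects, and well generated if it is so for some regular $\alpha$. $\mathcal T^\alpha$ is the unique maximal full subcategory of $\mathcal T$ formed by $\alpha$-small objects such that any morphism $S\to\coprod_{i\in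 I}X_i$ with $S\in\mathcal T^\alpha$ factors through a coproduct $\coprod f_i\colon\coprod_i S_i\to\coprod_i X_i$ with all $S_i\in\mathcal T^\alpha$. Standing assumptions: $\mathcal T$ is a non-zero well generated triangulated category and $\mathcal C\subset\mathcal T^\alpha$ is a non-zero essentially small full subcategory of $\mathcal T$ which is closed under suspension and desuspension, has coproducts of fewer than $\alpha$ objects (computed in $\mathcal T$), generates $\mathcal T$, and is perfect. $\mathrm{Mod}_\alpha(\mathcal C)$ is the abelian category of functors $\mathcal C^{\mathrm{op}}\to\mathrm{Ab}$ preserving products of fewer than $\alpha$ objects, and $S_\alpha(X)=\mathcal T(-,X)|_{\mathcal C}$. $\mathrm{Add}(\mathcal C)$ is the smallest subcategory of $\mathcal T$ containing $\mathcal C$ and closed under coproducts and retracts; $S_\alpha$ identifies it with the projective objects of $\mathrm{Mod}_\alpha(\mathcal C)$. A degree $+m$ morphism $X\to Y$ is a morphism $X\to\Sigma^mY$; composites of graded morphisms are formed after suspending. A $\mathcal C$-phantom map is a morphism $f$ with $S_\alpha(f)=0$; an $n$-$\mathcal C$-phantom map is a composite of $n$ $\mathcal C$-phantom maps; an $\infty$-$\mathcal C$-phantom map is one which is an $n$-$\mathcal C$-phantom map for all $n>0$. A Postnikov resolution $(X,X_*,P_* )$ of an object $X$ consists of exact triangles $P_n\xrightarrow{f_n}X_{n-1}\xrightarrow{i_n}X_n\xrightarrow{q_n}\Sigma P_n$, $n\ge0$, with $X_{-1}=0$ (so $q_0$ is an isomorphism) and $P_n\in\mathrm{Add}(\mathcal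 C)$, together with morphisms $p_n\colon X_n\to\Sigma X$ with $p_n=p_{n+1}i_{n+1}$, $n\ge0$, such that $S_\alpha$ maps the sequence $X\leftarrow P_0\leftarrow P_1\leftarrow P_2\leftarrow\cdots$, with augmentation $p_0q_0^{-1}$ of degree $0$ and differentials $q_nf_{n+1}\colon P_{n+1}\to\Sigma P_n$ of degree $+1$, to a projective resolution of $S_\alpha(X)$. A morphism $(h,\psi_*,\varphi_* )\colon(X,X_*,P_* )\to(Y,Y_*,Q_* )$ consists of morphisms $h\colon X\to Y$, $\psi_n\colon X_n\to Y_n$, $\varphi_n\colon P_n\to Q_n$, $n\ge0$, commuting with all structure morphisms $f_n,i_n,q_n,p_n$. Two such morphisms $(h,\psi_*,\varphi_* )$, $(\bar h,\bar\psi_*,\bar\varphi_* )$ are homotopic if $\psi_ni_n^X=\bar\psi_ni_n^X$ for all $n>0$ (equivalently $i_n^Y\psi_{n-1}=i_n^Y\bar\psi_{n-1}$ for all $n>0$). $\mathbf{Pres}_\infty$ is the category of Postnikov resolutions of objects of $\mathcal T$ and $\mathbf{Pres}_\infty^{\simeq}$ its quotient by homotopy. "Essentially unique" means unique up to natural isomorphism. *)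

theory Defs
  imports "HOL-Algebra.Coset"
begin

unbundle cardinal_syntax

record ('o, 'm) cat =
  Ob :: "'o set"
  Arr :: "'m set"
  Dom :: "'m \<Rightarrow> 'o"
  Cod :: "'m \<Rightarrow> 'o"
  Idn :: "'o \<Rightarrow> 'm"
  Comp :: "'m \<Rightarrow> 'm \<Rightarrow> 'm"  (infixr \<open>\<cdot>\<index>\<close> 70)

definition Hom :: "('o, 'm, 'x) cat_scheme \<Rightarrow> 'o \<Rightarrow> 'o \<Rightarrow> 'm set" where
  "Hom C X Y = {f \<in> Arr C. Dom C f = X \<and> Cod C f = Y}"

locale category =
  fixes C :: "('o, 'm, 'x) cat_scheme" (structure)
  assumes dom_cod_in_Ob: "f \<in> Arr C \<Longrightarrow> Dom C f \<in> Ob C \<and> Cod C f \<in> Ob C"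
    and Idn_in_Hom: "X \<in> Ob C \<Longrightarrow> Idn C X \<in> Hom C X X"
    and Comp_in_Hom: "f \<in> Hom C X Y \<Longrightarrow> g \<in> Hom C Y Z \<Longrightarrow> g \<cdot> f \<in> Hom C X Z"
    and Comp_Idn: "f \<in> Hom C X Y \<Longrightarrow> f \<cdot> Idn C X = f"
    and Idn_Comp: "f \<in> Hom C X Y \<Longrightarrow> Idn C Y \<cdot> f = f"
    and Comp_assoc: "f \<in> Hom C W X \<Longrightarrow> g \<in> Hom C X Y \<Longrightarrow> h \<in> Hom C Y Z
           \<Longrightarrow> (h \<cdot> g) \<cdot> f = h \<cdot> (g \<cdot> f)"

definition is_inverse :: "('o, 'm, 'x) cat_scheme \<Rightarrow> 'm \<Rightarrow> 'm \<Rightarrow> bool" where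
  "is_inverse C f g \<longleftrightarrow> f \<in> Arr C \<and> g \<in> Hom C (Cod C f) (Dom C f) \<and>
     g \<cdot>\<^bsub>C\<^esub> f = Idn C (Dom C f) \<and> f \<cdot>\<^bsub>C\<^esub> g = Idn C (Cod C f)"

definition is_iso :: "('o, 'm, 'x) cat_scheme \<Rightarrow> 'm \<Rightarrow> bool" where
  "is_iso C f \<longleftrightarrow> (\<exists>g. is_inverse C f g)"

definition inverse_arr :: "('o, 'm, 'x) cat_scheme \<Rightarrow> 'm \<Rightarrow> 'm" where
  "inverse_arr C f = (THE g. is_inverse C f g)"

definition isomorphic :: "('o, 'm, 'x) cat_scheme \<Rightarrow> 'o \<Rightarrow> 'o \<Rightarrow> bool" where
  "isomorphic C X Y \<longleftrightarrow> (\<exists>f \<in> Hom C X Y. is_iso C f)"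

definition is_zero_ob :: "('o, 'm, 'x) cat_scheme \<Rightarrow> 'o \<Rightarrow> bool" where
  "is_zero_ob C Z \<longleftrightarrow> Z \<in> Ob C \<and>
     (\<forall>X \<in> Ob C. (\<exists>!f. f \<in> Hom C Z X) \<and> (\<exists>!f. f \<in> Hom C X Z))"

definition zero_ob :: "('o, 'm, 'x) cat_scheme \<Rightarrow> 'o" where
  "zero_ob C = (SOME Z. is_zero_ob C Z)"

definition is_coproduct ::
  "('o, 'm, 'x) cat_scheme \<Rightarrow> 'i set \<Rightarrow> ('i \<Rightarrow> 'o) \<Rightarrow> 'o \<Rightarrow> ('i \<Rightarrow> 'm) \<Rightarrow> bool" where
  "is_coproduct C I X A \<iota> \<longleftrightarrow>
     A \<in> Ob C \<and> (\<forall>i \<in> I. \<iota> i \<in> Hom C (X i) A) \<and>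
     (\<forall>Y \<in> Ob C. \<forall>g. (\<forall>i \<in> I. g i \<in> Hom C (X i) Y) \<longrightarrow>
        (\<exists>!u. u \<in> Hom C A Y \<and> (\<forall>i \<in> I. u \<cdot>\<^bsub>C\<^esub> \<iota> i = g i)))"

record ('o, 'm, 'p, 'n) func =
  FOb :: "'o \<Rightarrow> 'p"
  FArr :: "'m \<Rightarrow> 'n"

definition is_functor ::
  "('o, 'm, 'x) cat_scheme \<Rightarrow> ('p, 'n, 'y) cat_scheme \<Rightarrow> ('o, 'm, 'p, 'n) func \<Rightarrow> bool" where
  "is_functor C D F \<longleftrightarrow> category C \<and> category D \<and>
     (\<forall>X \<in> Ob C. FOb F X \<in> Ob D) \<and>
     (\<forall>f \<in> Arr C. FArr F f \<in> Hom D (FOb F (Dom C f)) (FOb F (Cod C f))) \<and>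
     (\<forall>X \<in> Ob C. FArr F (Idn C X) = Idn D (FOb F X)) \<and>
     (\<forall>f \<in> Arr C. \<forall>g \<in> Arr C. Dom C g = Cod C f \<longrightarrow>
        FArr F (g \<cdot>\<^bsub>C\<^esub> f) = FArr F g \<cdot>\<^bsub>D\<^esub> FArr F f)"

definition id_func :: "('o, 'm, 'o, 'm) func" where
  "id_func = \<lparr>FOb = \<lambda>X. X, FArr = \<lambda>f. f\<rparr>"

definition comp_func ::
  "('p, 'n, 'q, 'k) func \<Rightarrow> ('o, 'm, 'p, 'n) func \<Rightarrow> ('o, 'm, 'q, 'k) func" where
  "comp_func G F = \<lparr>FOb = FOb G \<circ> FOb F, FArr = FArr G \<circ> FArr F\<rparr>"

definition naturally_isomorphic ::
  "('o, 'm, 'x) cat_scheme \<Rightarrow> ('p, 'n, 'y) cat_scheme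
     \<Rightarrow> ('o, 'm, 'p, 'n) func \<Rightarrow> ('o, 'm, 'p, 'n) func \<Rightarrow> bool" where
  "naturally_isomorphic C D F G \<longleftrightarrow>
     (\<exists>\<eta>. (\<forall>X \<in> Ob C. \<eta> X \<in> Hom D (FOb F X) (FOb G X) \<and> is_iso D (\<eta> X)) \<and>
          (\<forall>f \<in> Arr C. \<eta> (Cod C f) \<cdot>\<^bsub>D\<^esub> FArr F f = FArr G f \<cdot>\<^bsub>D\<^esub> \<eta> (Dom C f)))"

definition is_equivalence ::
  "('o, 'm, 'x) cat_scheme \<Rightarrow> ('p, 'n, 'y) cat_scheme \<Rightarrow> ('o, 'm, 'p, 'n) func \<Rightarrow> bool" where
  "is_equivalence C D F \<longleftrightarrow> is_functor C D F \<and>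
     (\<exists>G. is_functor D C G \<and>
          naturally_isomorphic C C (comp_func G F) id_func \<and>
          naturally_isomorphic D D (comp_func F G) id_func)"

definition is_full ::
  "('o, 'm, 'x) cat_scheme \<Rightarrow> ('p, 'n, 'y) cat_scheme \<Rightarrow> ('o, 'm, 'p, 'n) func \<Rightarrow> bool" where
  "is_full C D F \<longleftrightarrow>
     (\<forall>X \<in> Ob C. \<forall>Y \<in> Ob C. \<forall>g \<in> Hom D (FOb F X) (FOb F Y). \<exists>f \<in> Hom C X Y. FArr F f = g)"

definition is_essentially_surjective ::
  "('o, 'm, 'x) cat_scheme \<Rightarrow> ('p, 'n, 'y) cat_scheme \<Rightarrow> ('o, 'm, 'p, 'n) func \<Rightarrow> bool" where
  "is_essentially_surjective C D F \<longleftrightarrow> (\<forall>Y \<in> Ob D. \<exists>X \<in> Ob C. isomorphic D (FOb F X) Y)"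

record ('o, 'm) precat = "('o, 'm) cat" +
  Add :: "'m \<Rightarrow> 'm \<Rightarrow> 'm"  (infixl \<open>\<oplus>\<index>\<close> 65)
  Zero :: "'o \<Rightarrow> 'o \<Rightarrow> 'm"

definition Hom_group :: "('o, 'm, 'x) precat_scheme \<Rightarrow> 'o \<Rightarrow> 'o \<Rightarrow> 'm monoid" where
  "Hom_group C X Y = \<lparr>carrier = Hom C X Y, mult = Add C, one = Zero C X Y\<rparr>"

definition neg :: "('o, 'm, 'x) precat_scheme \<Rightarrow> 'm \<Rightarrow> 'm" where
  "neg C f = inv\<^bsub>Hom_group C (Dom C f) (Cod C f)\<^esub> f"

locale preadditive_category = category C
  for C :: "('o, 'm, 'x) precat_scheme" (structure) +
  assumes Hom_comm_group: "X \<in> Ob C \<Longrightarrow> Y \<in> Ob C \<Longrightarrow> comm_group (Hom_group C X Y)"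
    and Comp_Add: "f \<in> Hom C X Y \<Longrightarrow> g \<in> Hom C Y Z \<Longrightarrow> g' \<in> Hom C Y Z
           \<Longrightarrow> (g \<oplus> g') \<cdot> f = (g \<cdot> f) \<oplus> (g' \<cdot> f)"
    and Add_Comp: "f \<in> Hom C X Y \<Longrightarrow> f' \<in> Hom C X Y \<Longrightarrow> g \<in> Hom C Y Z
           \<Longrightarrow> g \<cdot> (f \<oplus> f') = (g \<cdot> f) \<oplus> (g \<cdot> f')"

locale additive_category = preadditive_category C
  for C :: "('o, 'm, 'x) precat_scheme" (structure) +
  assumes ex_zero_ob: "\<exists>Z. is_zero_ob C Z"
    and ex_binary_coproduct: "X \<in> Ob C \<Longrightarrow> Y \<in> Ob C \<Longrightarrow>
           \<exists>A \<iota>. is_coproduct C (UNIV :: bool set) (\<lambda>b. if b then X else Y) A \<iota>"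

definition is_additive_functor ::
  "('o, 'm, 'x) precat_scheme \<Rightarrow> ('p, 'n, 'y) precat_scheme \<Rightarrow> ('o, 'm, 'p, 'n) func \<Rightarrow> bool" where
  "is_additive_functor C D F \<longleftrightarrow>
     preadditive_category C \<and> preadditive_category D \<and> is_functor C D F \<and>
     (\<forall>X \<in> Ob C. \<forall>Y \<in> Ob C. \<forall>f \<in> Hom C X Y. \<forall>g \<in> Hom C X Y.
        FArr F (f \<oplus>\<^bsub>C\<^esub> g) = FArr F f \<oplus>\<^bsub>D\<^esub> FArr F g)"

definition functor_kernel ::
  "('o, 'm, 'x) precat_scheme \<Rightarrow> ('p, 'n, 'y) precat_scheme \<Rightarrow> ('o, 'm, 'p, 'n) func \<Rightarrow> 'm set" where
  "functor_kernel C D F =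
     {f \<in> Arr C. FArr F f = Zero D (FOb F (Dom C f)) (FOb F (Cod C f))}"

text \<open>The quotient by an additive congruence \<open>R\<close>, an equivalence relation on the set of
  arrows which only relates parallel arrows and is compatible with composition and addition.
  Arrows of the quotient are \<open>R\<close>-classes; all operations are computed on representatives.\<close>

definition quotient_cat ::
  "('o, 'm, 'x) precat_scheme \<Rightarrow> ('m \<times> 'm) set \<Rightarrow> ('o, 'm set) precat" where
  "quotient_cat C R =
     \<lparr>Ob = Ob C,
      Arr = Arr C // R,
      Dom = \<lambda>A. Dom C (SOME f. f \<in> A),
      Cod = \<lambda>A. Cod C (SOME f. f \<in> A),
      Idn = \<lambda>X. R `` {Idn C X},
      Comp = \<lambda>B A. R `` {(SOME g. g \<in> B) \<cdot>\<^bsub>C\<^esub> (SOME f. f \<in> A)},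
      Add = \<lambda>A B. R `` {(SOME f. f \<in> A) \<oplus>\<^bsub>C\<^esub> (SOME g. g \<in> B)},
      Zero = \<lambda>X Y. R `` {Zero C X Y}\<rparr>"

definition ideal_rel :: "('o, 'm, 'x) precat_scheme \<Rightarrow> 'm set \<Rightarrow> ('m \<times> 'm) set" where
  "ideal_rel C J = {(f, g). f \<in> Arr C \<and> g \<in> Hom C (Dom C f) (Cod C f) \<and> f \<oplus>\<^bsub>C\<^esub> neg C g \<in> J}"

text \<open>\<open>(f, g, h) \<in> Tri T\<close> is an exact triangle \<open>X \<rightarrow> Y \<rightarrow> Z \<rightarrow> \<Sigma> X\<close>; its objects are
  determined by its arrows.\<close>

record ('o, 'm) tricat = "('o, 'm) precat" +
  Susp :: "('o, 'm, 'o, 'm) func"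
  Tri :: "('m \<times> 'm \<times> 'm) set"

abbreviation suspO :: "('o, 'm, 'x) tricat_scheme \<Rightarrow> 'o \<Rightarrow> 'o" where
  "suspO T \<equiv> FOb (Susp T)"

abbreviation suspA :: "('o, 'm, 'x) tricat_scheme \<Rightarrow> 'm \<Rightarrow> 'm" where
  "suspA T \<equiv> FArr (Susp T)"

definition candidate_triangle ::
  "('o, 'm, 'x) tricat_scheme \<Rightarrow> 'o \<Rightarrow> 'o \<Rightarrow> 'o \<Rightarrow> 'm \<Rightarrow> 'm \<Rightarrow> 'm \<Rightarrow> bool" where
  "candidate_triangle T X Y Z f g h \<longleftrightarrow>
     f \<in> Hom T X Y \<and> g \<in> Hom T Y Z \<and> h \<in> Hom T Z (suspO T X)"

definition exact_triangle ::
  "('o, 'm, 'x) tricat_scheme \<Rightarrow> 'o \<Rightarrow> 'o \<Rightarrow> 'o \<Rightarrow> 'm \<Rightarrow> 'm \<Rightarrow> 'm \<Rightarrow> bool" where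
  "exact_triangle T X Y Z f g h \<longleftrightarrow> candidate_triangle T X Y Z f g h \<and> (f, g, h) \<in> Tri T"

locale triangulated_category = additive_category T
  for T :: "('o, 'm, 'x) tricat_scheme" (structure) +
  assumes susp_equivalence: "is_equivalence T T (Susp T)"
    and susp_additive: "is_additive_functor T T (Susp T)"
    and triangle_iso:
      "exact_triangle T X Y Z f g h \<Longrightarrow> candidate_triangle T X' Y' Z' f' g' h' \<Longrightarrow>
       a \<in> Hom T X X' \<Longrightarrow> b \<in> Hom T Y Y' \<Longrightarrow> c \<in> Hom T Z Z' \<Longrightarrow>
       is_iso T a \<Longrightarrow> is_iso T b \<Longrightarrow> is_iso T c \<Longrightarrow>
       b \<cdot> f = f' \<cdot> a \<Longrightarrow> c \<cdot> g = g' \<cdot> b \<Longrightarrow> suspA T a \<cdot> h = h' \<cdot> c \<Longrightarrow>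
       exact_triangle T X' Y' Z' f' g' h'"
    and triangle_id:
      "X \<in> Ob T \<Longrightarrow> is_zero_ob T Z \<Longrightarrow>
       exact_triangle T X X Z (Idn T X) (Zero T X Z) (Zero T Z (suspO T X))"
    and triangle_complete:
      "f \<in> Hom T X Y \<Longrightarrow> \<exists>Z g h. exact_triangle T X Y Z f g h"
    and triangle_rotate:
      "candidate_triangle T X Y Z f g h \<Longrightarrow>
       exact_triangle T X Y Z f g h \<longleftrightarrow>
       exact_triangle T Y Z (suspO T X) g h (neg T (suspA T f))"
    and triangle_morphism:
      "exact_triangle T X Y Z f g h \<Longrightarrow> exact_triangle T X' Y' Z' f' g' h' \<Longrightarrow>
       a \<in> Hom T X X' \<Longrightarrow> b \<in> Hom T Y Y' \<Longrightarrow> b \<cdot> f = f' \<cdot> a \<Longrightarrow>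
       \<exists>c \<in> Hom T Z Z'. c \<cdot> g = g' \<cdot> b \<and> suspA T a \<cdot> h = h' \<cdot> c"
    and octahedral:
      "exact_triangle T X Y U f f' f'' \<Longrightarrow> exact_triangle T Y Z W g g' g'' \<Longrightarrow>
       exact_triangle T X Z V (g \<cdot> f) k' k'' \<Longrightarrow>
       \<exists>u v. exact_triangle T U V W u v (suspA T f' \<cdot> g'') \<and>
             u \<cdot> f' = k' \<cdot> g \<and> v \<cdot> k' = g' \<and>
             k'' \<cdot> u = f'' \<and> g'' \<cdot> v = suspA T f \<cdot> k''"

text \<open>A triangulated category with coproducts is a large category. Throughout, \<open>\<kappa>\<close> is a regular
  cardinal which measures smallness: a ``set'', as opposed to a class, is a set of cardinality
  less than \<open>\<kappa>\<close>. (If \<open>\<kappa>\<close> is strongly inaccessible this is a Grothendieck universe.) Small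
  families are indexed by small subsets of the type underlying \<open>\<kappa>\<close>; every small set is in
  bijection with one of these.\<close>

definition regular_cardinal :: "'k rel \<Rightarrow> bool" where
  "regular_cardinal \<alpha> \<longleftrightarrow> Card_order \<alpha> \<and> infinite (Field \<alpha>) \<and> regularCard \<alpha>"

definition has_coproducts :: "('o, 'm, 'x) cat_scheme \<Rightarrow> 'k rel \<Rightarrow> bool" where
  "has_coproducts T \<kappa> \<longleftrightarrow>
     (\<forall>(I :: 'k set) X. |I| <o \<kappa> \<and> (\<forall>i \<in> I. X i \<in> Ob T) \<longrightarrow> (\<exists>A \<iota>. is_coproduct T I X A \<iota>))"

definition small_object :: "('o, 'm, 'x) cat_scheme \<Rightarrow> 'k rel \<Rightarrow> 'k rel \<Rightarrow> 'o \<Rightarrow> bool" where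
  "small_object T \<kappa> \<alpha> S \<longleftrightarrow> S \<in> Ob T \<and>
     (\<forall>(I :: 'k set) X A \<iota> s.
        |I| <o \<kappa> \<and> (\<forall>i \<in> I. X i \<in> Ob T) \<and> is_coproduct T I X A \<iota> \<and> s \<in> Hom T S A \<longrightarrow>
        (\<exists>I' B \<iota>' v u.
           I' \<subseteq> I \<and> |I'| <o \<alpha> \<and> is_coproduct T I' X B \<iota>' \<and>
           v \<in> Hom T B A \<and> (\<forall>i \<in> I'. v \<cdot>\<^bsub>T\<^esub> \<iota>' i = \<iota> i) \<and>
           u \<in> Hom T S B \<and> v \<cdot>\<^bsub>T\<^esub> u = s))"

definition generates :: "('o, 'm, 'x) precat_scheme \<Rightarrow> 'o set \<Rightarrow> bool" where
  "generates T \<S> \<longleftrightarrow>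
     (\<forall>X \<in> Ob T. is_zero_ob T X \<longleftrightarrow> (\<forall>S \<in> \<S>. Hom T S X = {Zero T S X}))"

text \<open>\<open>w\<close> is the coproduct of the \<open>f i\<close>, with respect to coproducts \<open>(A, \<iota>)\<close> of the sources
  and \<open>(B, \<iota>')\<close> of the targets.\<close>

definition is_coproduct_map ::
  "('o, 'm, 'x) cat_scheme \<Rightarrow> 'i set \<Rightarrow> ('i \<Rightarrow> 'o) \<Rightarrow> ('i \<Rightarrow> 'o) \<Rightarrow> ('i \<Rightarrow> 'm)
     \<Rightarrow> 'o \<Rightarrow> ('i \<Rightarrow> 'm) \<Rightarrow> 'o \<Rightarrow> ('i \<Rightarrow> 'm) \<Rightarrow> 'm \<Rightarrow> bool" where
  "is_coproduct_map T I X Y f A \<iota> B \<iota>' w \<longleftrightarrow>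
     (\<forall>i \<in> I. f i \<in> Hom T (X i) (Y i)) \<and>
     is_coproduct T I X A \<iota> \<and> is_coproduct T I Y B \<iota>' \<and>
     w \<in> Hom T A B \<and> (\<forall>i \<in> I. w \<cdot>\<^bsub>T\<^esub> \<iota> i = \<iota>' i \<cdot>\<^bsub>T\<^esub> f i)"

definition surjective_on :: "('o, 'm, 'x) cat_scheme \<Rightarrow> 'o set \<Rightarrow> 'm \<Rightarrow> bool" where
  "surjective_on T \<S> f \<longleftrightarrow>
     (\<forall>S \<in> \<S>. (\<lambda>u. f \<cdot>\<^bsub>T\<^esub> u) ` Hom T S (Dom T f) = Hom T S (Cod T f))"

definition perfect :: "('o, 'm, 'x) cat_scheme \<Rightarrow> 'k rel \<Rightarrow> 'o set \<Rightarrow> bool" where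
  "perfect T \<kappa> \<S> \<longleftrightarrow>
     (\<forall>(I :: 'k set) X Y f A \<iota> B \<iota>' w.
        |I| <o \<kappa> \<and> is_coproduct_map T I X Y f A \<iota> B \<iota>' w \<and>
        (\<forall>i \<in> I. surjective_on T \<S> (f i)) \<longrightarrow> surjective_on T \<S> w)"

definition compactly_generated :: "('o, 'm, 'x) precat_scheme \<Rightarrow> 'k rel \<Rightarrow> 'k rel \<Rightarrow> bool" where
  "compactly_generated T \<kappa> \<alpha> \<longleftrightarrow>
     (\<exists>\<S> \<subseteq> Ob T. |\<S>| <o \<kappa> \<and> (\<forall>S \<in> \<S>. small_object T \<kappa> \<alpha> S) \<and> perfect T \<kappa> \<S> \<and> generates T \<S>)"

definition well_generated :: "('o, 'm, 'x) precat_scheme \<Rightarrow> 'k rel \<Rightarrow> bool" where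
  "well_generated T \<kappa> \<longleftrightarrow>
     (\<exists>\<beta> :: 'k rel. regular_cardinal \<beta> \<and> \<beta> <o \<kappa> \<and> compactly_generated T \<kappa> \<beta>)"

definition factoring_class :: "('o, 'm, 'x) cat_scheme \<Rightarrow> 'k rel \<Rightarrow> 'k rel \<Rightarrow> 'o set \<Rightarrow> bool" where
  "factoring_class T \<kappa> \<alpha> \<S> \<longleftrightarrow>
     (\<forall>S \<in> \<S>. small_object T \<kappa> \<alpha> S) \<and>
     (\<forall>S \<in> \<S>. \<forall>(I :: 'k set) X A \<iota> s.
        |I| <o \<kappa> \<and> (\<forall>i \<in> I. X i \<in> Ob T) \<and> is_coproduct T I X A \<iota> \<and> s \<in> Hom T S A \<longrightarrow>
        (\<exists>S' f B \<iota>' w u.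
           (\<forall>i \<in> I. S' i \<in> \<S>) \<and> is_coproduct_map T I S' X f B \<iota>' A \<iota> w \<and>
           u \<in> Hom T S B \<and> w \<cdot>\<^bsub>T\<^esub> u = s))"

text \<open>The factoring classes are closed under unions, so the union of all of them, \<open>T\<^sup>\<alpha>\<close>, is the
  unique maximal one.\<close>

definition compact_objects :: "('o, 'm, 'x) cat_scheme \<Rightarrow> 'k rel \<Rightarrow> 'k rel \<Rightarrow> 'o set" where
  "compact_objects T \<kappa> \<alpha> = \<Union> {\<S>. factoring_class T \<kappa> \<alpha> \<S>}"

text \<open>Full subcategories are represented by their sets of objects. They need not be replete, and
  closure properties are up to isomorphism.\<close>

definition essentially_small :: "('o, 'm, 'x) cat_scheme \<Rightarrow> 'k rel \<Rightarrow> 'o set \<Rightarrow> bool" where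
  "essentially_small T \<kappa> \<C> \<longleftrightarrow>
     (\<forall>X \<in> \<C>. \<forall>Y \<in> \<C>. |Hom T X Y| <o \<kappa>) \<and>
     (\<exists>\<G> \<subseteq> \<C>. |\<G>| <o \<kappa> \<and> (\<forall>X \<in> \<C>. \<exists>Y \<in> \<G>. isomorphic T X Y))"

definition closed_under_suspensions :: "('o, 'm, 'x) tricat_scheme \<Rightarrow> 'o set \<Rightarrow> bool" where
  "closed_under_suspensions T \<C> \<longleftrightarrow>
     (\<forall>X \<in> \<C>. \<exists>Y \<in> \<C>. isomorphic T Y (suspO T X)) \<and>
     (\<forall>X \<in> \<C>. \<exists>Y \<in> \<C>. isomorphic T (suspO T Y) X)"

definition closed_under_coproducts :: "('o, 'm, 'x) cat_scheme \<Rightarrow> 'k rel \<Rightarrow> 'o set \<Rightarrow> bool" where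
  "closed_under_coproducts T \<alpha> \<C> \<longleftrightarrow>
     (\<forall>(I :: 'k set) X. |I| <o \<alpha> \<and> (\<forall>i \<in> I. X i \<in> \<C>) \<longrightarrow>
        (\<exists>A \<in> \<C>. \<exists>\<iota>. is_coproduct T I X A \<iota>))"

inductive_set Add_closure :: "('o, 'm, 'x) cat_scheme \<Rightarrow> 'k rel \<Rightarrow> 'o set \<Rightarrow> 'o set"
  for T :: "('o, 'm, 'x) cat_scheme" and \<kappa> :: "'k rel" and \<C> :: "'o set" where
  base: "X \<in> \<C> \<Longrightarrow> X \<in> Add_closure T \<kappa> \<C>"
| coproduct: "|I :: 'k set| <o \<kappa> \<Longrightarrow> (\<And>i. i \<in> I \<Longrightarrow> X i \<in> Add_closure T \<kappa> \<C>) \<Longrightarrow>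
     is_coproduct T I X A \<iota> \<Longrightarrow> A \<in> Add_closure T \<kappa> \<C>"
| retract: "X \<in> Add_closure T \<kappa> \<C> \<Longrightarrow> s \<in> Hom T Y X \<Longrightarrow> r \<in> Hom T X Y \<Longrightarrow>
     r \<cdot>\<^bsub>T\<^esub> s = Idn T Y \<Longrightarrow> Y \<in> Add_closure T \<kappa> \<C>"

text \<open>Presheaves of abelian groups on \<open>\<C>\<close>. The groups have their elements in the type of arrows
  of \<open>T\<close> and are required to be small; groups are written multiplicatively, as in HOL-Algebra.
  If \<open>T\<close> has coproducts and a non-zero object \<open>X\<close>, every small abelian group is isomorphic to
  such a group, since there are at least \<open>\<mu>\<close> arrows from \<open>X\<close> to the coproduct of \<open>\<mu>\<close> copies
  of \<open>X\<close>.\<close>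

record ('o, 'm, 'g) presheaf =
  Val :: "'o \<Rightarrow> 'g monoid"
  Res :: "'m \<Rightarrow> 'g \<Rightarrow> 'g"

definition is_Mod ::
  "('o, 'm, 'x) cat_scheme \<Rightarrow> 'k rel \<Rightarrow> 'k rel \<Rightarrow> 'o set \<Rightarrow> ('o, 'm, 'm) presheaf \<Rightarrow> bool" where
  "is_Mod T \<kappa> \<alpha> \<C> F \<longleftrightarrow>
     (\<forall>C \<in> \<C>. comm_group (Val F C) \<and> |carrier (Val F C)| <o \<kappa>) \<and>
     (\<forall>C \<in> \<C>. \<forall>D \<in> \<C>. \<forall>u \<in> Hom T C D. Res F u \<in> hom (Val F D) (Val F C)) \<and>
     (\<forall>C \<in> \<C>. \<forall>x \<in> carrier (Val F C). Res F (Idn T C) x = x) \<and>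
     (\<forall>C \<in> \<C>. \<forall>D \<in> \<C>. \<forall>E \<in> \<C>. \<forall>u \<in> Hom T C D. \<forall>v \<in> Hom T D E. \<forall>x \<in> carrier (Val F E).
        Res F (v \<cdot>\<^bsub>T\<^esub> u) x = Res F u (Res F v x)) \<and>
     (\<forall>(I :: 'k set) X A \<iota>.
        |I| <o \<alpha> \<and> (\<forall>i \<in> I. X i \<in> \<C>) \<and> A \<in> \<C> \<and> is_coproduct T I X A \<iota> \<longrightarrow>
        bij_betw (\<lambda>x. \<lambda>i \<in> I. Res F (\<iota> i) x)
          (carrier (Val F A)) (\<Pi>\<^sub>E i \<in> I. carrier (Val F (X i))))"

definition is_Mod_map ::
  "('o, 'm, 'x) cat_scheme \<Rightarrow> 'o set \<Rightarrow> ('o, 'm, 'm) presheaf \<Rightarrow> ('o, 'm, 'm) presheaf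
     \<Rightarrow> ('o \<Rightarrow> 'm \<Rightarrow> 'm) \<Rightarrow> bool" where
  "is_Mod_map T \<C> F G \<eta> \<longleftrightarrow>
     (\<forall>C \<in> \<C>. \<eta> C \<in> hom (Val F C) (Val G C)) \<and>
     (\<forall>C \<in> \<C>. \<forall>D \<in> \<C>. \<forall>u \<in> Hom T C D. \<forall>x \<in> carrier (Val F D).
        \<eta> C (Res F u x) = Res G u (\<eta> D x))"

text \<open>Products of abelian groups are exact, so kernels and cokernels in the category of modules
  are computed pointwise, and exactness is pointwise exactness.\<close>

definition Mod_epi ::
  "'o set \<Rightarrow> ('o, 'm, 'm) presheaf \<Rightarrow> ('o, 'm, 'm) presheaf \<Rightarrow> ('o \<Rightarrow> 'm \<Rightarrow> 'm) \<Rightarrow> bool" where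
  "Mod_epi \<C> F G \<eta> \<longleftrightarrow> (\<forall>C \<in> \<C>. \<eta> C ` carrier (Val F C) = carrier (Val G C))"

definition Mod_exact ::
  "'o set \<Rightarrow> ('o, 'm, 'm) presheaf \<Rightarrow> ('o \<Rightarrow> 'm \<Rightarrow> 'm) \<Rightarrow> ('o, 'm, 'm) presheaf
     \<Rightarrow> ('o \<Rightarrow> 'm \<Rightarrow> 'm) \<Rightarrow> ('o, 'm, 'm) presheaf \<Rightarrow> bool" where
  "Mod_exact \<C> F \<eta> G \<theta> H \<longleftrightarrow>
     (\<forall>C \<in> \<C>. \<eta> C ` carrier (Val F C) = kernel (Val G C) (Val H C) (\<theta> C))"

definition Mod_projective ::
  "('o, 'm, 'x) cat_scheme \<Rightarrow> 'k rel \<Rightarrow> 'k rel \<Rightarrow> 'o set \<Rightarrow> ('o, 'm, 'm) presheaf \<Rightarrow> bool" where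
  "Mod_projective T \<kappa> \<alpha> \<C> P \<longleftrightarrow> is_Mod T \<kappa> \<alpha> \<C> P \<and>
     (\<forall>F G e t.
        is_Mod T \<kappa> \<alpha> \<C> F \<and> is_Mod T \<kappa> \<alpha> \<C> G \<and>
        is_Mod_map T \<C> F G e \<and> Mod_epi \<C> F G e \<and> is_Mod_map T \<C> P G t \<longrightarrow>
        (\<exists>s. is_Mod_map T \<C> P F s \<and>
             (\<forall>C \<in> \<C>. \<forall>x \<in> carrier (Val P C). e C (s C x) = t C x)))"

definition yonedaO :: "('o, 'm, 'x) precat_scheme \<Rightarrow> 'o \<Rightarrow> ('o, 'm, 'm) presheaf" where
  "yonedaO T X = \<lparr>Val = \<lambda>C. Hom_group T C X, Res = \<lambda>u x. x \<cdot>\<^bsub>T\<^esub> u\<rparr>"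

definition yonedaA :: "('o, 'm, 'x) cat_scheme \<Rightarrow> 'm \<Rightarrow> 'o \<Rightarrow> 'm \<Rightarrow> 'm" where
  "yonedaA T f = (\<lambda>C x. f \<cdot>\<^bsub>T\<^esub> x)"

definition phantom :: "('o, 'm, 'x) precat_scheme \<Rightarrow> 'o set \<Rightarrow> 'm \<Rightarrow> bool" where
  "phantom T \<C> f \<longleftrightarrow> f \<in> Arr T \<and>
     (\<forall>C \<in> \<C>. \<forall>x \<in> carrier (Val (yonedaO T (Dom T f)) C).
        yonedaA T f C x = \<one>\<^bsub>Val (yonedaO T (Cod T f)) C\<^esub>)"

inductive n_phantom :: "('o, 'm, 'x) precat_scheme \<Rightarrow> 'o set \<Rightarrow> nat \<Rightarrow> 'm \<Rightarrow> bool"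
  for T :: "('o, 'm, 'x) precat_scheme" and \<C> :: "'o set" where
  one: "phantom T \<C> f \<Longrightarrow> n_phantom T \<C> 1 f"
| step: "n_phantom T \<C> n f \<Longrightarrow> phantom T \<C> g \<Longrightarrow> Dom T g = Cod T f \<Longrightarrow>
     n_phantom T \<C> (Suc n) (g \<cdot>\<^bsub>T\<^esub> f)"

definition infinite_phantoms :: "('o, 'm, 'x) precat_scheme \<Rightarrow> 'o set \<Rightarrow> 'm set" where
  "infinite_phantoms T \<C> = {f. \<forall>n > 0. n_phantom T \<C> n f}"

record ('o, 'm) postnikov =
  pk_base :: 'o
  pk_X :: "nat \<Rightarrow> 'o"
  pk_P :: "nat \<Rightarrow> 'o"
  pk_f :: "nat \<Rightarrow> 'm"
  pk_i :: "nat \<Rightarrow> 'm"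
  pk_q :: "nat \<Rightarrow> 'm"
  pk_p :: "nat \<Rightarrow> 'm"

text \<open>\<open>prevX T R n\<close> is \<open>X\<^bsub>n-1\<^esub>\<close>, where \<open>X\<^bsub>-1\<^esub> = 0\<close>.\<close>

definition prevX :: "('o, 'm, 'x) cat_scheme \<Rightarrow> ('o, 'm) postnikov \<Rightarrow> nat \<Rightarrow> 'o" where
  "prevX T R n = (case n of 0 \<Rightarrow> zero_ob T | Suc k \<Rightarrow> pk_X R k)"

text \<open>\<open>S\<^sub>\<alpha>\<close> maps \<open>X \<leftarrow> P\<^sub>0 \<leftarrow> P\<^sub>1 \<leftarrow> \<cdots>\<close>, with augmentation \<open>e : P\<^sub>0 \<rightarrow> X\<close> of degree \<open>0\<close> and
  differentials \<open>d n : P\<^bsub>n+1\<^esub> \<rightarrow> \<Sigma> P\<^sub>n\<close> of degree \<open>+1\<close>, to a projective resolution of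
  \<open>S\<^sub>\<alpha> X\<close>. Exactness at \<open>P\<^sub>n\<close> is exactness at \<open>\<Sigma> P\<^sub>n\<close>, where the composite of graded
  morphisms is formed after suspending the second one.\<close>

definition graded_projective_resolution ::
  "('o, 'm, 'x) tricat_scheme \<Rightarrow> 'k rel \<Rightarrow> 'k rel \<Rightarrow> 'o set
     \<Rightarrow> 'o \<Rightarrow> (nat \<Rightarrow> 'o) \<Rightarrow> 'm \<Rightarrow> (nat \<Rightarrow> 'm) \<Rightarrow> bool" where
  "graded_projective_resolution T \<kappa> \<alpha> \<C> X P e d \<longleftrightarrow>
     e \<in> Hom T (P 0) X \<and>
     (\<forall>n. d n \<in> Hom T (P (Suc n)) (suspO T (P n))) \<and>
     is_Mod T \<kappa> \<alpha> \<C> (yonedaO T X) \<and>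
     (\<forall>n. Mod_projective T \<kappa> \<alpha> \<C> (yonedaO T (P n))) \<and>
     Mod_epi \<C> (yonedaO T (P 0)) (yonedaO T X) (yonedaA T e) \<and>
     Mod_exact \<C> (yonedaO T (P 1)) (yonedaA T (d 0))
       (yonedaO T (suspO T (P 0))) (yonedaA T (suspA T e)) (yonedaO T (suspO T X)) \<and>
     (\<forall>n. Mod_exact \<C> (yonedaO T (P (Suc (Suc n)))) (yonedaA T (d (Suc n)))
       (yonedaO T (suspO T (P (Suc n)))) (yonedaA T (suspA T (d n)))
       (yonedaO T (suspO T (suspO T (P n)))))"

text \<open>The degree \<open>0\<close> morphism \<open>p\<^sub>0 q\<^sub>0\<^bsup>-1\<^esup> : \<Sigma> P\<^sub>0 \<rightarrow> \<Sigma> X\<close> is the suspension of the augmentation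
  \<open>e : P\<^sub>0 \<rightarrow> X\<close>, which is unique since \<open>\<Sigma>\<close> is faithful.\<close>

definition is_postnikov ::
  "('o, 'm, 'x) tricat_scheme \<Rightarrow> 'k rel \<Rightarrow> 'k rel \<Rightarrow> 'o set \<Rightarrow> ('o, 'm) postnikov \<Rightarrow> bool" where
  "is_postnikov T \<kappa> \<alpha> \<C> R \<longleftrightarrow>
     pk_base R \<in> Ob T \<and>
     (\<forall>n. pk_P R n \<in> Add_closure T \<kappa> \<C>) \<and>
     (\<forall>n. exact_triangle T (pk_P R n) (prevX T R n) (pk_X R n) (pk_f R n) (pk_i R n) (pk_q R n)) \<and>
     (\<forall>n. pk_p R n \<in> Hom T (pk_X R n) (suspO T (pk_base R))) \<and>
     (\<forall>n. pk_p R n = pk_p R (Suc n) \<cdot>\<^bsub>T\<^esub> pk_i R (Suc n)) \<and>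
     (\<exists>e. suspA T e = pk_p R 0 \<cdot>\<^bsub>T\<^esub> inverse_arr T (pk_q R 0) \<and>
        graded_projective_resolution T \<kappa> \<alpha> \<C> (pk_base R) (pk_P R) e
          (\<lambda>n. pk_q R n \<cdot>\<^bsub>T\<^esub> pk_f R (Suc n)))"

record ('o, 'm) postnikov_map =
  pm_src :: "('o, 'm) postnikov"
  pm_tgt :: "('o, 'm) postnikov"
  pm_h :: 'm
  pm_psi :: "nat \<Rightarrow> 'm"
  pm_phi :: "nat \<Rightarrow> 'm"

text \<open>\<open>prevpsi T m n\<close> is \<open>\<psi>\<^bsub>n-1\<^esub>\<close>.\<close>

definition prevpsi :: "('o, 'm, 'x) precat_scheme \<Rightarrow> ('o, 'm) postnikov_map \<Rightarrow> nat \<Rightarrow> 'm" where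
  "prevpsi T m n = (case n of 0 \<Rightarrow> Zero T (zero_ob T) (zero_ob T) | Suc k \<Rightarrow> pm_psi m k)"

definition is_postnikov_map ::
  "('o, 'm, 'x) tricat_scheme \<Rightarrow> 'k rel \<Rightarrow> 'k rel \<Rightarrow> 'o set \<Rightarrow> ('o, 'm) postnikov_map \<Rightarrow> bool" where
  "is_postnikov_map T \<kappa> \<alpha> \<C> m \<longleftrightarrow>
     (let R = pm_src m; R' = pm_tgt m in
      is_postnikov T \<kappa> \<alpha> \<C> R \<and> is_postnikov T \<kappa> \<alpha> \<C> R' \<and>
      pm_h m \<in> Hom T (pk_base R) (pk_base R') \<and>
      (\<forall>n. pm_psi m n \<in> Hom T (pk_X R n) (pk_X R' n)) \<and>
      (\<forall>n. pm_phi m n \<in> Hom T (pk_P R n) (pk_P R' n)) \<and>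
      (\<forall>n. prevpsi T m n \<cdot>\<^bsub>T\<^esub> pk_f R n = pk_f R' n \<cdot>\<^bsub>T\<^esub> pm_phi m n) \<and>
      (\<forall>n. pm_psi m n \<cdot>\<^bsub>T\<^esub> pk_i R n = pk_i R' n \<cdot>\<^bsub>T\<^esub> prevpsi T m n) \<and>
      (\<forall>n. suspA T (pm_phi m n) \<cdot>\<^bsub>T\<^esub> pk_q R n = pk_q R' n \<cdot>\<^bsub>T\<^esub> pm_psi m n) \<and>
      (\<forall>n. suspA T (pm_h m) \<cdot>\<^bsub>T\<^esub> pk_p R n = pk_p R' n \<cdot>\<^bsub>T\<^esub> pm_psi m n))"

definition Pres ::
  "('o, 'm, 'x) tricat_scheme \<Rightarrow> 'k rel \<Rightarrow> 'k rel \<Rightarrow> 'o set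
     \<Rightarrow> (('o, 'm) postnikov, ('o, 'm) postnikov_map) precat" where
  "Pres T \<kappa> \<alpha> \<C> =
     \<lparr>Ob = {R. is_postnikov T \<kappa> \<alpha> \<C> R},
      Arr = {m. is_postnikov_map T \<kappa> \<alpha> \<C> m},
      Dom = pm_src,
      Cod = pm_tgt,
      Idn = \<lambda>R. \<lparr>pm_src = R, pm_tgt = R, pm_h = Idn T (pk_base R),
                 pm_psi = \<lambda>n. Idn T (pk_X R n), pm_phi = \<lambda>n. Idn T (pk_P R n)\<rparr>,
      Comp = \<lambda>m' m. \<lparr>pm_src = pm_src m, pm_tgt = pm_tgt m', pm_h = pm_h m' \<cdot>\<^bsub>T\<^esub> pm_h m,
                      pm_psi = \<lambda>n. pm_psi m' n \<cdot>\<^bsub>T\<^esub> pm_psi m n, pm_phi = \<lambda>n. pm_phi m' n \<cdot>\<^bsub>T\<^esub> pm_phi m n\<rparr>,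
      Add = \<lambda>m m'. \<lparr>pm_src = pm_src m, pm_tgt = pm_tgt m, pm_h = pm_h m \<oplus>\<^bsub>T\<^esub> pm_h m',
                      pm_psi = \<lambda>n. pm_psi m n \<oplus>\<^bsub>T\<^esub> pm_psi m' n, pm_phi = \<lambda>n. pm_phi m n \<oplus>\<^bsub>T\<^esub> pm_phi m' n\<rparr>,
      Zero = \<lambda>R R'. \<lparr>pm_src = R, pm_tgt = R', pm_h = Zero T (pk_base R) (pk_base R'),
                      pm_psi = \<lambda>n. Zero T (pk_X R n) (pk_X R' n), pm_phi = \<lambda>n. Zero T (pk_P R n) (pk_P R' n)\<rparr>\<rparr>"

definition homotopy_rel ::
  "('o, 'm, 'x) tricat_scheme \<Rightarrow> 'k rel \<Rightarrow> 'k rel \<Rightarrow> 'o set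
     \<Rightarrow> (('o, 'm) postnikov_map \<times> ('o, 'm) postnikov_map) set" where
  "homotopy_rel T \<kappa> \<alpha> \<C> =
     {(m, m'). is_postnikov_map T \<kappa> \<alpha> \<C> m \<and> is_postnikov_map T \<kappa> \<alpha> \<C> m' \<and>
        pm_src m = pm_src m' \<and> pm_tgt m = pm_tgt m' \<and>
        (\<forall>n > 0. pm_psi m n \<cdot>\<^bsub>T\<^esub> pk_i (pm_src m) n = pm_psi m' n \<cdot>\<^bsub>T\<^esub> pk_i (pm_src m) n)}"

definition Pres_homotopy ::
  "('o, 'm, 'x) tricat_scheme \<Rightarrow> 'k rel \<Rightarrow> 'k rel \<Rightarrow> 'o set
     \<Rightarrow> (('o, 'm) postnikov, ('o, 'm) postnikov_map set) precat" where
  "Pres_homotopy T \<kappa> \<alpha> \<C> = quotient_cat (Pres T \<kappa> \<alpha> \<C>) (homotopy_rel T \<kappa> \<alpha> \<C>)"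

text \<open>\<open>\<Psi>\<close> sends each \<open>X\<close> to a Postnikov resolution of \<open>X\<close>, and each \<open>h\<close> to the homotopy class of
  a morphism with first coordinate \<open>h\<close>. (Homotopic morphisms may have different first
  coordinates.)\<close>

definition is_resolution_functor ::
  "('o, 'm, 'x) tricat_scheme \<Rightarrow> 'k rel \<Rightarrow> 'k rel \<Rightarrow> 'o set
     \<Rightarrow> ('o, 'm, ('o, 'm) postnikov, ('o, 'm) postnikov_map set) func \<Rightarrow> bool" where
  "is_resolution_functor T \<kappa> \<alpha> \<C> \<Psi> \<longleftrightarrow>
     is_functor T (Pres_homotopy T \<kappa> \<alpha> \<C>) \<Psi> \<and>
     (\<forall>X \<in> Ob T. pk_base (FOb \<Psi> X) = X) \<and>
     (\<forall>h \<in> Arr T. \<exists>m \<in> FArr \<Psi> h. pm_h m = h)"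

end

theory Submission
  imports Defs
begin

text \<open>
  Let \<open>X\<^sub>n\<close> be the stages of a Postnikov resolution of \<open>X\<close>, \<open>P\<^sub>n\<close> its cells, and \<open>p\<^sub>n : X\<^sub>n \<rightarrow> \<Sigma> X\<close> its
  comparison maps. Write \<open>S C\<close> for the functor of maps out of an object \<open>C\<close> of the generating subcategory.
  The whole proof is relative homological algebra: an object of the additive closure
  lifts along every pair \<open>f, g\<close> which is exact after applying all \<open>S C\<close> (\<open>Add_lift\<close>), because this property
  passes to coproducts and retracts.

  Resolutions exist because every object \<open>W\<close> receives a map, surjective on all \<open>S C\<close>, from a coproduct of objects
  of the subcategory, whose cone \<open>W \<rightarrow> W'\<close> is a phantom map. Iterating this gives a tower of phantom maps
  \<open>X = W\<^sub>0 \<rightarrow> W\<^sub>1 \<rightarrow> \<dots>\<close>; the cones of the composites \<open>X \<rightarrow> W\<^bsub>n+1\<^esub>\<close> are the stages \<open>X\<^sub>n\<close>,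
  and the octahedral axiom fits the cells between them (\<open>ex_postnikov\<close>). That the cells represent projective
  modules is the computation of the module represented by a coproduct: by smallness every map from \<open>C\<close>
  into it lives on fewer than \<open>\<alpha>\<close> summands, whose coproduct lies in the subcategory again
  (\<open>coproduct_projective\<close>).

  Maps lift to resolutions because exactness of the resolution propagates to the stages: a map \<open>P \<rightarrow> X\<^bsub>n-1\<^esub>\<close> out of the additive
  closure which is killed by \<open>p\<^bsub>n-1\<^esub>\<close> factors through the cell \<open>P\<^sub>n\<close> (\<open>exact_at_X\<close>), while every map
  \<open>P \<rightarrow> \<Sigma> X\<close> lifts through \<open>p\<^sub>n\<close> (\<open>lift_through_p\<close>). A map \<open>h\<close> is lifted stage by stage: the first fact
  gives the map of cells, the axioms of a triangulated category give a map of stages, and the second fact repairs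
  its compatibility with the \<open>p\<^sub>n\<close> (\<open>lift_step\<close>).

  Lifts are unique up to homotopy, and more precisely a lift of \<open>h\<close> is null-homotopic exactly when \<open>\<Sigma> h\<close> kills all \<open>p\<^sub>n\<close>
  (\<open>null_homotopic_iff\<close>). The hard direction needs that maps from \<open>\<Sigma> X\<^sub>n\<close>, an object built
  from \<open>n + 1\<close> cells, to \<open>\<Sigma> Y\<close> lift through the \<open>n\<close>-th comparison map of any resolution of \<open>Y\<close> (\<open>lift_from_suspended_X\<close>).
  On the other hand the fibre \<open>X \<rightarrow> W\<^bsub>n+1\<^esub>\<close> of \<open>p\<^sub>n\<close> is a composite of \<open>n + 1\<close> phantom maps, and it is
  universal as such; so \<open>\<Sigma> h\<close> kills all \<open>p\<^sub>n\<close> exactly when \<open>h\<close> is an \<open>\<infinity>\<close>-phantom map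
  (\<open>infinite_phantoms_iff\<close>). Hence two lifts are homotopic if and only if their first coordinates differ by
  an \<open>\<infinity>\<close>-phantom map (\<open>homotopic_iff\<close>). All assertions about the functor are formal consequences: it is
  well defined, functorial, additive and unique because lifts of the same map are homotopic, it is full since
  a morphism of resolutions is a lift of its first coordinate, and an inverse of the induced functor takes a
  resolution to the object which it resolves.
\<close>

section \<open>Categories, preadditive categories and their quotients\<close>

abbreviation sub :: "('o, 'm, 'x) precat_scheme \<Rightarrow> 'm \<Rightarrow> 'm \<Rightarrow> 'm" (infixl "\<ominus>\<index>" 65) where
  "f \<ominus>\<^bsub>C\<^esub> g \<equiv> f \<oplus>\<^bsub>C\<^esub> neg C g"

lemma in_Hom: "f \<in> Hom C X Y \<longleftrightarrow> f \<in> Arr C \<and> Dom C f = X \<and> Cod C f = Y"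
  by (auto simp: Hom_def)

lemma HomI: "f \<in> Arr C \<Longrightarrow> Dom C f = X \<Longrightarrow> Cod C f = Y \<Longrightarrow> f \<in> Hom C X Y"
  by (simp add: in_Hom)

context category
begin

lemma Dom_Ob [simp]: "f \<in> Arr C \<Longrightarrow> Dom C f \<in> Ob C"
  and Cod_Ob [simp]: "f \<in> Arr C \<Longrightarrow> Cod C f \<in> Ob C"
  using dom_cod_in_Ob by auto

lemma Hom_Ob: "f \<in> Hom C X Y \<Longrightarrow> X \<in> Ob C" "f \<in> Hom C X Y \<Longrightarrow> Y \<in> Ob C"
  by (auto simp: in_Hom)

lemma Idn_Arr [simp]: "X \<in> Ob C \<Longrightarrow> Idn C X \<in> Arr C"
  and Dom_Idn [simp]: "X \<in> Ob C \<Longrightarrow> Dom C (Idn C X) = X"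
  and Cod_Idn [simp]: "X \<in> Ob C \<Longrightarrow> Cod C (Idn C X) = X"
  using Idn_in_Hom by (auto simp: in_Hom)

lemma Comp_Arr [simp]: "f \<in> Arr C \<Longrightarrow> g \<in> Arr C \<Longrightarrow> Dom C g = Cod C f \<Longrightarrow> g \<cdot> f \<in> Arr C"
  and Dom_Comp [simp]: "f \<in> Arr C \<Longrightarrow> g \<in> Arr C \<Longrightarrow> Dom C g = Cod C f \<Longrightarrow> Dom C (g \<cdot> f) = Dom C f"
  and Cod_Comp [simp]: "f \<in> Arr C \<Longrightarrow> g \<in> Arr C \<Longrightarrow> Dom C g = Cod C f \<Longrightarrow> Cod C (g \<cdot> f) = Cod C g"
  using Comp_in_Hom[of f "Dom C f" "Cod C f" g "Cod C g"] by (auto simp: in_Hom)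

lemma Comp_Idn' [simp]: "f \<in> Arr C \<Longrightarrow> Dom C f = X \<Longrightarrow> f \<cdot> Idn C X = f"
  and Idn_Comp' [simp]: "f \<in> Arr C \<Longrightarrow> Cod C f = X \<Longrightarrow> Idn C X \<cdot> f = f"
  by (auto simp: in_Hom intro!: Comp_Idn Idn_Comp)

lemma assoc [simp]: "f \<in> Arr C \<Longrightarrow> g \<in> Arr C \<Longrightarrow> h \<in> Arr C \<Longrightarrow> Dom C g = Cod C f \<Longrightarrow> Dom C h = Cod C g
    \<Longrightarrow> (h \<cdot> g) \<cdot> f = h \<cdot> (g \<cdot> f)"
  by (rule Comp_assoc) (auto simp: in_Hom)

text \<open>
  The simplifier keeps composites nested to the right, so an equation about \<open>g \<cdot> f\<close> no longer
  matches once a third factor follows. The two lemmas below restate it in front of such a factor.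
\<close>

lemma comp_extend:
  assumes "g \<cdot> f = k" "f \<in> Arr C" "g \<in> Arr C" "Dom C g = Cod C f"
    and "x \<in> Arr C" "Cod C x = Dom C f"
  shows "g \<cdot> (f \<cdot> x) = k \<cdot> x"
  using assms by auto

lemma comp_extend2:
  assumes "g \<cdot> f = k \<cdot> l" "f \<in> Arr C" "g \<in> Arr C" "Dom C g = Cod C f"
    and "l \<in> Arr C" "k \<in> Arr C" "Dom C k = Cod C l" "x \<in> Arr C" "Cod C x = Dom C f" "Dom C f = Dom C l"
  shows "g \<cdot> (f \<cdot> x) = k \<cdot> (l \<cdot> x)"
  using assms by (metis assoc)

lemma is_isoD:
  assumes "is_iso C f" "f \<in> Hom C X Y"
  obtains g where "g \<in> Hom C Y X" "g \<cdot> f = Idn C X" "f \<cdot> g = Idn C Y"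
  using assms unfolding is_iso_def is_inverse_def by (auto simp: in_Hom)

lemma is_isoI:
  assumes "f \<in> Hom C X Y" "g \<in> Hom C Y X" "g \<cdot> f = Idn C X" "f \<cdot> g = Idn C Y"
  shows "is_iso C f"
  using assms unfolding is_iso_def is_inverse_def by (auto simp: in_Hom)

lemma inverse_arr_eq:
  assumes "f \<in> Hom C X Y" "g \<in> Hom C Y X" "g \<cdot> f = Idn C X" "f \<cdot> g = Idn C Y"
  shows "inverse_arr C f = g"
  unfolding inverse_arr_def
proof (rule the_equality)
  show "is_inverse C f g" using assms by (auto simp: in_Hom is_inverse_def)
next
  fix k assume "is_inverse C f k"
  then have k: "k \<in> Hom C Y X" "k \<cdot> f = Idn C X" using assms by (auto simp: in_Hom is_inverse_def)
  have "k = k \<cdot> (f \<cdot> g)" using assms k by (simp add: in_Hom)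
  also have "\<dots> = (k \<cdot> f) \<cdot> g" using assms k(1) by (simp add: in_Hom)
  also have "\<dots> = g" using assms k by (simp add: in_Hom)
  finally show "k = g" .
qed

lemma is_iso_Idn: "X \<in> Ob C \<Longrightarrow> is_iso C (Idn C X)"
  by (rule is_isoI[of _ X X "Idn C X"]) (auto simp: in_Hom)

lemma zero_ob_unique:
  assumes "is_zero_ob C Z"
  shows "f \<in> Hom C Z X \<Longrightarrow> g \<in> Hom C Z X \<Longrightarrow> f = g" "f \<in> Hom C X Z \<Longrightarrow> g \<in> Hom C X Z \<Longrightarrow> f = g"
  using assms Hom_Ob[of f] unfolding is_zero_ob_def by blast+

lemma coproduct_ext:
  assumes "is_coproduct C I X A \<iota>" "u \<in> Hom C A Y" "v \<in> Hom C A Y" "\<And>i. i \<in> I \<Longrightarrow> u \<cdot> \<iota> i = v \<cdot> \<iota> i"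
  shows "u = v"
proof -
  have "Y \<in> Ob C" and "\<forall>i \<in> I. u \<cdot> \<iota> i \<in> Hom C (X i) Y"
    using assms unfolding is_coproduct_def by (auto simp: in_Hom)
  then have "\<exists>!w. w \<in> Hom C A Y \<and> (\<forall>i \<in> I. w \<cdot> \<iota> i = u \<cdot> \<iota> i)"
    using assms(1) unfolding is_coproduct_def by (elim conjE ballE[of "Ob C" _ Y] allE[of _ "\<lambda>i. u \<cdot> \<iota> i"]) auto
  then show ?thesis using assms by metis
qed

lemma coproduct_map:
  assumes "is_coproduct C I X A \<iota>" "Y \<in> Ob C" "\<And>i. i \<in> I \<Longrightarrow> g i \<in> Hom C (X i) Y"
  obtains u where "u \<in> Hom C A Y" "\<And>i. i \<in> I \<Longrightarrow> u \<cdot> \<iota> i = g i"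
  using assms unfolding is_coproduct_def by blast

lemma coproductD:
  assumes "is_coproduct C I X A \<iota>"
  shows "A \<in> Ob C" "\<And>i. i \<in> I \<Longrightarrow> \<iota> i \<in> Hom C (X i) A"
  using assms unfolding is_coproduct_def by auto

end

context preadditive_category
begin

lemma Hom_group_simps [simp]:
  "carrier (Hom_group C X Y) = Hom C X Y" "mult (Hom_group C X Y) = Add C" "one (Hom_group C X Y) = Zero C X Y"
  by (simp_all add: Hom_group_def)

lemma Zero_Arr [simp]: "X \<in> Ob C \<Longrightarrow> Y \<in> Ob C \<Longrightarrow> Zero C X Y \<in> Arr C"
  and Dom_Zero [simp]: "X \<in> Ob C \<Longrightarrow> Y \<in> Ob C \<Longrightarrow> Dom C (Zero C X Y) = X"
  and Cod_Zero [simp]: "X \<in> Ob C \<Longrightarrow> Y \<in> Ob C \<Longrightarrow> Cod C (Zero C X Y) = Y"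
  using comm_group.axioms(2)[OF Hom_comm_group, THEN group.is_monoid, THEN monoid.one_closed, of X Y]
  by (auto simp: in_Hom)

lemma Add_Arr [simp]: "f \<in> Arr C \<Longrightarrow> g \<in> Arr C \<Longrightarrow> Dom C g = Dom C f \<Longrightarrow> Cod C g = Cod C f \<Longrightarrow> f \<oplus> g \<in> Arr C"
  and Dom_Add [simp]: "f \<in> Arr C \<Longrightarrow> g \<in> Arr C \<Longrightarrow> Dom C g = Dom C f \<Longrightarrow> Cod C g = Cod C f \<Longrightarrow> Dom C (f \<oplus> g) = Dom C f"
  and Cod_Add [simp]: "f \<in> Arr C \<Longrightarrow> g \<in> Arr C \<Longrightarrow> Dom C g = Dom C f \<Longrightarrow> Cod C g = Cod C f \<Longrightarrow> Cod C (f \<oplus> g) = Cod C f"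
  using comm_group.axioms(2)[OF Hom_comm_group, THEN group.is_monoid, THEN monoid.m_closed, of "Dom C f" "Cod C f" f g]
  by (auto simp: in_Hom)

lemma neg_Arr [simp]: "f \<in> Arr C \<Longrightarrow> neg C f \<in> Arr C"
  and Dom_neg [simp]: "f \<in> Arr C \<Longrightarrow> Dom C (neg C f) = Dom C f"
  and Cod_neg [simp]: "f \<in> Arr C \<Longrightarrow> Cod C (neg C f) = Cod C f"
  using comm_group.axioms(2)[OF Hom_comm_group, THEN group.inv_closed, of "Dom C f" "Cod C f" f]
  by (auto simp: in_Hom neg_def)

lemma Add_assoc: "f \<in> Hom C X Y \<Longrightarrow> g \<in> Hom C X Y \<Longrightarrow> h \<in> Hom C X Y \<Longrightarrow> (f \<oplus> g) \<oplus> h = f \<oplus> (g \<oplus> h)"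
  using comm_group.axioms(2)[OF Hom_comm_group, THEN group.is_monoid, THEN monoid.m_assoc, of X Y f g h] Hom_Ob[of f]
  by auto

lemma Add_commute: "f \<in> Hom C X Y \<Longrightarrow> g \<in> Hom C X Y \<Longrightarrow> f \<oplus> g = g \<oplus> f"
  using comm_monoid.m_comm[OF comm_group.axioms(1)[OF Hom_comm_group], of X Y f g] Hom_Ob[of f] by auto

lemma Add_assoc': "f \<in> Arr C \<Longrightarrow> g \<in> Arr C \<Longrightarrow> h \<in> Arr C \<Longrightarrow> Dom C g = Dom C f \<Longrightarrow> Cod C g = Cod C f
    \<Longrightarrow> Dom C h = Dom C f \<Longrightarrow> Cod C h = Cod C f \<Longrightarrow> (f \<oplus> g) \<oplus> h = f \<oplus> (g \<oplus> h)"
  by (rule Add_assoc) (auto simp: in_Hom)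

lemma Add_commute': "f \<in> Arr C \<Longrightarrow> g \<in> Arr C \<Longrightarrow> Dom C g = Dom C f \<Longrightarrow> Cod C g = Cod C f \<Longrightarrow> f \<oplus> g = g \<oplus> f"
  by (rule Add_commute) (auto simp: in_Hom)

lemma Add_Zero [simp]: "f \<in> Arr C \<Longrightarrow> Dom C f = X \<Longrightarrow> Cod C f = Y \<Longrightarrow> f \<oplus> Zero C X Y = f"
  and Zero_Add [simp]: "f \<in> Arr C \<Longrightarrow> Dom C f = X \<Longrightarrow> Cod C f = Y \<Longrightarrow> Zero C X Y \<oplus> f = f"
  using comm_group.axioms(2)[OF Hom_comm_group, THEN group.is_monoid, THEN monoid.r_one, of X Y f]
    comm_group.axioms(2)[OF Hom_comm_group, THEN group.is_monoid, THEN monoid.l_one, of X Y f]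
  by (auto simp: in_Hom)

lemma Add_neg: "f \<in> Hom C X Y \<Longrightarrow> f \<ominus> f = Zero C X Y"
  and neg_Add: "f \<in> Hom C X Y \<Longrightarrow> neg C f \<oplus> f = Zero C X Y"
  using comm_group.axioms(2)[OF Hom_comm_group, THEN group.r_inv, of X Y f] Hom_Ob[of f]
    comm_group.axioms(2)[OF Hom_comm_group, THEN group.l_inv, of X Y f]
  by (auto simp: in_Hom neg_def)

lemma neg_unique: "f \<in> Hom C X Y \<Longrightarrow> g \<in> Hom C X Y \<Longrightarrow> g \<oplus> f = Zero C X Y \<Longrightarrow> neg C f = g"
  using comm_group.axioms(2)[OF Hom_comm_group, THEN group.inv_equality, of X Y g f] Hom_Ob[of f]
  by (auto simp: in_Hom neg_def)

lemma sub_eq_Zero_iff: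
  assumes "f \<in> Hom C X Y" "g \<in> Hom C X Y"
  shows "f \<ominus> g = Zero C X Y \<longleftrightarrow> f = g"
proof
  assume "f \<ominus> g = Zero C X Y"
  then have "neg C (neg C g) = f" using assms by (intro neg_unique[of _ X Y]) (auto simp: in_Hom)
  moreover have "neg C (neg C g) = g" using assms by (intro neg_unique[of _ X Y]) (auto simp: in_Hom Add_neg)
  ultimately show "f = g" by simp
qed (use assms Add_neg in auto)

lemma sub_Add_cancel: "f \<in> Hom C X Y \<Longrightarrow> g \<in> Hom C X Y \<Longrightarrow> (f \<ominus> g) \<oplus> g = f"
  using Add_assoc[of f X Y "neg C g" g] by (auto simp: in_Hom neg_Add)

lemma Comp_Zero [simp]: "f \<in> Arr C \<Longrightarrow> Dom C f = Y \<Longrightarrow> X \<in> Ob C \<Longrightarrow> f \<cdot> Zero C X Y = Zero C X (Cod C f)"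
proof -
  assume a: "f \<in> Arr C" "Dom C f = Y" "X \<in> Ob C"
  let ?z = "f \<cdot> Zero C X Y"
  have z: "?z \<in> Hom C X (Cod C f)" using a by (auto simp: in_Hom)
  have "f \<cdot> (Zero C X Y \<oplus> Zero C X Y) = ?z \<oplus> ?z"
    using a by (intro Add_Comp[of _ X Y]) (auto simp: in_Hom)
  then have "?z = ?z \<oplus> ?z" using a by auto
  then have "?z \<ominus> ?z = (?z \<oplus> ?z) \<ominus> ?z" by simp
  also have "\<dots> = ?z \<oplus> (?z \<ominus> ?z)" using z by (intro Add_assoc) (auto simp: in_Hom)
  finally show ?thesis using z by (simp add: Add_neg[OF z]) (simp add: in_Hom)
qed

lemma Zero_Comp [simp]: "f \<in> Arr C \<Longrightarrow> Cod C f = Y \<Longrightarrow> Z \<in> Ob C \<Longrightarrow> Zero C Y Z \<cdot> f = Zero C (Dom C f) Z"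
proof -
  assume a: "f \<in> Arr C" "Cod C f = Y" "Z \<in> Ob C"
  let ?z = "Zero C Y Z \<cdot> f"
  have z: "?z \<in> Hom C (Dom C f) Z" using a by (auto simp: in_Hom)
  have "(Zero C Y Z \<oplus> Zero C Y Z) \<cdot> f = ?z \<oplus> ?z"
    using a by (intro Comp_Add[of _ "Dom C f" Y]) (auto simp: in_Hom)
  then have "?z = ?z \<oplus> ?z" using a by auto
  then have "?z \<ominus> ?z = (?z \<oplus> ?z) \<ominus> ?z" by simp
  also have "\<dots> = ?z \<oplus> (?z \<ominus> ?z)" using z by (intro Add_assoc) (auto simp: in_Hom)
  finally show ?thesis using z by (simp add: Add_neg[OF z]) (simp add: in_Hom)
qed

lemma distrib_left [simp]: "f \<in> Arr C \<Longrightarrow> f' \<in> Arr C \<Longrightarrow> g \<in> Arr C \<Longrightarrow> Dom C f' = Dom C f \<Longrightarrow> Cod C f' = Cod C f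
    \<Longrightarrow> Dom C g = Cod C f \<Longrightarrow> g \<cdot> (f \<oplus> f') = (g \<cdot> f) \<oplus> (g \<cdot> f')"
  by (rule Add_Comp) (auto simp: in_Hom)

lemma distrib_right [simp]: "f \<in> Arr C \<Longrightarrow> g \<in> Arr C \<Longrightarrow> g' \<in> Arr C \<Longrightarrow> Dom C g' = Dom C g \<Longrightarrow> Cod C g' = Cod C g
    \<Longrightarrow> Dom C g = Cod C f \<Longrightarrow> (g \<oplus> g') \<cdot> f = (g \<cdot> f) \<oplus> (g' \<cdot> f)"
  by (rule Comp_Add) (auto simp: in_Hom)

lemma neg_comp [simp]: "f \<in> Arr C \<Longrightarrow> g \<in> Arr C \<Longrightarrow> Dom C g = Cod C f \<Longrightarrow> neg C g \<cdot> f = neg C (g \<cdot> f)"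
  by (rule neg_unique[symmetric, of _ "Dom C f" "Cod C g"])
    (auto simp: in_Hom distrib_right[symmetric] neg_Add[of _ "Dom C g" "Cod C g"] simp del: distrib_right)

lemma comp_neg [simp]: "f \<in> Arr C \<Longrightarrow> g \<in> Arr C \<Longrightarrow> Dom C g = Cod C f \<Longrightarrow> g \<cdot> neg C f = neg C (g \<cdot> f)"
  by (rule neg_unique[symmetric, of _ "Dom C f" "Cod C g"])
    (auto simp: in_Hom distrib_left[symmetric] neg_Add[of _ "Dom C f" "Cod C f"] simp del: distrib_left)

lemma neg_Zero [simp]: "X \<in> Ob C \<Longrightarrow> Y \<in> Ob C \<Longrightarrow> neg C (Zero C X Y) = Zero C X Y"
  by (rule neg_unique[of _ X Y]) (auto simp: in_Hom)

lemma neg_neg [simp]: "f \<in> Arr C \<Longrightarrow> neg C (neg C f) = f"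
  by (rule neg_unique[of _ "Dom C f" "Cod C f"]) (auto simp: in_Hom Add_neg)

lemma sub_self [simp]: "f \<in> Arr C \<Longrightarrow> f \<ominus> f = Zero C (Dom C f) (Cod C f)"
  by (rule Add_neg) (auto simp: in_Hom)

lemma sub_left_cancel: "f \<in> Hom C X Y \<Longrightarrow> g \<in> Hom C X Y \<Longrightarrow> f \<ominus> (f \<ominus> g) = g"
proof -
  assume a: "f \<in> Hom C X Y" "g \<in> Hom C X Y"
  have "(g \<ominus> f) \<oplus> (f \<ominus> g) = ((g \<ominus> f) \<oplus> f) \<ominus> g" using a by (intro Add_assoc[symmetric]) (auto simp: in_Hom)
  then have "(g \<ominus> f) \<oplus> (f \<ominus> g) = Zero C X Y" using a by (simp add: sub_Add_cancel Add_neg)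
  then have "neg C (f \<ominus> g) = g \<ominus> f" using a by (intro neg_unique[of _ X Y]) (auto simp: in_Hom)
  then have "f \<ominus> (f \<ominus> g) = (g \<ominus> f) \<oplus> f"
    using a Add_commute[of f X Y "g \<ominus> f"] by (auto simp: in_Hom)
  then show ?thesis using a by (simp add: sub_Add_cancel)
qed

lemma is_zero_obI:
  assumes "Z \<in> Ob C" "Idn C Z = Zero C Z Z"
  shows "is_zero_ob C Z"
proof -
  have 1: "f = Zero C Z X" if "f \<in> Hom C Z X" for f X
  proof -
    have "f = f \<cdot> Idn C Z" using that by (auto simp: in_Hom)
    then show ?thesis using that assms by (auto simp: in_Hom)
  qed
  have 2: "f = Zero C X Z" if "f \<in> Hom C X Z" for f X
  proof -
    have "f = Idn C Z \<cdot> f" using that by (auto simp: in_Hom)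
    then show ?thesis using that assms by (auto simp: in_Hom)
  qed
  show ?thesis unfolding is_zero_ob_def
  proof (intro conjI ballI)
    fix X assume "X \<in> Ob C"
    show "\<exists>!f. f \<in> Hom C Z X" by (rule ex1I[of _ "Zero C Z X"]) (use \<open>X \<in> Ob C\<close> assms 1 in \<open>auto simp: in_Hom\<close>)
    show "\<exists>!f. f \<in> Hom C X Z" by (rule ex1I[of _ "Zero C X Z"]) (use \<open>X \<in> Ob C\<close> assms 2 in \<open>auto simp: in_Hom\<close>)
  qed (use assms in auto)
qed

lemma zero_ob_Hom:
  assumes "is_zero_ob C Z"
  shows "f \<in> Hom C Z X \<Longrightarrow> f = Zero C Z X" "f \<in> Hom C X Z \<Longrightarrow> f = Zero C X Z"
proof -
  assume f: "f \<in> Hom C Z X"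
  show "f = Zero C Z X"
    by (rule zero_ob_unique(1)[OF assms f]) (use Hom_Ob[OF f] in \<open>simp add: in_Hom\<close>)
next
  assume f: "f \<in> Hom C X Z"
  show "f = Zero C X Z"
    by (rule zero_ob_unique(2)[OF assms f]) (use Hom_Ob[OF f] in \<open>simp add: in_Hom\<close>)
qed

lemma zero_ob_Idn: "is_zero_ob C Z \<Longrightarrow> Idn C Z = Zero C Z Z"
  by (rule zero_ob_Hom) (auto simp: in_Hom is_zero_ob_def)

end

text \<open>
  The operations of \<open>quotient_cat C R\<close> are computed on representatives picked by choice. Under these
  conditions the results do not depend on the choice, and all axioms are inherited from \<open>C\<close>.
\<close>

locale additive_congruence = preadditive_category C
  for C :: "('o, 'm, 'x) precat_scheme" (structure) +
  fixes R :: "('m \<times> 'm) set"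
  assumes equiv_R: "equiv (Arr C) R"
    and parallel: "(f, g) \<in> R \<Longrightarrow> Dom C f = Dom C g \<and> Cod C f = Cod C g"
    and comp_cong: "(f, f') \<in> R \<Longrightarrow> (g, g') \<in> R \<Longrightarrow> Dom C g = Cod C f \<Longrightarrow> (g \<cdot> f, g' \<cdot> f') \<in> R"
    and add_cong: "(f, f') \<in> R \<Longrightarrow> (g, g') \<in> R \<Longrightarrow> Dom C g = Dom C f \<Longrightarrow> Cod C g = Cod C f
            \<Longrightarrow> (f \<oplus> g, f' \<oplus> g') \<in> R"
begin

abbreviation "cls f \<equiv> R `` {f}"
abbreviation "Q \<equiv> quotient_cat C R"

lemma rep: "f \<in> Arr C \<Longrightarrow> (f, SOME g. g \<in> cls f) \<in> R"
  using someI[of "\<lambda>g. g \<in> cls f" f] equiv_R unfolding equiv_def refl_on_def by auto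

lemma cls_eq_iff: "f \<in> Arr C \<Longrightarrow> g \<in> Arr C \<Longrightarrow> cls f = cls g \<longleftrightarrow> (f, g) \<in> R"
  using eq_equiv_class_iff[OF equiv_R] .

lemma cls_eqI: "(f, g) \<in> R \<Longrightarrow> cls f = cls g"
  using equiv_class_eq[OF equiv_R] .

lemma Q_Ob [simp]: "Ob Q = Ob C"
  by (simp add: quotient_cat_def)

lemma Q_Arr: "A \<in> Arr Q \<longleftrightarrow> (\<exists>f \<in> Arr C. A = cls f)"
  by (auto simp: quotient_cat_def quotient_def)

lemma cls_Arr [simp]: "f \<in> Arr C \<Longrightarrow> cls f \<in> Arr Q"
  by (auto simp: Q_Arr)

lemma Q_Dom [simp]: "f \<in> Arr C \<Longrightarrow> Dom Q (cls f) = Dom C f"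
  and Q_Cod [simp]: "f \<in> Arr C \<Longrightarrow> Cod Q (cls f) = Cod C f"
  using parallel[OF rep, of f] by (auto simp: quotient_cat_def)

lemma Q_Comp [simp]: "f \<in> Arr C \<Longrightarrow> g \<in> Arr C \<Longrightarrow> Dom C g = Cod C f \<Longrightarrow> cls g \<cdot>\<^bsub>Q\<^esub> cls f = cls (g \<cdot> f)"
  using cls_eqI[OF comp_cong[OF rep rep, of f g]] by (auto simp: quotient_cat_def)

lemma Q_Add [simp]: "f \<in> Arr C \<Longrightarrow> g \<in> Arr C \<Longrightarrow> Dom C g = Dom C f \<Longrightarrow> Cod C g = Cod C f
    \<Longrightarrow> cls f \<oplus>\<^bsub>Q\<^esub> cls g = cls (f \<oplus> g)"
  using cls_eqI[OF add_cong[OF rep rep, of f g]] by (auto simp: quotient_cat_def)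

lemma Q_Idn [simp]: "Idn Q X = cls (Idn C X)"
  and Q_Zero [simp]: "Zero Q X Y = cls (Zero C X Y)"
  by (simp_all add: quotient_cat_def)

lemma Q_Hom: "A \<in> Hom Q X Y \<longleftrightarrow> (\<exists>f \<in> Hom C X Y. A = cls f)"
  by (auto simp: in_Hom Q_Arr)

lemma Q_HomE:
  assumes "F \<in> Hom Q X Y"
  obtains f where "F = cls f" "f \<in> Arr C" "Dom C f = X" "Cod C f = Y"
  using assms unfolding Q_Hom by (auto simp: in_Hom)

lemma Q_Hom_clsI [simp]: "f \<in> Arr C \<Longrightarrow> cls f \<in> Hom Q X Y \<longleftrightarrow> Dom C f = X \<and> Cod C f = Y"
  by (simp add: in_Hom)

lemma Q_preadditive: "preadditive_category Q"
proof (intro preadditive_category.intro category.intro preadditive_category_axioms.intro)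
  fix F assume "F \<in> Arr Q"
  then show "Dom Q F \<in> Ob Q \<and> Cod Q F \<in> Ob Q" by (auto simp: Q_Arr)
next
  fix X assume "X \<in> Ob Q"
  then show "Idn Q X \<in> Hom Q X X" by simp
next
  fix F G X Y Z assume "F \<in> Hom Q X Y" "G \<in> Hom Q Y Z"
  then show "G \<cdot>\<^bsub>Q\<^esub> F \<in> Hom Q X Z" by (auto elim!: Q_HomE)
next
  fix F X Y assume "F \<in> Hom Q X Y"
  then show "F \<cdot>\<^bsub>Q\<^esub> Idn Q X = F" "Idn Q Y \<cdot>\<^bsub>Q\<^esub> F = F" by (auto elim!: Q_HomE)
next
  fix F G H W X Y Z assume "F \<in> Hom Q W X" "G \<in> Hom Q X Y" "H \<in> Hom Q Y Z"
  then show "(H \<cdot>\<^bsub>Q\<^esub> G) \<cdot>\<^bsub>Q\<^esub> F = H \<cdot>\<^bsub>Q\<^esub> (G \<cdot>\<^bsub>Q\<^esub> F)" by (auto elim!: Q_HomE)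
next
  fix X Y assume XY: "X \<in> Ob Q" "Y \<in> Ob Q"
  show "comm_group (Hom_group Q X Y)"
  proof (rule comm_groupI, unfold Hom_group_def, simp_all)
    fix F G assume "F \<in> Hom Q X Y" "G \<in> Hom Q X Y"
    then show "F \<oplus>\<^bsub>Q\<^esub> G \<in> Hom Q X Y" "F \<oplus>\<^bsub>Q\<^esub> G = G \<oplus>\<^bsub>Q\<^esub> F"
      by (auto elim!: Q_HomE simp: Add_commute')
  next
    fix F G H assume "F \<in> Hom Q X Y" "G \<in> Hom Q X Y" "H \<in> Hom Q X Y"
    then show "F \<oplus>\<^bsub>Q\<^esub> G \<oplus>\<^bsub>Q\<^esub> H = F \<oplus>\<^bsub>Q\<^esub> (G \<oplus>\<^bsub>Q\<^esub> H)"
      by (auto elim!: Q_HomE simp: Add_assoc')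
  next
    show "cls (Zero C X Y) \<in> Hom Q X Y" using XY by simp
  next
    fix F assume "F \<in> Hom Q X Y"
    then obtain f where f: "f \<in> Hom C X Y" "F = cls f" by (auto simp: Q_Hom)
    show "cls (Zero C X Y) \<oplus>\<^bsub>Q\<^esub> F = F" using f XY by (auto simp: in_Hom)
    show "\<exists>G \<in> Hom Q X Y. G \<oplus>\<^bsub>Q\<^esub> F = cls (Zero C X Y)"
      using f XY by (intro bexI[of _ "cls (neg C f)"]) (auto simp: in_Hom neg_Add)
  qed
next
  fix F G G' X Y Z assume "F \<in> Hom Q X Y" "G \<in> Hom Q Y Z" "G' \<in> Hom Q Y Z"
  then show "(G \<oplus>\<^bsub>Q\<^esub> G') \<cdot>\<^bsub>Q\<^esub> F = (G \<cdot>\<^bsub>Q\<^esub> F) \<oplus>\<^bsub>Q\<^esub> (G' \<cdot>\<^bsub>Q\<^esub> F)" by (auto elim!: Q_HomE)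
next
  fix F F' G X Y Z assume "F \<in> Hom Q X Y" "F' \<in> Hom Q X Y" "G \<in> Hom Q Y Z"
  then show "G \<cdot>\<^bsub>Q\<^esub> (F \<oplus>\<^bsub>Q\<^esub> F') = (G \<cdot>\<^bsub>Q\<^esub> F) \<oplus>\<^bsub>Q\<^esub> (G \<cdot>\<^bsub>Q\<^esub> F')" by (auto elim!: Q_HomE)
qed

end

section \<open>Triangulated categories\<close>

lemma functorD:
  assumes "is_functor C D F"
  shows "category C" "category D" "X \<in> Ob C \<Longrightarrow> FOb F X \<in> Ob D"
    and "f \<in> Hom C X Y \<Longrightarrow> FArr F f \<in> Hom D (FOb F X) (FOb F Y)"
    and "X \<in> Ob C \<Longrightarrow> FArr F (Idn C X) = Idn D (FOb F X)"
    and "f \<in> Hom C X Y \<Longrightarrow> g \<in> Hom C Y Z \<Longrightarrow> FArr F (g \<cdot>\<^bsub>C\<^esub> f) = FArr F g \<cdot>\<^bsub>D\<^esub> FArr F f"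
  using assms unfolding is_functor_def by (auto simp: in_Hom)

lemma (in category) split_mono_cancel:
  assumes m: "m \<in> Hom C X Y" "k \<in> Hom C Y X" "k \<cdot> m = Idn C X"
    and f: "f \<in> Hom C W X" "g \<in> Hom C W X" "m \<cdot> f = m \<cdot> g"
  shows "f = g"
proof -
  have "f = k \<cdot> m \<cdot> f" using comp_extend[OF m(3), of f] m f by (simp add: in_Hom)
  also have "\<dots> = g" unfolding f(3) using comp_extend[OF m(3), of g] m f by (simp add: in_Hom)
  finally show ?thesis .
qed

text \<open>
  Naturality expresses \<open>f \<cdot> \<eta>\<close> through the image of \<open>f\<close>, and the isomorphism \<open>\<eta>\<close> can be cancelled.
\<close>

lemma functor_isomorphic_to_id_faithful:
  fixes C (structure)
  assumes "category C" "is_functor C C H" "naturally_isomorphic C C H id_func"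
    and f: "f \<in> Hom C X Y" and g: "g \<in> Hom C X Y" and "FArr H f = FArr H g"
  shows "f = g"
proof -
  interpret category C by fact
  obtain \<eta> where \<eta>: "\<And>X. X \<in> Ob C \<Longrightarrow> \<eta> X \<in> Hom C (FOb H X) X \<and> is_iso C (\<eta> X)"
    and nat: "\<And>f. f \<in> Arr C \<Longrightarrow> \<eta> (Cod C f) \<cdot> FArr H f = f \<cdot> \<eta> (Dom C f)"
    using assms(3) unfolding naturally_isomorphic_def id_func_def by auto
  have X: "X \<in> Ob C" using f by (rule Hom_Ob)
  then have eX: "\<eta> X \<in> Hom C (FOb H X) X" using \<eta> by blast
  from \<eta>[OF X] obtain k where k: "k \<in> Hom C X (FOb H X)" "\<eta> X \<cdot> k = Idn C X"
    using is_isoD by metis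
  have "f \<cdot> \<eta> X = g \<cdot> \<eta> X" using nat[of f] nat[of g] f g assms(6) by (auto simp: in_Hom)
  then have "(f \<cdot> \<eta> X) \<cdot> k = (g \<cdot> \<eta> X) \<cdot> k" by simp
  then show ?thesis using k eX f g by (simp add: in_Hom)
qed

lemma comp_func_functor: "is_functor C D F \<Longrightarrow> is_functor D E G \<Longrightarrow> is_functor C E (comp_func G F)"
  unfolding is_functor_def comp_func_def by (auto simp: in_Hom)

lemma equivalence_faithful:
  assumes "is_equivalence C D F" "f \<in> Hom C X Y" "g \<in> Hom C X Y" "FArr F f = FArr F g"
  shows "f = g"
proof -
  obtain G where "is_functor C D F" "is_functor D C G" "naturally_isomorphic C C (comp_func G F) id_func"
    using assms(1) unfolding is_equivalence_def by auto
  then show ?thesis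
    using functor_isomorphic_to_id_faithful[OF functorD(1)[of C D F] comp_func_functor[of C D F C G]] assms(2-)
    by (auto simp: comp_func_def)
qed

text \<open>
  The preimage of \<open>k\<close> is \<open>G k\<close> conjugated with the unit. Naturality only shows that \<open>G\<close> sends its
  image to \<open>G k\<close>; faithfulness of \<open>G\<close>, which follows from the counit, finishes the proof.
\<close>

lemma equivalence_full:
  fixes C (structure)
  assumes "is_equivalence C D F" and XY: "X \<in> Ob C" "Y \<in> Ob C" and k: "k \<in> Hom D (FOb F X) (FOb F Y)"
  obtains f where "f \<in> Hom C X Y" "FArr F f = k"
proof -
  obtain G where F: "is_functor C D F" and G: "is_functor D C G"
    and GF: "naturally_isomorphic C C (comp_func G F) id_func" and FG: "naturally_isomorphic D D (comp_func F G) id_func"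
    using assms(1) unfolding is_equivalence_def by auto
  interpret category C using functorD(1)[OF F] .
  note FD = functorD(3-)[OF F] and GD = functorD(3-)[OF G]
  obtain \<eta> where \<eta>: "\<And>X. X \<in> Ob C \<Longrightarrow> \<eta> X \<in> Hom C (FOb G (FOb F X)) X \<and> is_iso C (\<eta> X)"
    and nat: "\<And>f. f \<in> Arr C \<Longrightarrow> \<eta> (Cod C f) \<cdot> FArr G (FArr F f) = f \<cdot> \<eta> (Dom C f)"
    using GF unfolding naturally_isomorphic_def id_func_def comp_func_def by auto
  obtain eX where eX: "eX \<in> Hom C X (FOb G (FOb F X))" "eX \<cdot> \<eta> X = Idn C (FOb G (FOb F X))"
    using \<eta>[OF XY(1)] is_isoD by metis
  obtain eY where eY: "eY \<in> Hom C Y (FOb G (FOb F Y))" "eY \<cdot> \<eta> Y = Idn C (FOb G (FOb F Y))"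
    using \<eta>[OF XY(2)] is_isoD by metis
  have Gk: "FArr G k \<in> Hom C (FOb G (FOb F X)) (FOb G (FOb F Y))" using GD(2) k .
  define f where "f = \<eta> Y \<cdot> FArr G k \<cdot> eX"
  have f: "f \<in> Hom C X Y" using \<eta>[OF XY(2)] Gk eX unfolding f_def by (auto simp: in_Hom)
  have GFf: "FArr G (FArr F f) \<in> Hom C (FOb G (FOb F X)) (FOb G (FOb F Y))" using GD(2) FD(2) f by blast
  have "\<eta> Y \<cdot> FArr G (FArr F f) = f \<cdot> \<eta> X" using nat[of f] f by (auto simp: in_Hom)
  also have "\<dots> = \<eta> Y \<cdot> FArr G k" unfolding f_def
    using \<eta>[OF XY(1)] \<eta>[OF XY(2)] eX Gk by (simp add: in_Hom)
  finally have "\<eta> Y \<cdot> FArr G (FArr F f) = \<eta> Y \<cdot> FArr G k" .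
  then have "FArr G (FArr F f) = FArr G k"
    using split_mono_cancel[OF _ eY GFf Gk] \<eta>[OF XY(2)] by blast
  then have "FArr (comp_func F G) (FArr F f) = FArr (comp_func F G) k" by (simp add: comp_func_def)
  then have "FArr F f = k"
    using functor_isomorphic_to_id_faithful[OF functorD(2)[OF F] comp_func_functor[OF G F] FG FD(2)[OF f] k] by simp
  then show ?thesis using f that by blast
qed

lemma equivalence_ess_surj:
  assumes "is_equivalence C D F" "Z \<in> Ob D"
  obtains X \<epsilon> where "X \<in> Ob C" "\<epsilon> \<in> Hom D (FOb F X) Z" "is_iso D \<epsilon>"
proof -
  obtain G where G: "is_functor D C G" and FG: "naturally_isomorphic D D (comp_func F G) id_func"
    using assms(1) unfolding is_equivalence_def by auto
  then obtain \<epsilon> where "\<epsilon> Z \<in> Hom D (FOb F (FOb G Z)) Z \<and> is_iso D (\<epsilon> Z)"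
    using assms(2) unfolding naturally_isomorphic_def id_func_def comp_func_def by auto
  then show ?thesis using that functorD(3)[OF G assms(2)] by blast
qed

lemma (in preadditive_category) additive_functor_Zero:
  assumes "is_additive_functor C D F" "X \<in> Ob C" "Y \<in> Ob C"
  shows "FArr F (Zero C X Y) = Zero D (FOb F X) (FOb F Y)"
proof -
  interpret D: preadditive_category D using assms(1) unfolding is_additive_functor_def by simp
  have F: "is_functor C D F" using assms(1) unfolding is_additive_functor_def by simp
  let ?z = "FArr F (Zero C X Y)"
  have z0: "Zero C X Y \<in> Hom C X Y" using assms by (simp add: in_Hom)
  have z: "?z \<in> Hom D (FOb F X) (FOb F Y)" using functorD(4)[OF F z0] .
  have "FArr F (Zero C X Y \<oplus> Zero C X Y) = ?z \<oplus>\<^bsub>D\<^esub> ?z"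
    using assms z0 unfolding is_additive_functor_def by blast
  then have zz: "?z = ?z \<oplus>\<^bsub>D\<^esub> ?z" using assms by simp
  then have "?z \<ominus>\<^bsub>D\<^esub> ?z = (?z \<oplus>\<^bsub>D\<^esub> ?z) \<ominus>\<^bsub>D\<^esub> ?z" by simp
  also have "\<dots> = ?z \<oplus>\<^bsub>D\<^esub> (?z \<ominus>\<^bsub>D\<^esub> ?z)" using z by (intro D.Add_assoc) (auto simp: in_Hom)
  finally show ?thesis using z by (simp add: D.Add_neg[OF z]) (simp add: in_Hom)
qed

lemma (in preadditive_category) additive_functor_neg:
  assumes "is_additive_functor C D F" "f \<in> Hom C X Y"
  shows "FArr F (neg C f) = neg D (FArr F f)"
proof -
  interpret D: preadditive_category D using assms(1) unfolding is_additive_functor_def by simp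
  have F: "is_functor C D F" using assms(1) unfolding is_additive_functor_def by simp
  have n: "neg C f \<in> Hom C X Y" using assms by (simp add: in_Hom)
  have XY: "X \<in> Ob C" "Y \<in> Ob C" using Hom_Ob[OF assms(2)] .
  have "FArr F (neg C f) \<oplus>\<^bsub>D\<^esub> FArr F f = FArr F (neg C f \<oplus> f)"
    using assms n XY unfolding is_additive_functor_def by metis
  also have "\<dots> = Zero D (FOb F X) (FOb F Y)"
    using assms XY by (simp add: neg_Add additive_functor_Zero)
  finally show ?thesis
    by (intro D.neg_unique[symmetric, of _ "FOb F X" "FOb F Y"] functorD(4)[OF F] assms n)
qed

context additive_category
begin

lemma zero_ob_is_zero: "is_zero_ob C (zero_ob C)"
  unfolding zero_ob_def using ex_zero_ob by (rule someI_ex)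

lemma zero_ob_Ob [simp]: "zero_ob C \<in> Ob C"
  using zero_ob_is_zero unfolding is_zero_ob_def by simp

end

context triangulated_category
begin

abbreviation "SO \<equiv> suspO T"
abbreviation "SA \<equiv> suspA T"

lemma susp_functor: "is_functor T T (Susp T)"
  using susp_additive unfolding is_additive_functor_def by simp

lemma SO_Ob [simp]: "X \<in> Ob T \<Longrightarrow> SO X \<in> Ob T"
  and SA_Arr [simp]: "f \<in> Arr T \<Longrightarrow> SA f \<in> Arr T"
  and Dom_SA [simp]: "f \<in> Arr T \<Longrightarrow> Dom T (SA f) = SO (Dom T f)"
  and Cod_SA [simp]: "f \<in> Arr T \<Longrightarrow> Cod T (SA f) = SO (Cod T f)"
  and SA_Idn [simp]: "X \<in> Ob T \<Longrightarrow> SA (Idn T X) = Idn T (SO X)"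
  and SA_Comp [simp]: "f \<in> Arr T \<Longrightarrow> g \<in> Arr T \<Longrightarrow> Dom T g = Cod T f \<Longrightarrow> SA (g \<cdot> f) = SA g \<cdot> SA f"
  using susp_functor unfolding is_functor_def by (auto simp: in_Hom)

lemma SA_Add [simp]: "f \<in> Arr T \<Longrightarrow> g \<in> Arr T \<Longrightarrow> Dom T g = Dom T f \<Longrightarrow> Cod T g = Cod T f
    \<Longrightarrow> SA (f \<oplus> g) = SA f \<oplus> SA g"
  using susp_additive HomI[of f T "Dom T f" "Cod T f"] HomI[of g T "Dom T f" "Cod T f"] dom_cod_in_Ob[of f]
  unfolding is_additive_functor_def by blast

lemma SA_Zero [simp]: "X \<in> Ob T \<Longrightarrow> Y \<in> Ob T \<Longrightarrow> SA (Zero T X Y) = Zero T (SO X) (SO Y)"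
  by (rule additive_functor_Zero[OF susp_additive])

lemma SA_neg [simp]: "f \<in> Arr T \<Longrightarrow> SA (neg T f) = neg T (SA f)"
  by (rule additive_functor_neg[OF susp_additive, of _ "Dom T f" "Cod T f"]) (simp add: in_Hom)

lemma SA_comp_eq: "g \<cdot> f = k \<Longrightarrow> f \<in> Arr T \<Longrightarrow> g \<in> Arr T \<Longrightarrow> Dom T g = Cod T f \<Longrightarrow> SA g \<cdot> SA f = SA k"
  by auto

lemma SA_faithful: "f \<in> Hom T X Y \<Longrightarrow> g \<in> Hom T X Y \<Longrightarrow> SA f = SA g \<Longrightarrow> f = g"
  by (rule equivalence_faithful[OF susp_equivalence])

lemma SA_full:
  assumes "k \<in> Hom T (SO X) (SO Y)" "X \<in> Ob T" "Y \<in> Ob T"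
  obtains f where "f \<in> Hom T X Y" "SA f = k"
  using equivalence_full[OF susp_equivalence assms(2,3,1)] by blast

lemma SO_ess_surj:
  assumes "Z \<in> Ob T"
  obtains X j j' where "X \<in> Ob T" "j \<in> Hom T (SO X) Z" "j' \<in> Hom T Z (SO X)" "j' \<cdot> j = Idn T (SO X)" "j \<cdot> j' = Idn T Z"
  using equivalence_ess_surj[OF susp_equivalence assms] is_isoD by metis

lemma SO_zero: "is_zero_ob T Z \<Longrightarrow> is_zero_ob T (SO Z)"
  by (rule is_zero_obI) (use zero_ob_Idn[of Z] in \<open>auto simp: is_zero_ob_def simp flip: SA_Idn\<close>)

lemma triD:
  assumes "exact_triangle T X Y Z f g h"
  shows "f \<in> Hom T X Y" "g \<in> Hom T Y Z" "h \<in> Hom T Z (SO X)" "X \<in> Ob T" "Y \<in> Ob T" "Z \<in> Ob T"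
  using assms unfolding exact_triangle_def candidate_triangle_def by (auto simp: in_Hom)

lemma tri_rot: "exact_triangle T X Y Z f g h \<Longrightarrow> exact_triangle T Y Z (SO X) g h (neg T (SA f))"
  using triangle_rotate[of X Y Z f g h] unfolding exact_triangle_def by auto

text \<open>
  The trivial triangle on \<open>X\<close> maps to the given one by the identity and \<open>f\<close>, so \<open>g \<cdot> f\<close> factors
  through its third vertex, which is zero.
\<close>

lemma tri_comp1:
  assumes "exact_triangle T X Y Z f g h"
  shows "g \<cdot> f = Zero T X Z"
proof -
  note d = triD[OF assms]
  have "exact_triangle T X X (zero_ob T) (Idn T X) (Zero T X (zero_ob T)) (Zero T (zero_ob T) (SO X))"
    using triangle_id[OF d(4) zero_ob_is_zero] .
  from triangle_morphism[OF this assms, of "Idn T X" f] d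
  obtain c where "c \<in> Hom T (zero_ob T) Z" "c \<cdot> Zero T X (zero_ob T) = g \<cdot> f" by (auto simp: in_Hom)
  then show ?thesis using d by (auto simp: in_Hom)
qed

lemma tri_comp2: "exact_triangle T X Y Z f g h \<Longrightarrow> h \<cdot> g = Zero T Y (SO X)"
  using tri_comp1[OF tri_rot] .

lemma neg_inject: "neg T f = neg T g \<Longrightarrow> f \<in> Arr T \<Longrightarrow> g \<in> Arr T \<Longrightarrow> f = g"
  by (metis neg_neg)

lemma neg_eq_ZeroD: "f \<in> Hom T X Y \<Longrightarrow> neg T f = Zero T X Y \<Longrightarrow> f = Zero T X Y"
  using neg_neg[of f] Hom_Ob[of f X Y] by (auto simp: in_Hom)

lemma tri_comp3:
  assumes "exact_triangle T X Y Z f g h"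
  shows "SA f \<cdot> h = Zero T Z (SO Y)"
proof (rule neg_eq_ZeroD)
  note d = triD[OF assms]
  show "SA f \<cdot> h \<in> Hom T Z (SO Y)" using d by (simp add: in_Hom)
  show "neg T (SA f \<cdot> h) = Zero T Z (SO Y)"
    using tri_comp1[OF tri_rot[OF tri_rot[OF assms]]] d by (simp add: in_Hom)
qed

text \<open>
  Compare with the trivial triangle on \<open>W\<close>, both rotated once: the third component is a map
  \<open>\<Sigma> W \<rightarrow> \<Sigma> X\<close>, whose desuspension is the required lift.
\<close>

lemma tri_lift1:
  assumes tri: "exact_triangle T X Y Z f g h" and u: "u \<in> Hom T W Y" "g \<cdot> u = Zero T W Z"
  obtains x where "x \<in> Hom T W X" "f \<cdot> x = u"
proof -
  note d = triD[OF tri]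
  have W: "W \<in> Ob T" using u by (auto simp: in_Hom)
  let ?z = "zero_ob T"
  have "exact_triangle T W ?z (SO W) (Zero T W ?z) (Zero T ?z (SO W)) (neg T (SA (Idn T W)))"
    using tri_rot[OF triangle_id[OF W zero_ob_is_zero]] .
  from triangle_morphism[OF this tri_rot[OF tri], of u "Zero T ?z Z"] u d W
  obtain c where c: "c \<in> Hom T (SO W) (SO X)" "SA u \<cdot> neg T (SA (Idn T W)) = neg T (SA f) \<cdot> c"
    by (auto simp: in_Hom)
  obtain x where x: "x \<in> Hom T W X" "SA x = c" using SA_full[OF c(1) W d(4)] .
  have "neg T (SA u) = neg T (SA (f \<cdot> x))" using c x d u W by (simp add: in_Hom)
  then have "SA u = SA (f \<cdot> x)" by (rule neg_inject) (use u d x c(1) in \<open>simp_all add: in_Hom\<close>)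
  then have "f \<cdot> x = u" using SA_faithful[of u W Y "f \<cdot> x"] u d x by (simp add: in_Hom)
  then show ?thesis using that x by blast
qed

lemma tri_lift2:
  assumes "exact_triangle T X Y Z f g h" "u \<in> Hom T W Z" "h \<cdot> u = Zero T W (SO X)"
  obtains x where "x \<in> Hom T W Y" "g \<cdot> x = u"
  using tri_lift1[OF tri_rot[OF assms(1)] assms(2,3)] .

lemma tri_lift3:
  assumes tri: "exact_triangle T X Y Z f g h" and u: "u \<in> Hom T W (SO X)" "SA f \<cdot> u = Zero T W (SO Y)"
  obtains x where "x \<in> Hom T W Z" "h \<cdot> x = u"
  by (rule tri_lift1[OF tri_rot[OF tri_rot[OF tri]] u(1)]) (use u triD[OF tri] in \<open>auto simp: in_Hom\<close>)

text \<open>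
  Dually, map the triangle to the trivial one \<open>0 \<rightarrow> W \<rightarrow> W \<rightarrow> \<Sigma> 0\<close>.
\<close>

lemma tri_colift1:
  assumes tri: "exact_triangle T X Y Z f g h" and v: "v \<in> Hom T Y W" "v \<cdot> f = Zero T X W"
  obtains y where "y \<in> Hom T Z W" "y \<cdot> g = v"
proof -
  note d = triD[OF tri]
  have W: "W \<in> Ob T" using v by (auto simp: in_Hom)
  let ?z = "zero_ob T"
  let ?h = "Zero T W (SO ?z)"
  have "exact_triangle T W W (SO ?z) (Idn T W) ?h (neg T (SA (Zero T ?z W)))"
    using triangle_id[OF W SO_zero[OF zero_ob_is_zero]] W by simp
  then have t: "exact_triangle T ?z W W (Zero T ?z W) (Idn T W) ?h"
    using W by (subst triangle_rotate) (auto simp: candidate_triangle_def in_Hom)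
  have z: "Zero T X ?z \<in> Hom T X ?z" "v \<cdot> f = Zero T ?z W \<cdot> Zero T X ?z" using v d W by (simp_all add: in_Hom)
  obtain c where c: "c \<in> Hom T Z W" "c \<cdot> g = Idn T W \<cdot> v" using triangle_morphism[OF tri t z(1) v(1) z(2)] by blast
  then have "c \<cdot> g = v" using v by (simp add: in_Hom)
  then show ?thesis using that c by blast
qed

lemma tri_colift2:
  assumes "exact_triangle T X Y Z f g h" "v \<in> Hom T Z W" "v \<cdot> g = Zero T Y W"
  obtains y where "y \<in> Hom T (SO X) W" "y \<cdot> h = v"
  using tri_colift1[OF tri_rot[OF assms(1)] assms(2,3)] .

lemma tri_colift3:
  assumes tri: "exact_triangle T X Y Z f g h" and v: "v \<in> Hom T (SO X) W" "v \<cdot> h = Zero T Z W"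
  obtains y where "y \<in> Hom T (SO Y) W" "y \<cdot> SA f = v"
proof -
  obtain y where y: "y \<in> Hom T (SO Y) W" "y \<cdot> neg T (SA f) = v"
    using tri_colift1[OF tri_rot[OF tri_rot[OF tri]] v] .
  then have "neg T y \<cdot> SA f = v" "neg T y \<in> Hom T (SO Y) W" using triD[OF tri] by (auto simp: in_Hom)
  then show ?thesis using that by blast
qed

text \<open>
  Three rotations suspend a triangle and change the sign of every map. The following lemmas absorb
  these signs into the lift.
\<close>

lemma tri_susp:
  "exact_triangle T X Y Z f g h \<Longrightarrow> exact_triangle T (SO X) (SO Y) (SO Z) (neg T (SA f)) (neg T (SA g)) (neg T (SA h))"
  by (intro tri_rot)

lemma tri_susp_lift2:
  assumes tri: "exact_triangle T X Y Z f g h" and u: "u \<in> Hom T W (SO Z)" "SA h \<cdot> u = Zero T W (SO (SO X))"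
  obtains x where "x \<in> Hom T W (SO Y)" "SA g \<cdot> x = u"
proof -
  note d = triD[OF tri]
  have h: "neg T (SA h) \<cdot> u = Zero T W (SO (SO X))" using u d Hom_Ob[OF u(1)] by (simp add: in_Hom)
  obtain x where "x \<in> Hom T W (SO Y)" "neg T (SA g) \<cdot> x = u" using tri_lift2[OF tri_susp[OF tri] u(1) h] .
  then have "neg T x \<in> Hom T W (SO Y)" "SA g \<cdot> neg T x = u" using d by (auto simp: in_Hom)
  then show ?thesis using that by blast
qed

lemma tri_susp_colift1:
  assumes tri: "exact_triangle T X Y Z f g h" and v: "v \<in> Hom T (SO Y) W" "v \<cdot> SA f = Zero T (SO X) W"
  obtains y where "y \<in> Hom T (SO Z) W" "y \<cdot> SA g = v"
proof -
  note d = triD[OF tri]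
  have h: "v \<cdot> neg T (SA f) = Zero T (SO X) W" using v d Hom_Ob[OF v(1)] by (simp add: in_Hom)
  obtain y where "y \<in> Hom T (SO Z) W" "y \<cdot> neg T (SA g) = v" using tri_colift1[OF tri_susp[OF tri] v(1) h] .
  then have "neg T y \<in> Hom T (SO Z) W" "neg T y \<cdot> SA g = v" using d by (auto simp: in_Hom)
  then show ?thesis using that by blast
qed

lemma tri_susp_colift2:
  assumes tri: "exact_triangle T X Y Z f g h" and v: "v \<in> Hom T (SO Z) W" "v \<cdot> SA g = Zero T (SO Y) W"
  obtains y where "y \<in> Hom T (SO (SO X)) W" "y \<cdot> SA h = v"
proof -
  note d = triD[OF tri]
  have h: "v \<cdot> neg T (SA g) = Zero T (SO Y) W" using v d Hom_Ob[OF v(1)] by (simp add: in_Hom)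
  obtain y where "y \<in> Hom T (SO (SO X)) W" "y \<cdot> neg T (SA h) = v" using tri_colift2[OF tri_susp[OF tri] v(1) h] .
  then have "neg T y \<in> Hom T (SO (SO X)) W" "neg T y \<cdot> SA h = v" using d by (auto simp: in_Hom)
  then show ?thesis using that by blast
qed

text \<open>
  The middle vertex of the first triangle of a Postnikov resolution is zero, so this makes its
  map \<open>q\<^sub>0\<close> invertible.
\<close>

lemma tri_zero_middle_iso:
  assumes tri: "exact_triangle T P Z X f i q" and Z: "is_zero_ob T Z"
  obtains r where "r \<in> Hom T (SO P) X" "r \<cdot> q = Idn T X" "q \<cdot> r = Idn T (SO P)"
proof -
  note d = triD[OF tri]
  have fi: "f = Zero T P Z" "i = Zero T Z X" using zero_ob_Hom[OF Z] d by blast+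
  have "Idn T (SO P) \<in> Hom T (SO P) (SO P)" "SA f \<cdot> Idn T (SO P) = Zero T (SO P) (SO Z)"
    using d fi by (auto simp: in_Hom)
  then obtain r where r: "r \<in> Hom T (SO P) X" "q \<cdot> r = Idn T (SO P)" using tri_lift3[OF tri] by blast
  let ?u = "(r \<cdot> q) \<ominus> Idn T X"
  have u: "?u \<in> Hom T X X" using r d by (auto simp: in_Hom)
  have "q \<cdot> r \<cdot> q = q" using comp_extend[OF r(2), of q] r d by (auto simp: in_Hom)
  then have "q \<cdot> ?u = Zero T X (SO P)" using r d by (auto simp: in_Hom)
  from tri_lift2[OF tri u this] obtain x where x: "x \<in> Hom T X Z" "i \<cdot> x = ?u" .
  then have "?u = Zero T X X" using fi(2) d by (auto simp: in_Hom)
  then have "r \<cdot> q = Idn T X" using r d by (subst (asm) sub_eq_Zero_iff[of _ X X]) (auto simp: in_Hom)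
  then show ?thesis using that r by blast
qed

text \<open>
  As \<open>\<Sigma>\<close> is an equivalence, a test object for the suspended cocone is isomorphic to a suspension, and all
  maps can be desuspended.
\<close>

lemma coproduct_susp:
  assumes cp: "is_coproduct T I X A \<iota>" and X: "\<And>i. i \<in> I \<Longrightarrow> X i \<in> Ob T"
  shows "is_coproduct T I (\<lambda>i. SO (X i)) (SO A) (\<lambda>i. SA (\<iota> i))"
  unfolding is_coproduct_def
proof (intro conjI ballI allI impI)
  note c = coproductD[OF cp]
  show "SO A \<in> Ob T" using c by simp
  show "SA (\<iota> i) \<in> Hom T (SO (X i)) (SO A)" if "i \<in> I" for i using c that by (auto simp: in_Hom)
  fix Y g assume Y: "Y \<in> Ob T" and g: "\<forall>i \<in> I. g i \<in> Hom T (SO (X i)) Y"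
  obtain Y' j j' where j: "Y' \<in> Ob T" "j \<in> Hom T (SO Y') Y" "j' \<in> Hom T Y (SO Y')" "j' \<cdot> j = Idn T (SO Y')" "j \<cdot> j' = Idn T Y"
    using SO_ess_surj[OF Y] .
  have "\<forall>i \<in> I. \<exists>g'. g' \<in> Hom T (X i) Y' \<and> SA g' = j' \<cdot> g i"
  proof
    fix i assume i: "i \<in> I"
    then have "j' \<cdot> g i \<in> Hom T (SO (X i)) (SO Y')" using g j by (auto simp: in_Hom)
    then show "\<exists>g'. g' \<in> Hom T (X i) Y' \<and> SA g' = j' \<cdot> g i" using SA_full X[OF i] j(1) by metis
  qed
  then obtain g' where g': "\<And>i. i \<in> I \<Longrightarrow> g' i \<in> Hom T (X i) Y'" "\<And>i. i \<in> I \<Longrightarrow> SA (g' i) = j' \<cdot> g i" by metis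
  obtain u where u: "u \<in> Hom T A Y'" "\<And>i. i \<in> I \<Longrightarrow> u \<cdot> \<iota> i = g' i" by (rule coproduct_map[OF cp j(1) g'(1)]) blast+
  show "\<exists>!u. u \<in> Hom T (SO A) Y \<and> (\<forall>i \<in> I. u \<cdot> SA (\<iota> i) = g i)"
  proof (rule ex1I[of _ "j \<cdot> SA u"], intro conjI ballI)
    show "j \<cdot> SA u \<in> Hom T (SO A) Y" using u j by (auto simp: in_Hom)
    fix i assume i: "i \<in> I"
    have "(j \<cdot> SA u) \<cdot> SA (\<iota> i) = j \<cdot> SA (u \<cdot> \<iota> i)" using u(1) j(2) c(2)[OF i] by (simp add: in_Hom)
    also have "\<dots> = j \<cdot> j' \<cdot> g i" using u(2) g'(2) i by simp
    also have "\<dots> = g i" using comp_extend[OF j(5)] j g i by (auto simp: in_Hom)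
    finally show "(j \<cdot> SA u) \<cdot> SA (\<iota> i) = g i" .
  next
    fix w assume w: "w \<in> Hom T (SO A) Y \<and> (\<forall>i \<in> I. w \<cdot> SA (\<iota> i) = g i)"
    then have "j' \<cdot> w \<in> Hom T (SO A) (SO Y')" using j by (auto simp: in_Hom)
    then obtain w' where w': "w' \<in> Hom T A Y'" "SA w' = j' \<cdot> w" using SA_full c(1) j(1) by metis
    have "w' = u"
    proof (rule coproduct_ext[OF cp w'(1) u(1)])
      fix i assume i: "i \<in> I"
      have "SA (w' \<cdot> \<iota> i) = (j' \<cdot> w) \<cdot> SA (\<iota> i)" using w' c(2)[OF i] by (simp add: in_Hom)
      also have "\<dots> = j' \<cdot> g i" using w j c(2)[OF i] i by (simp add: in_Hom)
      also have "\<dots> = SA (u \<cdot> \<iota> i)" using u g' i by simp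
      finally have e: "SA (w' \<cdot> \<iota> i) = SA (u \<cdot> \<iota> i)" .
      show "w' \<cdot> \<iota> i = u \<cdot> \<iota> i"
        by (rule SA_faithful[OF _ _ e, of "X i" Y']) (use w' c(2)[OF i] u(1) in \<open>auto simp: in_Hom\<close>)
    qed
    then have "j \<cdot> SA u = j \<cdot> j' \<cdot> w" using w' by simp
    also have "\<dots> = w" using comp_extend[OF j(5), of w] j w by (auto simp: in_Hom)
    finally show "w = j \<cdot> SA u" by simp
  qed
qed

text \<open>
  Extend \<open>p\<close> to a triangle on the right, replace its third vertex by an isomorphic suspension \<open>\<Sigma> W\<close>, and
  rotate back twice; the signs of these rotations go into the choice of \<open>w\<close> and \<open>a\<close>.
\<close>

lemma ex_triangle_third:
  assumes p: "p \<in> Hom T A (SO X)" "X \<in> Ob T"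
  obtains W w a where "exact_triangle T X W A w a p"
proof -
  have A: "A \<in> Ob T" using p by (auto simp: in_Hom)
  obtain Z g h where tri: "exact_triangle T A (SO X) Z p g h" using triangle_complete[OF p(1)] by blast
  note d = triD[OF tri]
  obtain W j j' where j: "W \<in> Ob T" "j \<in> Hom T (SO W) Z" "j' \<in> Hom T Z (SO W)" "j' \<cdot> j = Idn T (SO W)" "j \<cdot> j' = Idn T Z"
    using SO_ess_surj[OF d(6)] .
  have "neg T (j' \<cdot> g) \<in> Hom T (SO X) (SO W)" using j d by (auto simp: in_Hom)
  then obtain w where w: "w \<in> Hom T X W" "SA w = neg T (j' \<cdot> g)" using SA_full p(2) j(1) by metis
  have "neg T (h \<cdot> j) \<in> Hom T (SO W) (SO A)" using j d by (auto simp: in_Hom)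
  then obtain a where a: "a \<in> Hom T W A" "SA a = neg T (h \<cdot> j)" using SA_full A j(1) by metis
  have jiso: "is_iso T j'" using is_isoI[OF j(3,2)] j by simp
  have "exact_triangle T A (SO X) (SO W) p (neg T (SA w)) (neg T (SA a))"
  proof (rule triangle_iso[OF tri, of _ _ _ _ _ _ "Idn T A" "Idn T (SO X)" j'])
    show "candidate_triangle T A (SO X) (SO W) p (neg T (SA w)) (neg T (SA a))"
      using p w(1) a(1) unfolding candidate_triangle_def by (auto simp: in_Hom)
    show "SA (Idn T A) \<cdot> h = neg T (SA a) \<cdot> j'"
      using a j d A by (simp add: in_Hom)
    show "j' \<cdot> g = neg T (SA w) \<cdot> Idn T (SO X)" using w j d by (simp add: in_Hom)
  qed (use A p d j jiso is_iso_Idn in \<open>auto simp: in_Hom\<close>)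
  then have "exact_triangle T W A (SO X) a p (neg T (SA w))"
    using p a(1) w(1) by (subst triangle_rotate) (auto simp: candidate_triangle_def in_Hom)
  then have "exact_triangle T X W A w a p"
    using p a(1) w(1) by (subst triangle_rotate) (auto simp: candidate_triangle_def in_Hom)
  then show ?thesis using that by blast
qed

end

section \<open>Projective objects and phantom maps\<close>

text \<open>
  The objects of \<open>\<C>\<close> are the test objects. Their smallness controls maps into coproducts, closure under
  suspension and desuspension lets tested statements be shifted, and essential smallness together with
  small sets of maps provides covers.
\<close>

locale resolution_setting = triangulated_category T
  for T :: "('o, 'm, 'x) tricat_scheme" (structure) +
  fixes \<kappa> \<alpha> :: "'k rel" and \<C> :: "'o set"
  assumes \<kappa>_regular: "regular_cardinal \<kappa>"
    and \<alpha>_regular: "regular_cardinal \<alpha>"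
    and T_coproducts: "has_coproducts T \<kappa>"
    and C_compact: "\<C> \<subseteq> compact_objects T \<kappa> \<alpha>"
    and C_essentially_small: "essentially_small T \<kappa> \<C>"
    and Hom_small: "C \<in> \<C> \<Longrightarrow> X \<in> Ob T \<Longrightarrow> |Hom T C X| <o \<kappa>"
    and C_suspensions: "closed_under_suspensions T \<C>"
    and C_coproducts: "closed_under_coproducts T \<alpha> \<C>"
begin

abbreviation "AddC \<equiv> Add_closure T \<kappa> \<C>"
abbreviation "C_epi \<equiv> surjective_on T \<C>"
abbreviation "C_phantom \<equiv> phantom T \<C>"
abbreviation "resolution \<equiv> is_postnikov T \<kappa> \<alpha> \<C>"
abbreviation "resolution_map \<equiv> is_postnikov_map T \<kappa> \<alpha> \<C>"
abbreviation "resolution_functor \<equiv> is_resolution_functor T \<kappa> \<alpha> \<C>"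

lemma C_small: "C \<in> \<C> \<Longrightarrow> small_object T \<kappa> \<alpha> C"
  using C_compact unfolding compact_objects_def factoring_class_def by blast

lemma C_Ob: "C \<in> \<C> \<Longrightarrow> C \<in> Ob T"
  using C_small unfolding small_object_def by blast

text \<open>
  The half of exactness that allows lifting: on test objects the kernel of \<open>g\<close> lies in the image of \<open>f\<close>. The
  composite \<open>g \<cdot> f\<close> is arbitrary, so surjectivity of \<open>f\<close> is the case in which \<open>g\<close> is zero.
\<close>

definition C_exact :: "'m \<Rightarrow> 'm \<Rightarrow> bool" where
  "C_exact f g \<longleftrightarrow> f \<in> Arr T \<and> g \<in> Arr T \<and> Dom T g = Cod T f \<and>
     (\<forall>C \<in> \<C>. \<forall>u \<in> Hom T C (Cod T f). g \<cdot> u = Zero T C (Cod T g) \<longrightarrow> (\<exists>x \<in> Hom T C (Dom T f). f \<cdot> x = u))"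

lemma Add_Ob: "P \<in> AddC \<Longrightarrow> P \<in> Ob T"
  by (induction rule: Add_closure.induct) (auto dest: C_Ob coproductD(1) Hom_Ob(1))

text \<open>
  Maps out of a coproduct are assembled from their components, and a map out of a retract is extended to the
  large object and its lift restricted again.
\<close>

lemma Add_lift:
  assumes ex: "C_exact f g" and P: "P \<in> AddC" and u: "u \<in> Hom T P (Cod T f)" "g \<cdot> u = Zero T P (Cod T g)"
  shows "\<exists>x \<in> Hom T P (Dom T f). f \<cdot> x = u"
  using P u
proof (induction P arbitrary: u rule: Add_closure.induct)
  case (base X)
  then show ?case using ex unfolding C_exact_def by blast
next
  case (coproduct I X A \<iota>)
  note fg = ex[unfolded C_exact_def]
  note c = coproductD[OF coproduct.hyps(3)]
  have "\<forall>i \<in> I. \<exists>x. x \<in> Hom T (X i) (Dom T f) \<and> f \<cdot> x = u \<cdot> \<iota> i"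
  proof
    fix i assume i: "i \<in> I"
    have "g \<cdot> u \<cdot> \<iota> i = Zero T A (Cod T g) \<cdot> \<iota> i"
      using comp_extend[OF coproduct.prems(2), of "\<iota> i"] c(2)[OF i] coproduct.prems(1) fg by (simp add: in_Hom)
    also have "\<dots> = Zero T (X i) (Cod T g)" using c(2)[OF i] fg by (simp add: in_Hom)
    finally show "\<exists>x. x \<in> Hom T (X i) (Dom T f) \<and> f \<cdot> x = u \<cdot> \<iota> i"
      using coproduct.IH[OF i, of "u \<cdot> \<iota> i"] c(2)[OF i] coproduct.prems(1) by (auto simp: in_Hom)
  qed
  then obtain x where x: "\<And>i. i \<in> I \<Longrightarrow> x i \<in> Hom T (X i) (Dom T f)" "\<And>i. i \<in> I \<Longrightarrow> f \<cdot> x i = u \<cdot> \<iota> i" by metis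
  have D: "Dom T f \<in> Ob T" using fg by simp
  obtain y where y: "y \<in> Hom T A (Dom T f)" "\<And>i. i \<in> I \<Longrightarrow> y \<cdot> \<iota> i = x i"
    by (rule coproduct_map[OF coproduct.hyps(3) D x(1)]) blast+
  have "f \<cdot> y = u"
  proof (rule coproduct_ext[OF coproduct.hyps(3) _ coproduct.prems(1)])
    show "f \<cdot> y \<in> Hom T A (Cod T f)" using y(1) fg by (simp add: in_Hom)
    fix i assume "i \<in> I"
    then show "(f \<cdot> y) \<cdot> \<iota> i = u \<cdot> \<iota> i" using y x c(2) fg by (simp add: in_Hom)
  qed
  then show ?case using y by blast
next
  case (retract X s Y r)
  note fg = ex[unfolded C_exact_def]
  have "u \<cdot> r \<in> Hom T X (Cod T f)" using retract by (auto simp: in_Hom)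
  moreover have "g \<cdot> u \<cdot> r = Zero T X (Cod T g)"
    using comp_extend[OF retract.prems(2), of r] retract.hyps retract.prems(1) fg by (simp add: in_Hom)
  ultimately obtain x where x: "x \<in> Hom T X (Dom T f)" "f \<cdot> x = u \<cdot> r" using retract.IH by blast
  have "f \<cdot> x \<cdot> s = (u \<cdot> r) \<cdot> s" using comp_extend[OF x(2), of s] x(1) retract.hyps(2,3) retract.prems(1) fg by (simp add: in_Hom)
  also have "\<dots> = u" using retract.hyps(2-4) retract.prems(1) by (simp add: in_Hom)
  finally show ?case using x(1) retract.hyps(2) by (intro bexI[of _ "x \<cdot> s"]) (auto simp: in_Hom)
qed

lemma C_exact_lift:
  assumes "C_exact f g" "f \<in> Hom T X Y" "g \<in> Hom T Y Z" "P \<in> AddC" "u \<in> Hom T P Y" "g \<cdot> u = Zero T P Z"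
  obtains x where "x \<in> Hom T P X" "f \<cdot> x = u"
proof -
  have t: "Dom T f = X" "Cod T f = Y" "Cod T g = Z" using assms(2,3) by (simp_all add: in_Hom)
  show ?thesis using Add_lift[OF assms(1,4), of u] assms(5,6) that unfolding t by blast
qed

lemma surjective_onD:
  assumes "C_epi f" "C \<in> \<C>" "u \<in> Hom T C (Cod T f)"
  obtains x where "x \<in> Hom T C (Dom T f)" "f \<cdot> x = u"
proof -
  have "u \<in> (\<cdot>) f ` Hom T C (Dom T f)" using assms unfolding surjective_on_def by simp
  then show ?thesis using that by blast
qed

lemma surjective_onI:
  assumes "f \<in> Hom T X Y" "\<And>C u. C \<in> \<C> \<Longrightarrow> u \<in> Hom T C Y \<Longrightarrow> \<exists>x \<in> Hom T C X. f \<cdot> x = u"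
  shows "C_epi f"
proof -
  have d: "Dom T f = X" "Cod T f = Y" "f \<in> Arr T" using assms(1) by (simp_all add: in_Hom)
  show ?thesis unfolding surjective_on_def d
  proof
    fix S assume S: "S \<in> \<C>"
    show "(\<lambda>u. f \<cdot> u) ` Hom T S X = Hom T S Y"
    proof
      show "(\<lambda>u. f \<cdot> u) ` Hom T S X \<subseteq> Hom T S Y" using assms(1) by (auto simp: in_Hom)
      show "Hom T S Y \<subseteq> (\<lambda>u. f \<cdot> u) ` Hom T S X" using assms(2)[OF S] by blast
    qed
  qed
qed

lemma C_exact_zero:
  assumes "C_epi f" "f \<in> Arr T"
  shows "C_exact f (Zero T (Cod T f) (zero_ob T))"
  using assms surjective_onD[OF assms(1)] unfolding C_exact_def by simp metis

text \<open>
  The special case of a surjection, viewed as a pair whose second map is zero.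
\<close>

lemma Add_projective:
  assumes "C_epi f" "f \<in> Hom T X Y" "P \<in> AddC" "u \<in> Hom T P Y"
  obtains x where "x \<in> Hom T P X" "f \<cdot> x = u"
proof (rule C_exact_lift[OF _ assms(2) _ assms(3,4)])
  show "C_exact f (Zero T Y (zero_ob T))" using C_exact_zero[OF assms(1)] assms(2) by (simp add: in_Hom)
  show "Zero T Y (zero_ob T) \<in> Hom T Y (zero_ob T)" using Hom_Ob[OF assms(2)] by (simp add: in_Hom)
  show "Zero T Y (zero_ob T) \<cdot> u = Zero T P (zero_ob T)" using assms(4) by (simp add: in_Hom)
qed (use that in blast)

text \<open>
  Statements tested on the subcategory can be shifted by \<open>\<Sigma>\<close>, since every test object is
  isomorphic to the suspension of another one.
\<close>

lemma desuspend:
  assumes "C \<in> \<C>"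
  obtains D j j' where "D \<in> \<C>" "D \<in> Ob T" "j \<in> Hom T (SO D) C" "j' \<in> Hom T C (SO D)"
    "j' \<cdot> j = Idn T (SO D)" "j \<cdot> j' = Idn T C"
  using C_suspensions assms is_isoD C_Ob unfolding closed_under_suspensions_def isomorphic_def by metis

lemma Add_susp: "P \<in> AddC \<Longrightarrow> SO P \<in> AddC"
proof (induction rule: Add_closure.induct)
  case (base X)
  then obtain Y j where Y: "Y \<in> \<C>" "j \<in> Hom T Y (SO X)" "is_iso T j"
    using C_suspensions unfolding closed_under_suspensions_def isomorphic_def by blast
  obtain k where k: "k \<in> Hom T (SO X) Y" "j \<cdot> k = Idn T (SO X)" using is_isoD[OF Y(3,2)] by metis
  show ?case by (rule Add_closure.retract[OF Add_closure.base[OF Y(1)] k(1) Y(2) k(2)])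
next
  case (coproduct I X A \<iota>)
  show ?case
    by (rule Add_closure.coproduct[OF coproduct.hyps(1) coproduct.IH
          coproduct_susp[OF coproduct.hyps(3) Add_Ob[OF coproduct.hyps(2)]]])
next
  case (retract X s Y r)
  have "SA s \<in> Hom T (SO Y) (SO X)" "SA r \<in> Hom T (SO X) (SO Y)" using retract by (simp_all add: in_Hom)
  moreover have "SA r \<cdot> SA s = Idn T (SO Y)"
    using arg_cong[OF retract.hyps(4), of SA] retract.hyps(2,3) Hom_Ob(1)[OF retract.hyps(2)] by (simp add: in_Hom)
  ultimately show ?case using retract.IH Add_closure.retract by metis
qed

lemma C_exact_susp:
  assumes ex: "C_exact f g"
  shows "C_exact (SA f) (SA g)"
proof -
  note fg = ex[unfolded C_exact_def]
  show ?thesis unfolding C_exact_def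
  proof (intro conjI ballI impI)
    fix C u assume C: "C \<in> \<C>" and u: "u \<in> Hom T C (Cod T (SA f))" "SA g \<cdot> u = Zero T C (Cod T (SA g))"
    obtain D j j' where D: "D \<in> \<C>" "D \<in> Ob T" and j: "j \<in> Hom T (SO D) C" "j' \<in> Hom T C (SO D)" "j \<cdot> j' = Idn T C"
      using desuspend[OF C] by metis
    have "u \<cdot> j \<in> Hom T (SO D) (SO (Cod T f))" using u j fg by (simp add: in_Hom)
    then obtain v where v: "v \<in> Hom T D (Cod T f)" "SA v = u \<cdot> j" using SA_full D(2) fg by (metis Cod_Ob)
    have "SA (g \<cdot> v) = SA g \<cdot> u \<cdot> j" using v fg by (simp add: in_Hom)
    also have "\<dots> = Zero T (SO D) (SO (Cod T g))" using comp_extend[OF u(2), of j] u(1) j(1) fg C_Ob[OF C] by (simp add: in_Hom)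
    finally have z: "SA (g \<cdot> v) = SA (Zero T D (Cod T g))" using fg D(2) by simp
    have "g \<cdot> v = Zero T D (Cod T g)"
      by (rule SA_faithful[OF _ _ z, of D "Cod T g"]) (use v(1) fg D(2) in \<open>simp_all add: in_Hom\<close>)
    then obtain x where x: "x \<in> Hom T D (Dom T f)" "f \<cdot> x = v" using fg D v by blast
    have "SA f \<cdot> SA x = u \<cdot> j" using x fg v by (simp add: in_Hom flip: SA_Comp)
    then have "SA f \<cdot> SA x \<cdot> j' = u \<cdot> j \<cdot> j'" using comp_extend2[of "SA f" "SA x" u j j'] x(1) fg u(1) j by (simp add: in_Hom)
    also have "\<dots> = u" using u j by (simp add: in_Hom)
    finally show "\<exists>x \<in> Hom T C (Dom T (SA f)). SA f \<cdot> x = u"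
      using x(1) fg j by (intro bexI[of _ "SA x \<cdot> j'"]) (simp_all add: in_Hom)
  qed (use fg in auto)
qed

lemma surjective_susp:
  assumes s: "C_epi f" and f: "f \<in> Hom T X Y"
  shows "C_epi (SA f)"
proof (rule surjective_onI)
  show "SA f \<in> Hom T (SO X) (SO Y)" using f by (simp add: in_Hom)
  fix C u assume C: "C \<in> \<C>" and u: "u \<in> Hom T C (SO Y)"
  have f': "f \<in> Arr T" using f by (simp add: in_Hom)
  then have "C_exact (SA f) (SA (Zero T (Cod T f) (zero_ob T)))" by (intro C_exact_susp C_exact_zero s)
  then show "\<exists>x \<in> Hom T C (SO X). SA f \<cdot> x = u"
    using f f' u C Hom_Ob[OF u] unfolding C_exact_def by (simp add: in_Hom)
qed

lemma phantom_iff: "C_phantom f \<longleftrightarrow> f \<in> Arr T \<and> (\<forall>C \<in> \<C>. \<forall>x \<in> Hom T C (Dom T f). f \<cdot> x = Zero T C (Cod T f))"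
  unfolding phantom_def yonedaO_def yonedaA_def by simp

lemma phantom_Add:
  assumes f: "C_phantom f" and P: "P \<in> AddC" and u: "u \<in> Hom T P (Dom T f)"
  shows "f \<cdot> u = Zero T P (Cod T f)"
proof -
  have fA: "f \<in> Arr T" using f unfolding phantom_iff by simp
  show ?thesis using P u
  proof (induction P arbitrary: u rule: Add_closure.induct)
    case (base X)
    then show ?case using f unfolding phantom_iff by blast
  next
    case (coproduct I X A \<iota>)
    note c = coproductD[OF coproduct.hyps(3)]
    show ?case
    proof (rule coproduct_ext[OF coproduct.hyps(3), of _ "Cod T f"])
      fix i assume i: "i \<in> I"
      have "f \<cdot> u \<cdot> \<iota> i = Zero T (X i) (Cod T f)"
        using coproduct.IH[OF i, of "u \<cdot> \<iota> i"] c(2)[OF i] coproduct.prems(1) fA by (simp add: in_Hom)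
      then show "(f \<cdot> u) \<cdot> \<iota> i = Zero T A (Cod T f) \<cdot> \<iota> i"
        using c(2)[OF i] coproduct.prems(1) fA by (simp add: in_Hom)
    qed (use coproduct.prems(1) c fA in \<open>simp_all add: in_Hom\<close>)
  next
    case (retract X s Y r)
    have "f \<cdot> u \<cdot> r = Zero T X (Cod T f)" using retract.IH[of "u \<cdot> r"] retract.hyps(3) retract.prems(1) by (simp add: in_Hom)
    then have "(f \<cdot> u \<cdot> r) \<cdot> s = Zero T Y (Cod T f)" using retract.hyps(2) fA by (simp add: in_Hom)
    then show ?case using retract.hyps(2-4) retract.prems(1) fA by (simp add: in_Hom)
  qed
qed

lemma phantom_susp:
  assumes f: "C_phantom f"
  shows "C_phantom (SA f)"
  unfolding phantom_iff
proof (intro conjI ballI)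
  have fA: "f \<in> Arr T" using f unfolding phantom_iff by simp
  then show "SA f \<in> Arr T" by simp
  fix C x assume C: "C \<in> \<C>" and x: "x \<in> Hom T C (Dom T (SA f))"
  obtain D j j' where D: "D \<in> \<C>" "D \<in> Ob T" and j: "j \<in> Hom T (SO D) C" "j' \<in> Hom T C (SO D)" "j \<cdot> j' = Idn T C"
    using desuspend[OF C] by metis
  have "x \<cdot> j \<in> Hom T (SO D) (SO (Dom T f))" using x j fA by (simp add: in_Hom)
  then obtain v where v: "v \<in> Hom T D (Dom T f)" "SA v = x \<cdot> j" using SA_full D(2) fA by (metis Dom_Ob)
  have "f \<cdot> v = Zero T D (Cod T f)" using f D v unfolding phantom_iff by blast
  then have "SA f \<cdot> SA v = Zero T (SO D) (SO (Cod T f))" using SA_comp_eq[of f v "Zero T D (Cod T f)"] v(1) fA D(2) by (simp add: in_Hom)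
  then have "(SA f \<cdot> x \<cdot> j) \<cdot> j' = Zero T C (SO (Cod T f))" using v(2) j fA D by (simp add: in_Hom)
  then show "SA f \<cdot> x = Zero T C (Cod T (SA f))" using x j fA by (simp add: in_Hom)
qed

lemma regular_stable: "regular_cardinal r \<Longrightarrow> stable r"
  unfolding regular_cardinal_def using regularCard_stable by blast

text \<open>
  Coproducts are indexed by subsets of the type that underlies \<open>\<kappa>\<close>, so an index set of another type has to
  be transported there first.
\<close>

lemma small_reindex:
  assumes "|K| <o \<kappa>"
  obtains I :: "'k set" and e where "|I| <o \<kappa>" "bij_betw e I K"
proof -
  have co: "Card_order \<kappa>" using \<kappa>_regular unfolding regular_cardinal_def by simp
  have "|K| \<le>o |Field \<kappa>|"
    using assms card_of_Field_ordIso[OF co] ordLess_imp_ordLeq ordIso_symmetric ordLeq_ordIso_trans by blast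
  then obtain g where g: "inj_on g K" "g ` K \<subseteq> Field \<kappa>" using card_of_ordLeq[of K "Field \<kappa>"] by blast
  have "|g ` K| <o \<kappa>" using assms card_of_image[of g K] ordLeq_ordLess_trans by blast
  moreover have "bij_betw (inv_into K g) (g ` K) K" using g(1) by (simp add: bij_betw_inv_into inj_on_imp_bij_betw)
  ultimately show ?thesis using that by blast
qed

text \<open>
  Take the coproduct of the sources of all maps to \<open>W\<close> from a small skeleton. The number of these maps is
  a small sum of small cardinals, hence small by regularity of \<open>\<kappa>\<close>.
\<close>

lemma ex_cover:
  assumes W: "W \<in> Ob T"
  obtains I :: "'k set" and X A \<iota> g where "|I| <o \<kappa>" "\<And>i. i \<in> I \<Longrightarrow> X i \<in> \<C>" "is_coproduct T I X A \<iota>"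
    "g \<in> Hom T A W" "C_epi g"
proof -
  obtain \<G> where G: "\<G> \<subseteq> \<C>" "|\<G>| <o \<kappa>" "\<And>C. C \<in> \<C> \<Longrightarrow> \<exists>Y \<in> \<G>. isomorphic T C Y"
    using C_essentially_small unfolding essentially_small_def by blast
  define K where "K = (SIGMA G : \<G>. Hom T G W)"
  have "|K| <o \<kappa>" unfolding K_def
    by (rule stable_elim[OF regular_stable[OF \<kappa>_regular] G(2)]) (rule Hom_small[OF subsetD[OF G(1)] W])
  then obtain I :: "'k set" and e where I: "|I| <o \<kappa>" "bij_betw e I K" by (rule small_reindex)
  have eK: "e i \<in> K" if "i \<in> I" for i using I(2) that bij_betwE by blast
  let ?X = "\<lambda>i. fst (e i)"
  have X: "?X i \<in> \<C>" "snd (e i) \<in> Hom T (?X i) W" if "i \<in> I" for i using eK[OF that] G(1) unfolding K_def by auto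
  have "\<forall>i \<in> I. ?X i \<in> Ob T" using X C_Ob by blast
  then obtain A \<iota> where A: "is_coproduct T I ?X A \<iota>"
    using I(1) T_coproducts unfolding has_coproducts_def by meson
  obtain g where g: "g \<in> Hom T A W" "\<And>i. i \<in> I \<Longrightarrow> g \<cdot> \<iota> i = snd (e i)"
    by (rule coproduct_map[OF A W X(2)]) blast+
  have "C_epi g"
  proof (rule surjective_onI[OF g(1)])
    fix C u assume C: "C \<in> \<C>" and u: "u \<in> Hom T C W"
    obtain D j where D: "D \<in> \<G>" "j \<in> Hom T C D" "is_iso T j" using G(3)[OF C] unfolding isomorphic_def by blast
    obtain k where k: "k \<in> Hom T D C" "k \<cdot> j = Idn T C" using is_isoD[OF D(3,2)] by metis
    have "(D, u \<cdot> k) \<in> K" unfolding K_def using D k u by (simp add: in_Hom)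
    then obtain i where i: "i \<in> I" "e i = (D, u \<cdot> k)" using I(2) unfolding bij_betw_def by (metis imageE)
    have \<iota>: "\<iota> i \<in> Hom T D A" using coproductD(2)[OF A i(1)] i(2) by simp
    have "g \<cdot> \<iota> i \<cdot> j = (u \<cdot> k) \<cdot> j" using comp_extend[OF g(2)[OF i(1)], of j] i(2) g(1) \<iota> D(2) by (simp add: in_Hom)
    also have "\<dots> = u" using u k D by (simp add: in_Hom)
    finally show "\<exists>x \<in> Hom T C A. g \<cdot> x = u" using \<iota> D(2) by (intro bexI[of _ "\<iota> i \<cdot> j"]) (simp_all add: in_Hom)
  qed
  then show ?thesis using that[OF I(1) X(1) A g(1)] by blast
qed

lemma Add_coproduct:
  assumes "|I| <o \<kappa>" "\<And>i. i \<in> I \<Longrightarrow> X i \<in> \<C>" "is_coproduct T (I :: 'k set) X A \<iota>"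
  shows "A \<in> AddC"
  using assms Add_closure.coproduct Add_closure.base by metis

text \<open>
  The cover of \<open>P\<close> splits because \<open>P\<close> is projective. So a single coproduct suffices, although the
  additive closure is formed by iterating coproducts and retracts.
\<close>

lemma Add_retract_of_coproduct:
  assumes P: "P \<in> AddC"
  obtains I :: "'k set" and X A \<iota> s r where "|I| <o \<kappa>" "\<And>i. i \<in> I \<Longrightarrow> X i \<in> \<C>" "is_coproduct T I X A \<iota>"
    "s \<in> Hom T P A" "r \<in> Hom T A P" "r \<cdot> s = Idn T P"
proof -
  have PO: "P \<in> Ob T" using Add_Ob[OF P] .
  obtain I :: "'k set" and X A \<iota> g where g: "|I| <o \<kappa>" "\<And>i. i \<in> I \<Longrightarrow> X i \<in> \<C>" "is_coproduct T I X A \<iota>"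
    "g \<in> Hom T A P" "C_epi g" using ex_cover[OF PO] by metis
  obtain s where "s \<in> Hom T P A" "g \<cdot> s = Idn T P"
    using Add_projective[OF g(5,4) P Idn_in_Hom[OF PO]] by blast
  then show ?thesis using that g by blast
qed

end

section \<open>Representable modules of projective objects\<close>

context resolution_setting
begin

lemma yoneda_simps [simp]:
  "Val (yonedaO T X) C = Hom_group T C X" "Res (yonedaO T X) u x = x \<cdot> u"
  by (simp_all add: yonedaO_def)

lemma yonedaA_apply [simp]: "yonedaA T f C x = f \<cdot> x"
  by (simp add: yonedaA_def)

text \<open>
  Preservation of products is the universal property of the coproducts.
\<close>

lemma is_Mod_yoneda:
  assumes X: "X \<in> Ob T"
  shows "is_Mod T \<kappa> \<alpha> \<C> (yonedaO T X)"
  unfolding is_Mod_def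
proof (intro conjI ballI allI impI)
  fix C assume C: "C \<in> \<C>"
  show "comm_group (Val (yonedaO T X) C)" using C_Ob[OF C] X by (simp add: Hom_comm_group)
  show "|carrier (Val (yonedaO T X) C)| <o \<kappa>" using Hom_small[OF C X] by simp
  fix x assume "x \<in> carrier (Val (yonedaO T X) C)"
  then show "Res (yonedaO T X) (Idn T C) x = x" by (simp add: in_Hom)
next
  fix C D u assume "C \<in> \<C>" "D \<in> \<C>" and u: "u \<in> Hom T C D"
  show "Res (yonedaO T X) u \<in> hom (Val (yonedaO T X) D) (Val (yonedaO T X) C)"
    using u by (intro homI) (simp_all add: in_Hom)
next
  fix C D E u v x assume "u \<in> Hom T C D" "v \<in> Hom T D E" "x \<in> carrier (Val (yonedaO T X) E)"
  then show "Res (yonedaO T X) (v \<cdot> u) x = Res (yonedaO T X) u (Res (yonedaO T X) v x)" by (simp add: in_Hom)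
next
  fix I :: "'k set" and Y A \<iota>
  assume "|I| <o \<alpha> \<and> (\<forall>i \<in> I. Y i \<in> \<C>) \<and> A \<in> \<C> \<and> is_coproduct T I Y A \<iota>"
  then have cp: "is_coproduct T I Y A \<iota>" by simp
  show "bij_betw (\<lambda>x. \<lambda>i \<in> I. Res (yonedaO T X) (\<iota> i) x)
          (carrier (Val (yonedaO T X) A)) (\<Pi>\<^sub>E i \<in> I. carrier (Val (yonedaO T X) (Y i)))"
    unfolding bij_betw_def
  proof (intro conjI inj_onI equalityI subsetI)
    fix x y assume x: "x \<in> carrier (Val (yonedaO T X) A)" and y: "y \<in> carrier (Val (yonedaO T X) A)"
      and e: "(\<lambda>i \<in> I. Res (yonedaO T X) (\<iota> i) x) = (\<lambda>i \<in> I. Res (yonedaO T X) (\<iota> i) y)"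
    have "x \<cdot> \<iota> i = y \<cdot> \<iota> i" if "i \<in> I" for i using fun_cong[OF e, of i] that by simp
    then show "x = y" using coproduct_ext[OF cp, of x X y] x y by simp
  next
    fix z assume "z \<in> (\<lambda>x. \<lambda>i \<in> I. Res (yonedaO T X) (\<iota> i) x) ` carrier (Val (yonedaO T X) A)"
    then obtain x where "x \<in> Hom T A X" "z = (\<lambda>i \<in> I. x \<cdot> \<iota> i)" by auto
    then show "z \<in> (\<Pi>\<^sub>E i \<in> I. carrier (Val (yonedaO T X) (Y i)))"
      using coproductD(2)[OF cp] by (simp add: in_Hom)
  next
    fix z assume z: "z \<in> (\<Pi>\<^sub>E i \<in> I. carrier (Val (yonedaO T X) (Y i)))"
    then have "z i \<in> Hom T (Y i) X" if "i \<in> I" for i using that by auto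
    then obtain x where x: "x \<in> Hom T A X" "\<And>i. i \<in> I \<Longrightarrow> x \<cdot> \<iota> i = z i"
      by (rule coproduct_map[OF cp X]) blast+
    have "z = (\<lambda>i \<in> I. x \<cdot> \<iota> i)" using z x(2) by (auto simp: fun_eq_iff PiE_def extensional_def)
    then show "z \<in> (\<lambda>x. \<lambda>i \<in> I. Res (yonedaO T X) (\<iota> i) x) ` carrier (Val (yonedaO T X) A)"
      using x(1) by (intro image_eqI[of _ _ x]) simp_all
  qed
qed

lemma ModD:
  assumes "is_Mod T \<kappa> \<alpha> \<C> F"
  shows "C \<in> \<C> \<Longrightarrow> comm_group (Val F C)"
    and "C \<in> \<C> \<Longrightarrow> D \<in> \<C> \<Longrightarrow> u \<in> Hom T C D \<Longrightarrow> Res F u \<in> hom (Val F D) (Val F C)"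
    and "C \<in> \<C> \<Longrightarrow> x \<in> carrier (Val F C) \<Longrightarrow> Res F (Idn T C) x = x"
    and "C \<in> \<C> \<Longrightarrow> D \<in> \<C> \<Longrightarrow> E \<in> \<C> \<Longrightarrow> u \<in> Hom T C D \<Longrightarrow> v \<in> Hom T D E \<Longrightarrow> x \<in> carrier (Val F E)
      \<Longrightarrow> Res F (v \<cdot> u) x = Res F u (Res F v x)"
  using assms unfolding is_Mod_def by blast+

lemma Mod_bij:
  assumes "is_Mod T \<kappa> \<alpha> \<C> F" "|I :: 'k set| <o \<alpha>" "\<And>i. i \<in> I \<Longrightarrow> X i \<in> \<C>" "A \<in> \<C>" "is_coproduct T I X A \<iota>"
  shows "bij_betw (\<lambda>x. \<lambda>i \<in> I. Res F (\<iota> i) x) (carrier (Val F A)) (\<Pi>\<^sub>E i \<in> I. carrier (Val F (X i)))"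
  using assms unfolding is_Mod_def by blast

lemma Mod_ext:
  assumes "is_Mod T \<kappa> \<alpha> \<C> F" "|I :: 'k set| <o \<alpha>" "\<And>i. i \<in> I \<Longrightarrow> X i \<in> \<C>" "A \<in> \<C>" "is_coproduct T I X A \<iota>"
    and "x \<in> carrier (Val F A)" "y \<in> carrier (Val F A)" "\<And>i. i \<in> I \<Longrightarrow> Res F (\<iota> i) x = Res F (\<iota> i) y"
  shows "x = y"
proof (rule inj_onD[OF bij_betw_imp_inj_on[OF Mod_bij[OF assms(1-5)]] _ assms(6,7)])
  show "(\<lambda>i \<in> I. Res F (\<iota> i) x) = (\<lambda>i \<in> I. Res F (\<iota> i) y)" using assms(8) by (intro restrict_ext)
qed

lemma Mod_amalgamate:
  assumes "is_Mod T \<kappa> \<alpha> \<C> F" "|I :: 'k set| <o \<alpha>" "\<And>i. i \<in> I \<Longrightarrow> X i \<in> \<C>" "A \<in> \<C>" "is_coproduct T I X A \<iota>"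
    and y: "\<And>i. i \<in> I \<Longrightarrow> y i \<in> carrier (Val F (X i))"
  obtains x where "x \<in> carrier (Val F A)" "\<And>i. i \<in> I \<Longrightarrow> Res F (\<iota> i) x = y i"
proof -
  have "restrict y I \<in> (\<Pi>\<^sub>E i \<in> I. carrier (Val F (X i)))" using y by auto
  then obtain x where x: "x \<in> carrier (Val F A)" "restrict y I = (\<lambda>i \<in> I. Res F (\<iota> i) x)"
    using bij_betw_imp_surj_on[OF Mod_bij[OF assms(1-5)]] by blast
  have "Res F (\<iota> i) x = y i" if "i \<in> I" for i using fun_cong[OF x(2), of i] that by simp
  then show ?thesis using that x by blast
qed

lemma finite_small: "finite I \<Longrightarrow> |I| <o \<alpha>"
  using \<alpha>_regular finite_ordLess_infinite[of "|I|" \<alpha>] card_order_on_well_order_on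
  unfolding regular_cardinal_def by (metis Field_card_of card_of_well_order_on)

lemma C_coproduct:
  assumes "|I :: 'k set| <o \<alpha>" "\<And>i. i \<in> I \<Longrightarrow> X i \<in> \<C>"
  obtains A \<iota> where "A \<in> \<C>" "is_coproduct T I X A \<iota>"
  using C_coproducts[unfolded closed_under_coproducts_def, rule_format, of I X] assms by blast

text \<open>
  The zero map factors through the empty coproduct, on which a module has exactly one element.
\<close>

lemma Mod_zero:
  assumes F: "is_Mod T \<kappa> \<alpha> \<C> F" and C: "C \<in> \<C>" "B \<in> \<C>" and b: "b \<in> carrier (Val F B)"
  shows "Res F (Zero T C B) b = \<one>\<^bsub>Val F C\<^esub>"
proof -
  obtain E \<iota> where E: "E \<in> \<C>" "is_coproduct T ({} :: 'k set) (\<lambda>_. C) E \<iota>"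
    by (rule C_coproduct[OF finite_small, of "{}" "\<lambda>_. C"]) simp_all
  interpret FC: comm_group "Val F C" using ModD(1)[OF F C(1)] .
  interpret FE: comm_group "Val F E" using ModD(1)[OF F E(1)] .
  have z: "Zero T E B \<in> Hom T E B" "Zero T C E \<in> Hom T C E" using C_Ob C E by (simp_all add: in_Hom)
  have zb: "Res F (Zero T E B) b \<in> carrier (Val F E)" using ModD(2)[OF F E(1) C(2) z(1)] b by (rule hom_in_carrier)
  have "Res F (Zero T E B) b = \<one>\<^bsub>Val F E\<^esub>"
    by (rule Mod_ext[OF F finite_small _ E(1) E(2) zb]) simp_all
  then have "Res F (Zero T E B \<cdot> Zero T C E) b = Res F (Zero T C E) \<one>\<^bsub>Val F E\<^esub>"
    using ModD(4)[OF F C(1) E(1) C(2) z(2,1) b] by simp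
  also have "\<dots> = \<one>\<^bsub>Val F C\<^esub>"
    using hom_one[OF ModD(2)[OF F C(1) E(1) z(2)] FE.group_axioms FC.group_axioms] .
  finally show ?thesis using C_Ob C E by simp
qed

text \<open>
  Modules are only required to preserve products, but this forces additivity: the sum \<open>u + u'\<close>
  is a map \<open>w\<close> with components \<open>u\<close> and \<open>u'\<close> followed by the fold map \<open>s\<close>, and restriction along \<open>s\<close> is the product
  of the restrictions along the two projections \<open>p\<close> and \<open>q\<close>, as can be checked on both summands.
\<close>

lemma Mod_additive:
  assumes F: "is_Mod T \<kappa> \<alpha> \<C> F" and C: "C \<in> \<C>" and B: "B \<in> \<C>" and u: "u \<in> Hom T C B" "u' \<in> Hom T C B"
    and b: "b \<in> carrier (Val F B)"
  shows "Res F (u \<oplus> u') b = Res F u b \<otimes>\<^bsub>Val F C\<^esub> Res F u' b"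
proof -
  have "infinite (UNIV :: 'k set)"
    using \<alpha>_regular infinite_super[of "Field \<alpha>" UNIV] unfolding regular_cardinal_def by auto
  then obtain k l :: 'k where kl: "k \<noteq> l"
    by (metis (full_types) UNIV_I finite.simps finite_subset insertI1 subsetI)
  define I where "I = {k, l}"
  have I: "|I| <o \<alpha>" unfolding I_def by (rule finite_small) simp
  obtain D \<iota> where D: "D \<in> \<C>" and cp: "is_coproduct T I (\<lambda>_. B) D \<iota>"
    by (rule C_coproduct[OF I, of "\<lambda>_. B"]) (use B in simp_all)
  have BO: "B \<in> Ob T" "C \<in> Ob T" "D \<in> Ob T" using C_Ob B C D by auto
  have \<iota>: "\<iota> k \<in> Hom T B D" "\<iota> l \<in> Hom T B D" using coproductD(2)[OF cp] unfolding I_def by auto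
  have ex: "\<exists>p. p \<in> Hom T D B \<and> p \<cdot> \<iota> k = x \<and> p \<cdot> \<iota> l = y" if "x \<in> Hom T B B" "y \<in> Hom T B B" for x y
  proof -
    have "(if i = k then x else y) \<in> Hom T B B" for i using that by simp
    then obtain p where "p \<in> Hom T D B" "\<And>i. i \<in> I \<Longrightarrow> p \<cdot> \<iota> i = (if i = k then x else y)"
      by (rule coproduct_map[OF cp BO(1), of "\<lambda>i. if i = k then x else y"]) blast+
    then show ?thesis using kl unfolding I_def by auto
  qed
  have ids: "Idn T B \<in> Hom T B B" "Zero T B B \<in> Hom T B B" using BO by (simp_all add: in_Hom)
  obtain p where p: "p \<in> Hom T D B" "p \<cdot> \<iota> k = Idn T B" "p \<cdot> \<iota> l = Zero T B B" using ex[OF ids] by blast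
  obtain q where q: "q \<in> Hom T D B" "q \<cdot> \<iota> k = Zero T B B" "q \<cdot> \<iota> l = Idn T B" using ex[OF ids(2,1)] by blast
  obtain s where s: "s \<in> Hom T D B" "s \<cdot> \<iota> k = Idn T B" "s \<cdot> \<iota> l = Idn T B" using ex[OF ids(1,1)] by blast
  define w where "w = (\<iota> k \<cdot> u) \<oplus> (\<iota> l \<cdot> u')"
  have w: "w \<in> Hom T C D" unfolding w_def using \<iota> u by (simp add: in_Hom)
  have comp: "r \<cdot> w = (x \<cdot> u) \<oplus> (y \<cdot> u')" if "r \<in> Hom T D B" "r \<cdot> \<iota> k = x" "r \<cdot> \<iota> l = y" for r x y
    unfolding w_def using that(1) \<iota> u comp_extend[OF that(2), of u] comp_extend[OF that(3), of u'] by (simp add: in_Hom)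
  have sw: "s \<cdot> w = u \<oplus> u'" "p \<cdot> w = u" "q \<cdot> w = u'"
    using comp[OF s] comp[OF p] comp[OF q] u BO by (simp_all add: in_Hom)
  interpret FB: comm_group "Val F B" using ModD(1)[OF F B] .
  interpret FD: comm_group "Val F D" using ModD(1)[OF F D] .
  note hD = ModD(2)[OF F D B] and hw = ModD(2)[OF F C D w]
  have cl: "Res F r b \<in> carrier (Val F D)" if "r \<in> Hom T D B" for r using hom_in_carrier[OF hD[OF that] b] .
  have rest: "Res F (\<iota> i) (Res F s b) = Res F (\<iota> i) (Res F p b \<otimes>\<^bsub>Val F D\<^esub> Res F q b)" if "i \<in> I" for i
  proof -
    have i: "\<iota> i \<in> Hom T B D" using coproductD(2)[OF cp that] .
    note cmp = ModD(4)[OF F B D B i _ b, symmetric]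
    have "Res F (\<iota> i) (Res F p b \<otimes>\<^bsub>Val F D\<^esub> Res F q b) = Res F (p \<cdot> \<iota> i) b \<otimes>\<^bsub>Val F B\<^esub> Res F (q \<cdot> \<iota> i) b"
      using hom_mult[OF ModD(2)[OF F B D i]] cl p(1) q(1) cmp by simp
    also have "\<dots> = b"
      using that p q Mod_zero[OF F B B b] ModD(3)[OF F B b] b unfolding I_def by auto
    also have "b = Res F (\<iota> i) (Res F s b)"
      using that s ModD(3)[OF F B b] cmp[OF s(1)] unfolding I_def by auto
    finally show ?thesis by simp
  qed
  have "Res F s b = Res F p b \<otimes>\<^bsub>Val F D\<^esub> Res F q b"
    by (rule Mod_ext[OF F I _ D cp]) (use B cl p(1) q(1) s(1) rest in auto)
  then have "Res F w (Res F s b) = Res F w (Res F p b) \<otimes>\<^bsub>Val F C\<^esub> Res F w (Res F q b)"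
    using hom_mult[OF hw] cl p(1) q(1) by simp
  then show ?thesis using ModD(4)[OF F C D B w _ b, symmetric] p(1) q(1) s(1) sw by simp
qed

lemma C_factor:
  assumes C: "C \<in> \<C>" and I: "|I :: 'k set| <o \<kappa>" and X: "\<And>i. i \<in> I \<Longrightarrow> X i \<in> Ob T"
    and cp: "is_coproduct T I X A \<iota>" and s: "s \<in> Hom T C A"
  obtains J B \<iota>' v u where "J \<subseteq> I" "|J| <o \<alpha>" "is_coproduct T J X B \<iota>'"
    "v \<in> Hom T B A" "\<And>i. i \<in> J \<Longrightarrow> v \<cdot> \<iota>' i = \<iota> i" "u \<in> Hom T C B" "v \<cdot> u = s"
proof -
  note sm = C_small[OF C, unfolded small_object_def, THEN conjunct2, rule_format, of I X A \<iota> s]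
  have "|I| <o \<kappa> \<and> (\<forall>i \<in> I. X i \<in> Ob T) \<and> is_coproduct T I X A \<iota> \<and> s \<in> Hom T C A" using assms by blast
  from sm[OF this] show ?thesis by (elim exE conjE) (rule that, assumption+, blast, assumption+)
qed

text \<open>
  A module map from the module represented by \<open>\<Coprod> X\<^sub>i\<close> to \<open>F\<close> amounts to a family of elements
  \<open>y\<^sub>i\<close> of \<open>F (X\<^sub>i)\<close>; choosing preimages \<open>y\<^sub>i\<close> of the images of the coproduct inclusions
  therefore lifts \<open>t\<close>. To define the map \<open>s\<close> that belongs to the family, factor \<open>x : C \<rightarrow> \<Coprod> X\<^sub>i\<close>
  through the coproduct \<open>B J\<close> of a subfamily \<open>J\<close> of fewer than \<open>\<alpha>\<close> objects. It lies in the subcategory, so the \<open>y\<^sub>i\<close>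
  with \<open>i\<close> in \<open>J\<close> form one element \<open>b J\<close> of \<open>F (B J)\<close>, which is restricted along the factorization of \<open>x\<close>.
\<close>

lemma coproduct_projective:
  fixes I :: "'k set"
  assumes I: "|I| <o \<kappa>" and X: "\<And>i. i \<in> I \<Longrightarrow> X i \<in> \<C>" and cp: "is_coproduct T I X A \<iota>"
  shows "Mod_projective T \<kappa> \<alpha> \<C> (yonedaO T A)"
  unfolding Mod_projective_def
proof (intro conjI allI impI)
  note c = coproductD[OF cp]
  show "is_Mod T \<kappa> \<alpha> \<C> (yonedaO T A)" using is_Mod_yoneda c(1) .
  fix F G e t
  assume "is_Mod T \<kappa> \<alpha> \<C> F \<and> is_Mod T \<kappa> \<alpha> \<C> G \<and>
        is_Mod_map T \<C> F G e \<and> Mod_epi \<C> F G e \<and> is_Mod_map T \<C> (yonedaO T A) G t"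
  then have F: "is_Mod T \<kappa> \<alpha> \<C> F" and G: "is_Mod T \<kappa> \<alpha> \<C> G" and e: "is_Mod_map T \<C> F G e"
    and epi: "Mod_epi \<C> F G e" and t: "is_Mod_map T \<C> (yonedaO T A) G t" by auto
  have th: "t C x \<in> carrier (Val G C)" if "C \<in> \<C>" "x \<in> Hom T C A" for C x
    using t that hom_in_carrier[of "t C" "Hom_group T C A" "Val G C" x] unfolding is_Mod_map_def by simp
  have tn: "t C (x \<cdot> u) = Res G u (t D x)" if "C \<in> \<C>" "D \<in> \<C>" "u \<in> Hom T C D" "x \<in> Hom T D A" for C D u x
    using t that unfolding is_Mod_map_def by simp
  have eh: "e C x \<in> carrier (Val G C)" if "C \<in> \<C>" "x \<in> carrier (Val F C)" for C x
    using e that hom_in_carrier[of "e C" "Val F C" "Val G C" x] unfolding is_Mod_map_def by simp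
  have en: "e C (Res F u x) = Res G u (e D x)" if "C \<in> \<C>" "D \<in> \<C>" "u \<in> Hom T C D" "x \<in> carrier (Val F D)" for C D u x
    using e that unfolding is_Mod_map_def by simp
  have "\<forall>i \<in> I. \<exists>y. y \<in> carrier (Val F (X i)) \<and> e (X i) y = t (X i) (\<iota> i)"
  proof
    fix i assume i: "i \<in> I"
    then have "t (X i) (\<iota> i) \<in> e (X i) ` carrier (Val F (X i))"
      using epi X th c(2) unfolding Mod_epi_def by simp
    then show "\<exists>y. y \<in> carrier (Val F (X i)) \<and> e (X i) y = t (X i) (\<iota> i)" by auto
  qed
  then obtain y where y: "\<And>i. i \<in> I \<Longrightarrow> y i \<in> carrier (Val F (X i))" "\<And>i. i \<in> I \<Longrightarrow> e (X i) (y i) = t (X i) (\<iota> i)"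
    by metis
  define \<J> where "\<J> = {J. J \<subseteq> I \<and> |J| <o \<alpha>}"
  define \<Phi> where "\<Phi> J B \<mu> v r b \<longleftrightarrow> B \<in> \<C> \<and> is_coproduct T J X B \<mu> \<and> v \<in> Hom T B A \<and> (\<forall>i \<in> J. v \<cdot> \<mu> i = \<iota> i) \<and>
      r \<in> Hom T A B \<and> r \<cdot> v = Idn T B \<and> b \<in> carrier (Val F B) \<and> (\<forall>i \<in> J. Res F (\<mu> i) b = y i)" for J B \<mu> v r b
  have sub: "\<exists>B \<mu> v r b. \<Phi> J B \<mu> v r b"
    if J: "J \<in> \<J>" for J
  proof -
    have J': "J \<subseteq> I" "|J| <o \<alpha>" using J unfolding \<J>_def by auto
    have XJ: "X i \<in> \<C>" if "i \<in> J" for i using X J' that by blast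
    obtain B \<mu> where B: "B \<in> \<C>" "is_coproduct T J X B \<mu>" by (rule C_coproduct[OF J'(2) XJ])
    note d = coproductD[OF B(2)]
    have "\<iota> i \<in> Hom T (X i) A" if "i \<in> J" for i using c(2) J' that by blast
    then obtain v where v: "v \<in> Hom T B A" "\<And>i. i \<in> J \<Longrightarrow> v \<cdot> \<mu> i = \<iota> i"
      by (rule coproduct_map[OF B(2) c(1), of \<iota>]) blast+
    \<comment> \<open>The inclusion of a subcoproduct splits: project the other summands to zero.\<close>
    have "(if i \<in> J then \<mu> i else Zero T (X i) B) \<in> Hom T (X i) B" if "i \<in> I" for i
      using d that C_Ob[OF X[OF that]] by (simp add: in_Hom)
    then obtain r where r: "r \<in> Hom T A B" "\<And>i. i \<in> I \<Longrightarrow> r \<cdot> \<iota> i = (if i \<in> J then \<mu> i else Zero T (X i) B)"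
      by (rule coproduct_map[OF cp d(1), of "\<lambda>i. if i \<in> J then \<mu> i else Zero T (X i) B"]) blast+
    have "r \<cdot> v = Idn T B"
    proof (rule coproduct_ext[OF B(2), of _ B])
      fix i assume i: "i \<in> J"
      have "(r \<cdot> v) \<cdot> \<mu> i = r \<cdot> (v \<cdot> \<mu> i)" using r(1) v(1) d(2)[OF i] by (simp add: in_Hom)
      also have "\<dots> = \<mu> i" using v(2)[OF i] r(2)[of i] i J' by auto
      finally show "(r \<cdot> v) \<cdot> \<mu> i = Idn T B \<cdot> \<mu> i" using d(2)[OF i] by (simp add: in_Hom)
    qed (use r(1) v(1) d(1) in \<open>simp_all add: in_Hom\<close>)
    moreover have yJ: "y i \<in> carrier (Val F (X i))" if "i \<in> J" for i using y(1) that J' by blast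
    obtain b where b: "b \<in> carrier (Val F B)" "\<And>i. i \<in> J \<Longrightarrow> Res F (\<mu> i) b = y i"
      by (rule Mod_amalgamate[OF F J'(2) XJ B yJ]) blast+
    ultimately show ?thesis using B v r(1) unfolding \<Phi>_def by blast
  qed
  have "\<forall>J \<in> \<J>. \<exists>d. \<Phi> J (fst d) (fst (snd d)) (fst (snd (snd d))) (fst (snd (snd (snd d)))) (snd (snd (snd (snd d))))"
    using sub by simp
  from bchoice[OF this] obtain d where d: "\<forall>J \<in> \<J>. \<Phi> J (fst (d J)) (fst (snd (d J))) (fst (snd (snd (d J)))) (fst (snd (snd (snd (d J))))) (snd (snd (snd (snd (d J)))))"
    ..
  define B where "B J = fst (d J)" for J
  define \<mu> where "\<mu> J = fst (snd (d J))" for J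
  define v where "v J = fst (snd (snd (d J)))" for J
  define r where "r J = fst (snd (snd (snd (d J))))" for J
  define b where "b J = snd (snd (snd (snd (d J))))" for J
  have \<Phi>: "\<Phi> J (B J) (\<mu> J) (v J) (r J) (b J)" if "J \<in> \<J>" for J
    using d that unfolding B_def \<mu>_def v_def r_def b_def by blast
  have B: "B J \<in> \<C>" and \<mu>: "is_coproduct T J X (B J) (\<mu> J)"
    and v: "v J \<in> Hom T (B J) A" "\<And>i. i \<in> J \<Longrightarrow> v J \<cdot> \<mu> J i = \<iota> i"
    and r: "r J \<in> Hom T A (B J)" "r J \<cdot> v J = Idn T (B J)"
    and b: "b J \<in> carrier (Val F (B J))" "\<And>i. i \<in> J \<Longrightarrow> Res F (\<mu> J i) (b J) = y i"
    if "J \<in> \<J>" for J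
    using \<Phi>[OF that] unfolding \<Phi>_def by blast+
  \<comment> \<open>Smallness yields some coproduct over \<open>J\<close>, which is then compared with the one chosen in the subcategory.\<close>
  have factor: "\<exists>J \<in> \<J>. \<exists>u \<in> Hom T C (B J). v J \<cdot> u = x" if C: "C \<in> \<C>" and x: "x \<in> Hom T C A" for C x
  proof -
    obtain J B' \<iota>' v' u where J: "J \<subseteq> I" "|J| <o \<alpha>" and B': "is_coproduct T J X B' \<iota>'"
      and v': "v' \<in> Hom T B' A" "\<And>i. i \<in> J \<Longrightarrow> v' \<cdot> \<iota>' i = \<iota> i" and u: "u \<in> Hom T C B'" "v' \<cdot> u = x"
      by (rule C_factor[OF C I C_Ob[OF X] cp x]) blast+
    have JJ: "J \<in> \<J>" using J unfolding \<J>_def by simp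
    note d = coproductD[OF \<mu>[OF JJ]]
    obtain a where a: "a \<in> Hom T B' (B J)" "\<And>i. i \<in> J \<Longrightarrow> a \<cdot> \<iota>' i = \<mu> J i"
      by (rule coproduct_map[OF B' d]) blast+
    have "v J \<cdot> a = v'"
    proof (rule coproduct_ext[OF B', of _ A])
      fix i assume i: "i \<in> J"
      have "(v J \<cdot> a) \<cdot> \<iota>' i = v J \<cdot> \<mu> J i" using a v(1)[OF JJ] coproductD(2)[OF B' i] i by (simp add: in_Hom)
      then show "(v J \<cdot> a) \<cdot> \<iota>' i = v' \<cdot> \<iota>' i" using v(2)[OF JJ i] v'(2)[OF i] by simp
    qed (use v(1)[OF JJ] a(1) v'(1) in \<open>simp_all add: in_Hom\<close>)
    then have "v J \<cdot> a \<cdot> u = x" using comp_extend[of "v J" a v' u] v(1)[OF JJ] a(1) u by (simp add: in_Hom)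
    then show ?thesis using JJ a(1) u(1) by (intro bexI[of _ J] bexI[of _ "a \<cdot> u"]) (simp_all add: in_Hom)
  qed
  have mono: "\<exists>j \<in> Hom T (B J) (B J'). v J' \<cdot> j = v J \<and> Res F j (b J') = b J"
    if J: "J \<in> \<J>" "J' \<in> \<J>" "J \<subseteq> J'" for J J'
  proof -
    note d = coproductD[OF \<mu>[OF J(1)]] and d' = coproductD[OF \<mu>[OF J(2)]]
    have "\<mu> J' i \<in> Hom T (X i) (B J')" if "i \<in> J" for i using d'(2) J(3) that by blast
    then obtain j where j: "j \<in> Hom T (B J) (B J')" "\<And>i. i \<in> J \<Longrightarrow> j \<cdot> \<mu> J i = \<mu> J' i"
      by (rule coproduct_map[OF \<mu>[OF J(1)] d'(1), of "\<mu> J'"]) blast+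
    have "v J' \<cdot> j = v J"
    proof (rule coproduct_ext[OF \<mu>[OF J(1)], of _ A])
      fix i assume i: "i \<in> J"
      have "(v J' \<cdot> j) \<cdot> \<mu> J i = v J' \<cdot> \<mu> J' i" using j v(1)[OF J(2)] d(2)[OF i] i by (simp add: in_Hom)
      then show "(v J' \<cdot> j) \<cdot> \<mu> J i = v J \<cdot> \<mu> J i" using v(2)[OF J(1) i] v(2)[OF J(2), of i] i J(3) by auto
    qed (use v(1)[OF J(1)] v(1)[OF J(2)] j(1) in \<open>simp_all add: in_Hom\<close>)
    moreover have "Res F j (b J') = b J"
    proof (rule Mod_ext[OF F _ _ B[OF J(1)] \<mu>[OF J(1)]])
      show "|J| <o \<alpha>" using J(1) unfolding \<J>_def by simp
      show "X i \<in> \<C>" if "i \<in> J" for i using that X J(1) unfolding \<J>_def by blast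
      show "Res F j (b J') \<in> carrier (Val F (B J))"
        using hom_in_carrier[OF ModD(2)[OF F B[OF J(1)] B[OF J(2)] j(1)] b(1)[OF J(2)]] .
      show "b J \<in> carrier (Val F (B J))" using b(1)[OF J(1)] .
      fix i assume i: "i \<in> J"
      have XC: "X i \<in> \<C>" using i X J(1) unfolding \<J>_def by blast
      have "Res F (\<mu> J i) (Res F j (b J')) = Res F (j \<cdot> \<mu> J i) (b J')"
        using ModD(4)[OF F XC B[OF J(1)] B[OF J(2)] d(2)[OF i] j(1) b(1)[OF J(2)]] by simp
      also have "\<dots> = Res F (\<mu> J i) (b J)" using j(2)[OF i] b(2)[OF J(1) i] b(2)[OF J(2), of i] i J(3) by auto
      finally show "Res F (\<mu> J i) (Res F j (b J')) = Res F (\<mu> J i) (b J)" .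
    qed
    ultimately show ?thesis using j(1) by blast
  qed
  have enlarge: "\<exists>u' \<in> Hom T C (B J'). v J' \<cdot> u' = v J \<cdot> u \<and> Res F u' (b J') = Res F u (b J)"
    if C: "C \<in> \<C>" and J: "J \<in> \<J>" "J' \<in> \<J>" "J \<subseteq> J'" and u: "u \<in> Hom T C (B J)" for C J J' u
  proof -
    obtain j where j: "j \<in> Hom T (B J) (B J')" "v J' \<cdot> j = v J" "Res F j (b J') = b J" using mono[OF J] by blast
    have "v J' \<cdot> j \<cdot> u = v J \<cdot> u" using comp_extend[OF j(2), of u] v(1)[OF J(2)] j(1) u by (simp add: in_Hom)
    moreover have "Res F (j \<cdot> u) (b J') = Res F u (b J)"
      using ModD(4)[OF F C B[OF J(1)] B[OF J(2)] u j(1) b(1)[OF J(2)]] j(3) by simp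
    ultimately show ?thesis using j(1) u by (intro bexI[of _ "j \<cdot> u"]) (simp_all add: in_Hom)
  qed
  have Un: "J \<union> J' \<in> \<J>" if "J \<in> \<J>" "J' \<in> \<J>" for J J'
    using that \<alpha>_regular card_of_Un_ordLess_infinite_Field unfolding \<J>_def regular_cardinal_def by blast
  \<comment> \<open>Pass to the union of the two index sets; there the factorizations agree, because \<open>v\<close> is a monomorphism.\<close>
  have uniq: "Res F u (b J) = Res F u' (b J')"
    if C: "C \<in> \<C>" and J: "J \<in> \<J>" "J' \<in> \<J>" and u: "u \<in> Hom T C (B J)" "u' \<in> Hom T C (B J')" and vu: "v J \<cdot> u = v J' \<cdot> u'"
    for C J J' u u'
  proof -
    let ?K = "J \<union> J'"
    have K: "?K \<in> \<J>" using Un[OF J] .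
    obtain w where w: "w \<in> Hom T C (B ?K)" "v ?K \<cdot> w = v J \<cdot> u" "Res F w (b ?K) = Res F u (b J)"
      using enlarge[OF C J(1) K _ u(1)] by auto
    obtain w' where w': "w' \<in> Hom T C (B ?K)" "v ?K \<cdot> w' = v J' \<cdot> u'" "Res F w' (b ?K) = Res F u' (b J')"
      using enlarge[OF C J(2) K _ u(2)] by auto
    have "w = w'" using split_mono_cancel[OF v(1)[OF K] r(1)[OF K] r(2)[OF K] w(1) w'(1)] w(2) w'(2) vu by simp
    then show ?thesis using w(3) w'(3) by simp
  qed
  define s where "s C x = (SOME z. \<exists>J \<in> \<J>. \<exists>u \<in> Hom T C (B J). v J \<cdot> u = x \<and> z = Res F u (b J))" for C x
  have s: "s C (v J \<cdot> u) = Res F u (b J)" if "C \<in> \<C>" "J \<in> \<J>" "u \<in> Hom T C (B J)" for C J u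
  proof -
    have "\<exists>J' \<in> \<J>. \<exists>u' \<in> Hom T C (B J'). v J' \<cdot> u' = v J \<cdot> u \<and> s C (v J \<cdot> u) = Res F u' (b J')"
      unfolding s_def by (rule someI_ex) (use that in blast)
    then show ?thesis using uniq that by metis
  qed
  have carr: "Res F u (b J) \<in> carrier (Val F C)" if "C \<in> \<C>" "J \<in> \<J>" "u \<in> Hom T C (B J)" for C J u
    using hom_in_carrier[OF ModD(2)[OF F that(1) B[OF that(2)] that(3)] b(1)[OF that(2)]] .
  have "is_Mod_map T \<C> (yonedaO T A) F s"
    unfolding is_Mod_map_def
  proof (intro conjI ballI)
    fix C assume C: "C \<in> \<C>"
    show "s C \<in> hom (Val (yonedaO T A) C) (Val F C)"
    proof (rule homI)
      fix x assume "x \<in> carrier (Val (yonedaO T A) C)"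
      then obtain J u where "J \<in> \<J>" "u \<in> Hom T C (B J)" "v J \<cdot> u = x" using factor[OF C, of x] by auto
      then show "s C x \<in> carrier (Val F C)" using s[OF C] carr[OF C] by auto
    next
      fix x x' assume "x \<in> carrier (Val (yonedaO T A) C)" "x' \<in> carrier (Val (yonedaO T A) C)"
      then obtain J u J' u' where J: "J \<in> \<J>" "u \<in> Hom T C (B J)" "v J \<cdot> u = x"
        and J': "J' \<in> \<J>" "u' \<in> Hom T C (B J')" "v J' \<cdot> u' = x'" using factor[OF C, of x] factor[OF C, of x'] by auto
      let ?K = "J \<union> J'"
      have K: "?K \<in> \<J>" using Un J J' by blast
      obtain w where w: "w \<in> Hom T C (B ?K)" "v ?K \<cdot> w = x" using enlarge[OF C J(1) K _ J(2)] J(3) by auto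
      obtain w' where w': "w' \<in> Hom T C (B ?K)" "v ?K \<cdot> w' = x'" using enlarge[OF C J'(1) K _ J'(2)] J'(3) by auto
      have "v ?K \<cdot> (w \<oplus> w') = x \<oplus> x'" using w w' v(1)[OF K] by (simp add: in_Hom)
      then have "s C (x \<oplus> x') = Res F (w \<oplus> w') (b ?K)"
        using s[OF C K, of "w \<oplus> w'"] w(1) w'(1) by (simp add: in_Hom)
      also have "\<dots> = s C x \<otimes>\<^bsub>Val F C\<^esub> s C x'"
        using Mod_additive[OF F C B[OF K] w(1) w'(1) b(1)[OF K]] s[OF C K w(1)] s[OF C K w'(1)] w(2) w'(2) by simp
      finally show "s C (x \<otimes>\<^bsub>Val (yonedaO T A) C\<^esub> x') = s C x \<otimes>\<^bsub>Val F C\<^esub> s C x'" by simp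
    qed
  next
    fix C D u x assume C: "C \<in> \<C>" and D: "D \<in> \<C>" and u: "u \<in> Hom T C D" and x: "x \<in> carrier (Val (yonedaO T A) D)"
    obtain J w where J: "J \<in> \<J>" and w: "w \<in> Hom T D (B J)" "v J \<cdot> w = x" using factor[OF D, of x] x by auto
    have "x \<cdot> u = v J \<cdot> (w \<cdot> u)" using comp_extend[OF w(2), of u] v(1)[OF J] w(1) u by (simp add: in_Hom)
    then have "s C (x \<cdot> u) = Res F (w \<cdot> u) (b J)" using s[OF C J, of "w \<cdot> u"] w(1) u by (simp add: in_Hom)
    also have "\<dots> = Res F u (s D x)" using ModD(4)[OF F C D B[OF J] u w(1) b(1)[OF J]] s[OF D J w(1)] w(2) by simp
    finally show "s C (Res (yonedaO T A) u x) = Res F u (s D x)" by simp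
  qed
  moreover have "e C (s C x) = t C x" if C: "C \<in> \<C>" and x: "x \<in> carrier (Val (yonedaO T A) C)" for C x
  proof -
    obtain J w where J: "J \<in> \<J>" and w: "w \<in> Hom T C (B J)" "v J \<cdot> w = x" using factor[OF C, of x] x by auto
    have J': "|J| <o \<alpha>" "\<And>i. i \<in> J \<Longrightarrow> X i \<in> \<C>" "J \<subseteq> I" using J X unfolding \<J>_def by auto
    note d = coproductD[OF \<mu>[OF J]]
    have eb: "e (B J) (b J) = t (B J) (v J)"
    proof (rule Mod_ext[OF G J'(1,2) B[OF J] \<mu>[OF J]])
      show "e (B J) (b J) \<in> carrier (Val G (B J))" "t (B J) (v J) \<in> carrier (Val G (B J))"
        using eh th B b(1) v(1) J by blast+
      fix i assume i: "i \<in> J"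
      have "Res G (\<mu> J i) (e (B J) (b J)) = e (X i) (y i)"
        using en[OF J'(2)[OF i] B[OF J] d(2)[OF i] b(1)[OF J]] b(2)[OF J i] by simp
      also have "\<dots> = t (X i) (v J \<cdot> \<mu> J i)" using y(2)[of i] v(2)[OF J i] i J'(3) by auto
      also have "\<dots> = Res G (\<mu> J i) (t (B J) (v J))" using tn[OF J'(2)[OF i] B[OF J] d(2)[OF i] v(1)[OF J]] .
      finally show "Res G (\<mu> J i) (e (B J) (b J)) = Res G (\<mu> J i) (t (B J) (v J))" .
    qed
    have "e C (s C x) = Res G w (e (B J) (b J))" using s[OF C J w(1)] w(2) en[OF C B[OF J] w(1) b(1)[OF J]] by simp
    also have "\<dots> = t C x" using eb tn[OF C B[OF J] w(1) v(1)[OF J]] w(2) by simp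
    finally show ?thesis .
  qed
  ultimately show "\<exists>s. is_Mod_map T \<C> (yonedaO T A) F s \<and>
      (\<forall>C \<in> \<C>. \<forall>x \<in> carrier (Val (yonedaO T A) C). e C (s C x) = t C x)" by blast
qed

lemma Mod_map_precomp:
  assumes t: "is_Mod_map T \<C> (yonedaO T Y) G t" and r: "r \<in> Hom T X Y"
  shows "is_Mod_map T \<C> (yonedaO T X) G (\<lambda>C x. t C (r \<cdot> x))"
  unfolding is_Mod_map_def
proof (intro conjI ballI)
  fix C assume C: "C \<in> \<C>"
  have tC: "t C \<in> hom (Hom_group T C Y) (Val G C)" using t C unfolding is_Mod_map_def by simp
  show "(\<lambda>x. t C (r \<cdot> x)) \<in> hom (Val (yonedaO T X) C) (Val G C)"
  proof (rule homI)
    fix x assume "x \<in> carrier (Val (yonedaO T X) C)"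
    then have "r \<cdot> x \<in> carrier (Hom_group T C Y)" using r by (simp add: in_Hom)
    then show "t C (r \<cdot> x) \<in> carrier (Val G C)" by (rule hom_in_carrier[OF tC])
  next
    fix x y assume xy: "x \<in> carrier (Val (yonedaO T X) C)" "y \<in> carrier (Val (yonedaO T X) C)"
    then have "r \<cdot> x \<in> carrier (Hom_group T C Y)" "r \<cdot> y \<in> carrier (Hom_group T C Y)" using r by (simp_all add: in_Hom)
    from hom_mult[OF tC this]
    show "t C (r \<cdot> (x \<otimes>\<^bsub>Val (yonedaO T X) C\<^esub> y)) = t C (r \<cdot> x) \<otimes>\<^bsub>Val G C\<^esub> t C (r \<cdot> y)"
      using xy r by (simp add: in_Hom)
  qed
next
  fix C D u x assume C: "C \<in> \<C>" "D \<in> \<C>" "u \<in> Hom T C D" "x \<in> carrier (Val (yonedaO T X) D)"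
  then have "r \<cdot> x \<in> Hom T D Y" using r by (simp add: in_Hom)
  then have "t C ((r \<cdot> x) \<cdot> u) = Res G u (t D (r \<cdot> x))" using t C unfolding is_Mod_map_def by simp
  then show "t C (r \<cdot> Res (yonedaO T X) u x) = Res G u (t D (r \<cdot> x))" using C r by (simp add: in_Hom)
qed

lemma Add_Mod_projective:
  assumes P: "P \<in> AddC"
  shows "Mod_projective T \<kappa> \<alpha> \<C> (yonedaO T P)"
proof -
  obtain I :: "'k set" and X A \<iota> s r where A: "|I| <o \<kappa>" "\<And>i. i \<in> I \<Longrightarrow> X i \<in> \<C>" "is_coproduct T I X A \<iota>"
    and sr: "s \<in> Hom T P A" "r \<in> Hom T A P" "r \<cdot> s = Idn T P" using Add_retract_of_coproduct[OF P] by metis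
  have proj: "Mod_projective T \<kappa> \<alpha> \<C> (yonedaO T A)" using coproduct_projective[OF A] .
  show ?thesis unfolding Mod_projective_def
  proof (intro conjI allI impI)
    show "is_Mod T \<kappa> \<alpha> \<C> (yonedaO T P)" using is_Mod_yoneda Add_Ob[OF P] .
    fix F G e t
    assume as: "is_Mod T \<kappa> \<alpha> \<C> F \<and> is_Mod T \<kappa> \<alpha> \<C> G \<and>
        is_Mod_map T \<C> F G e \<and> Mod_epi \<C> F G e \<and> is_Mod_map T \<C> (yonedaO T P) G t"
    have "is_Mod_map T \<C> (yonedaO T A) G (\<lambda>C x. t C (r \<cdot> x))" using Mod_map_precomp as sr(2) by blast
    with as have "is_Mod T \<kappa> \<alpha> \<C> F \<and> is_Mod T \<kappa> \<alpha> \<C> G \<and> is_Mod_map T \<C> F G e \<and> Mod_epi \<C> F G e \<and>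
        is_Mod_map T \<C> (yonedaO T A) G (\<lambda>C x. t C (r \<cdot> x))" by blast
    from proj[unfolded Mod_projective_def, THEN conjunct2, rule_format, OF this]
    obtain s' where s': "is_Mod_map T \<C> (yonedaO T A) F s'" "\<forall>C \<in> \<C>. \<forall>x \<in> Hom T C A. e C (s' C x) = t C (r \<cdot> x)"
      by auto
    have "is_Mod_map T \<C> (yonedaO T P) F (\<lambda>C x. s' C (s \<cdot> x))" by (rule Mod_map_precomp[OF s'(1) sr(1)])
    moreover have "e C (s' C (s \<cdot> x)) = t C x" if "C \<in> \<C>" "x \<in> carrier (Val (yonedaO T P) C)" for C x
    proof -
      have "s \<cdot> x \<in> Hom T C A" using that sr by (simp add: in_Hom)
      then have "e C (s' C (s \<cdot> x)) = t C (r \<cdot> s \<cdot> x)" using s'(2) that by blast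
      also have "r \<cdot> s \<cdot> x = x" using comp_extend[OF sr(3), of x] sr(1,2) that by (simp add: in_Hom)
      finally show ?thesis .
    qed
    ultimately show "\<exists>s. is_Mod_map T \<C> (yonedaO T P) F s \<and>
        (\<forall>C \<in> \<C>. \<forall>x \<in> carrier (Val (yonedaO T P) C). e C (s C x) = t C x)" by blast
  qed
qed

end

section \<open>Existence of Postnikov resolutions\<close>

context resolution_setting
begin

lemma C_exactI:
  assumes "f \<in> Hom T X Y" "g \<in> Hom T Y Z"
    and "\<And>C u. C \<in> \<C> \<Longrightarrow> u \<in> Hom T C Y \<Longrightarrow> g \<cdot> u = Zero T C Z \<Longrightarrow> \<exists>x \<in> Hom T C X. f \<cdot> x = u"
  shows "C_exact f g"
proof -
  have d: "Dom T f = X" "Cod T f = Y" "Dom T g = Y" "Cod T g = Z" "f \<in> Arr T" "g \<in> Arr T"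
    using assms(1,2) by (simp_all add: in_Hom)
  show ?thesis unfolding C_exact_def d(1-4) using d(5,6) assms(3) by blast
qed

lemma Mod_exactD:
  assumes ex: "Mod_exact \<C> (yonedaO T X) (yonedaA T f) (yonedaO T Y) (yonedaA T g) (yonedaO T Z)"
    and f: "f \<in> Hom T X Y" and g: "g \<in> Hom T Y Z"
  shows "C_exact f g"
proof (rule C_exactI[OF f g])
  fix C u assume C: "C \<in> \<C>" and u: "u \<in> Hom T C Y" "g \<cdot> u = Zero T C Z"
  then have "u \<in> kernel (Hom_group T C Y) (Hom_group T C Z) (yonedaA T g C)" by (simp add: kernel_def)
  then have "u \<in> yonedaA T f C ` Hom T C X" using ex C unfolding Mod_exact_def by simp
  then show "\<exists>x \<in> Hom T C X. f \<cdot> x = u" by auto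
qed

lemma Mod_exactI:
  assumes ex: "C_exact f g" and f: "f \<in> Hom T X Y" and g: "g \<in> Hom T Y Z" and gf: "g \<cdot> f = Zero T X Z"
  shows "Mod_exact \<C> (yonedaO T X) (yonedaA T f) (yonedaO T Y) (yonedaA T g) (yonedaO T Z)"
  unfolding Mod_exact_def
proof
  fix C assume C: "C \<in> \<C>"
  show "yonedaA T f C ` carrier (Val (yonedaO T X) C) = kernel (Val (yonedaO T Y) C) (Val (yonedaO T Z) C) (yonedaA T g C)"
  proof (intro equalityI subsetI)
    fix u assume "u \<in> yonedaA T f C ` carrier (Val (yonedaO T X) C)"
    then obtain x where x: "x \<in> Hom T C X" "u = f \<cdot> x" by auto
    have "g \<cdot> f \<cdot> x = Zero T C Z" using comp_extend[OF gf, of x] f g x(1) Hom_Ob[OF g] by (simp add: in_Hom)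
    then show "u \<in> kernel (Val (yonedaO T Y) C) (Val (yonedaO T Z) C) (yonedaA T g C)"
      using x f by (simp add: kernel_def in_Hom)
  next
    fix u assume "u \<in> kernel (Val (yonedaO T Y) C) (Val (yonedaO T Z) C) (yonedaA T g C)"
    then have "u \<in> Hom T C Y" "g \<cdot> u = Zero T C Z" by (simp_all add: kernel_def)
    then obtain x where "x \<in> Hom T C X" "f \<cdot> x = u" by (rule C_exact_lift[OF ex f g Add_closure.base[OF C]])
    then show "u \<in> yonedaA T f C ` carrier (Val (yonedaO T X) C)" by (intro image_eqI[of _ _ x]) simp_all
  qed
qed

lemma Mod_epi_yoneda_iff:
  assumes "f \<in> Hom T X Y"
  shows "Mod_epi \<C> (yonedaO T X) (yonedaO T Y) (yonedaA T f) \<longleftrightarrow> C_epi f"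
proof -
  have d: "Dom T f = X" "Cod T f = Y" using assms by (simp_all add: in_Hom)
  have "yonedaA T f C = (\<lambda>u. f \<cdot> u)" for C by (simp add: fun_eq_iff)
  then show ?thesis unfolding Mod_epi_def surjective_on_def d by simp
qed

text \<open>
  A map from \<open>C\<close> to \<open>W\<close> lifts along \<open>g\<close>, and \<open>t \<cdot> g = 0\<close>.
\<close>

lemma cone_of_cover_phantom:
  assumes tri: "exact_triangle T P W N g t b" and s: "C_epi g"
  shows "C_phantom t"
  unfolding phantom_iff
proof (intro conjI ballI)
  note d = triD[OF tri]
  show "t \<in> Arr T" using d by (simp add: in_Hom)
  fix C u assume C: "C \<in> \<C>" and "u \<in> Hom T C (Dom T t)"
  then have u: "u \<in> Hom T C (Cod T g)" using d by (simp add: in_Hom)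
  obtain x where x: "x \<in> Hom T C (Dom T g)" "g \<cdot> x = u" by (rule surjective_onD[OF s C u])
  have "t \<cdot> g \<cdot> x = Zero T P N \<cdot> x" using comp_extend[OF tri_comp1[OF tri], of x] x(1) d by (simp add: in_Hom)
  then show "t \<cdot> u = Zero T C (Cod T t)" using x d by (simp add: in_Hom)
qed

lemma ex_phantom_tower:
  assumes X: "X \<in> Ob T"
  shows "\<exists>W P g t b. W 0 = X \<and> (\<forall>n. P n \<in> AddC \<and> exact_triangle T (P n) (W n) (W (Suc n)) (g n) (t n) (b n) \<and>
    C_epi (g n))"
proof -
  define S where "S V P N g t b \<longleftrightarrow> P \<in> AddC \<and> exact_triangle T P V N g t b \<and> C_epi g" for V P N g t b
  have "\<exists>P N g t b. S V P N g t b" if V: "V \<in> Ob T" for V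
  proof -
    obtain I :: "'k set" and Y A \<iota> g where "|I| <o \<kappa>" "\<And>i. i \<in> I \<Longrightarrow> Y i \<in> \<C>" "is_coproduct T I Y A \<iota>"
      and g: "g \<in> Hom T A V" "C_epi g" using ex_cover[OF V] by metis
    then have A: "A \<in> AddC" using Add_coproduct by metis
    obtain N t b where "exact_triangle T A V N g t b" using triangle_complete[OF g(1)] by blast
    then show ?thesis unfolding S_def using A g(2) by blast
  qed
  then have "\<forall>V. \<exists>N. V \<in> Ob T \<longrightarrow> (\<exists>P g t b. S V P N g t b)" by blast
  from choice[OF this] obtain N where N: "\<And>V. V \<in> Ob T \<Longrightarrow> \<exists>P g t b. S V P (N V) g t b" by blast
  define W where "W n = (N ^^ n) X" for n
  have W0: "W 0 = X" and WS: "W (Suc n) = N (W n)" for n unfolding W_def by simp_all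
  have WO: "W n \<in> Ob T" for n
  proof (induction n)
    case (Suc n)
    then show ?case using N[OF Suc] triD(6) unfolding WS S_def by blast
  qed (use W0 X in simp)
  have "\<forall>n. \<exists>P g t b. S (W n) P (W (Suc n)) g t b" using N WO WS by simp
  then obtain P g t b where "\<And>n. S (W n) (P n) (W (Suc n)) (g n) (t n) (b n)" by metis
  then show ?thesis using W0 unfolding S_def by blast
qed

text \<open>
  In the phantom tower \<open>W\<close> let \<open>X\<^sub>n\<close> be the cone of \<open>X \<rightarrow> W\<^bsub>n+1\<^esub>\<close>. The octahedral axiom for
  \<open>X \<rightarrow> W\<^sub>n \<rightarrow> W\<^bsub>n+1\<^esub>\<close> yields the triangles \<open>P\<^sub>n \<rightarrow> X\<^bsub>n-1\<^esub> \<rightarrow> X\<^sub>n \<rightarrow> \<Sigma> P\<^sub>n\<close>, and its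
  commutativity relations identify the differentials with the composites \<open>P\<^bsub>n+1\<^esub> \<rightarrow> W\<^bsub>n+1\<^esub> \<rightarrow> \<Sigma> P\<^sub>n\<close>.
  These are exact because the first map is surjective on maps from the subcategory and \<open>W\<^bsub>n+1\<^esub> \<rightarrow> \<Sigma> P\<^sub>n\<close>
  is injective on them, its predecessor in the triangle being a phantom map.
\<close>

theorem ex_postnikov:
  assumes X: "X \<in> Ob T"
  shows "\<exists>R. resolution R \<and> pk_base R = X"
proof -
  obtain W P g t b where W0: "W 0 = X" and PA: "\<And>n. P n \<in> AddC"
    and tri: "\<And>n. exact_triangle T (P n) (W n) (W (Suc n)) (g n) (t n) (b n)"
    and sg: "\<And>n. C_epi (g n)" using ex_phantom_tower[OF X] by metis
  note d = triD[OF tri]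
  define w where "w = rec_nat (Idn T X) (\<lambda>n x. t n \<cdot> x)"
  have w0: "w 0 = Idn T X" and wS: "w (Suc n) = t n \<cdot> w n" for n unfolding w_def by simp_all
  have w: "w n \<in> Hom T X (W n)" for n
    by (induction n) (use w0 wS W0 X d in \<open>simp_all add: in_Hom\<close>)
  \<comment> \<open>The object \<open>V n\<close> is the stage \<open>X\<^bsub>n-1\<^esub>\<close>; for \<open>n = 0\<close> it has to be the chosen zero object.\<close>
  have "\<exists>V a p. exact_triangle T X (W n) V (w n) a p \<and> (n = 0 \<longrightarrow> V = zero_ob T)" for n
  proof (cases n)
    case 0
    then show ?thesis using triangle_id[OF X zero_ob_is_zero] w0 W0 by auto
  next
    case (Suc k)
    then show ?thesis using triangle_complete[OF w[of n]] by blast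
  qed
  then obtain V a p where tV: "\<And>n. exact_triangle T X (W n) (V n) (w n) (a n) (p n)" and V0: "V 0 = zero_ob T"
    by metis
  note v = triD[OF tV]
  have "\<exists>i q. exact_triangle T (V n) (V (Suc n)) (SO (P n)) i q (SA (a n) \<cdot> neg T (SA (g n))) \<and>
      i \<cdot> a n = a (Suc n) \<cdot> t n \<and> q \<cdot> a (Suc n) = b n \<and> p (Suc n) \<cdot> i = p n \<and>
      neg T (SA (g n)) \<cdot> q = SA (w n) \<cdot> p (Suc n)" for n
    using octahedral[OF tV[of n] tri_rot[OF tri[of n]] tV[of "Suc n", unfolded wS]] .
  then obtain i q where oct: "\<And>n. exact_triangle T (V n) (V (Suc n)) (SO (P n)) (i n) (q n) (SA (a n) \<cdot> neg T (SA (g n)))"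
    and ia: "\<And>n. i n \<cdot> a n = a (Suc n) \<cdot> t n" and qa: "\<And>n. q n \<cdot> a (Suc n) = b n"
    and pi: "\<And>n. p (Suc n) \<cdot> i n = p n" and gq: "\<And>n. neg T (SA (g n)) \<cdot> q n = SA (w n) \<cdot> p (Suc n)" by metis
  note o = triD[OF oct]
  define f where "f n = a n \<cdot> g n" for n
  have f: "f n \<in> Hom T (P n) (V n)" for n unfolding f_def using d v by (simp add: in_Hom)
  have tf: "exact_triangle T (P n) (V n) (V (Suc n)) (f n) (i n) (q n)" for n
  proof (subst triangle_rotate)
    show "candidate_triangle T (P n) (V n) (V (Suc n)) (f n) (i n) (q n)"
      unfolding candidate_triangle_def using f o by simp
    have "neg T (SA (f n)) = SA (a n) \<cdot> neg T (SA (g n))" unfolding f_def using d v by (simp add: in_Hom)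
    then show "exact_triangle T (V n) (V (Suc n)) (SO (P n)) (i n) (q n) (neg T (SA (f n)))" using oct[of n] by simp
  qed
  define R where "R = \<lparr>pk_base = X, pk_X = \<lambda>n. V (Suc n), pk_P = P, pk_f = f, pk_i = i, pk_q = q, pk_p = \<lambda>n. p (Suc n)\<rparr>"
  have pv: "prevX T R n = V n" for n unfolding prevX_def R_def using V0 by (simp split: nat.split)
  \<comment> \<open>The rotation of the first triangle introduces a sign: \<open>p\<^sub>0 \<cdot> q\<^sub>0\<^bsup>-1\<^esup> = - \<Sigma> g\<^sub>0\<close>.\<close>
  define e where "e = neg T (g 0)"
  have e: "e \<in> Hom T (P 0) X" unfolding e_def using d[of 0] W0 by (simp add: in_Hom)
  have SAe: "SA e = neg T (SA (g 0))" unfolding e_def using d[of 0] by (simp add: in_Hom)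
  have dn: "q n \<cdot> f (Suc n) = b n \<cdot> g (Suc n)" for n
    unfolding f_def using comp_extend[OF qa[of n], of "g (Suc n)"] o[of n] v(1-3)[of "Suc n"] d[of "Suc n"] by (simp add: in_Hom)
  have dH: "b n \<cdot> g (Suc n) \<in> Hom T (P (Suc n)) (SO (P n))" for n using d by (simp add: in_Hom)
  have PO: "P n \<in> Ob T" for n using d by blast
  have SAd: "SA (b n \<cdot> g (Suc n)) = SA (b n) \<cdot> SA (g (Suc n))" for n using d by (simp add: in_Hom)
  have eSA: "SA e = p (Suc 0) \<cdot> inverse_arr T (q 0)"
  proof -
    obtain r where r: "r \<in> Hom T (SO (P 0)) (V (Suc 0))" "r \<cdot> q 0 = Idn T (V (Suc 0))" "q 0 \<cdot> r = Idn T (SO (P 0))"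
      using tri_zero_middle_iso[OF tf[of 0]] V0 zero_ob_is_zero by metis
    have inv: "inverse_arr T (q 0) = r" using inverse_arr_eq[OF o(2)[of 0] r] .
    have "p (Suc 0) = neg T (SA (g 0)) \<cdot> q 0" using gq[of 0] w0 X v(3)[of "Suc 0"] by (simp add: in_Hom)
    then have "p (Suc 0) \<cdot> r = (neg T (SA (g 0)) \<cdot> q 0) \<cdot> r" by simp
    also have "\<dots> = neg T (SA (g 0))" using r(1,3) o[of 0] d[of 0] by (simp add: in_Hom)
    finally show ?thesis using inv SAe by simp
  qed
  have epi: "C_epi e"
  proof (rule surjective_onI[OF e])
    fix C u assume C: "C \<in> \<C>" and u: "u \<in> Hom T C X"
    obtain x where x: "x \<in> Hom T C (P 0)" "g 0 \<cdot> x = u"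
      using Add_projective[OF sg[of 0] d(1)[of 0] Add_closure.base[OF C], of u] u W0 by auto
    then show "\<exists>x \<in> Hom T C (P 0). e \<cdot> x = u"
      unfolding e_def using d[of 0] by (intro bexI[of _ "neg T x"]) (auto simp: in_Hom)
  qed
  have lift_d: "\<exists>z \<in> Hom T C (P (Suc n)). (b n \<cdot> g (Suc n)) \<cdot> z = u"
    if C: "C \<in> \<C>" and u: "u \<in> Hom T C (SO (P n))" and z: "SA (g n) \<cdot> u = Zero T C (SO (W n))" for C u n
  proof -
    obtain y where y: "y \<in> Hom T C (W (Suc n))" "b n \<cdot> y = u" using tri_lift3[OF tri u z] .
    obtain z where "z \<in> Hom T C (P (Suc n))" "g (Suc n) \<cdot> z = y"
      using Add_projective[OF sg[of "Suc n"] d(1)[of "Suc n"] Add_closure.base[OF C] y(1)] .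
    then show ?thesis using y d[of n] d[of "Suc n"] by (intro bexI[of _ z]) (simp_all add: in_Hom)
  qed
  have ex0: "C_exact (b 0 \<cdot> g (Suc 0)) (SA e)"
  proof (rule C_exactI[OF dH])
    show "SA e \<in> Hom T (SO (P 0)) (SO X)" using e by (simp add: in_Hom)
    fix C u assume C: "C \<in> \<C>" and u': "u \<in> Hom T C (SO (P 0))" and u: "SA e \<cdot> u = Zero T C (SO X)"
    have "neg T (SA (g 0) \<cdot> u) = Zero T C (SO (W 0))" using u u' d[of 0] e W0 unfolding SAe by (simp add: in_Hom)
    then have "SA (g 0) \<cdot> u = Zero T C (SO (W 0))"
      using neg_eq_ZeroD[of "SA (g 0) \<cdot> u" C "SO (W 0)"] u' d[of 0] by (simp add: in_Hom)
    then show "\<exists>x \<in> Hom T C (P (Suc 0)). (b 0 \<cdot> g (Suc 0)) \<cdot> x = u" using lift_d[OF C u'] by blast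
  qed
  have z0: "SA e \<cdot> (b 0 \<cdot> g (Suc 0)) = Zero T (P (Suc 0)) (SO X)"
    using comp_extend[OF tri_comp3[OF tri[of 0]], of "g (Suc 0)"] d[of 0] d[of "Suc 0"] W0 X unfolding SAe by (simp add: in_Hom)
  have exS: "C_exact (b (Suc n) \<cdot> g (Suc (Suc n))) (SA (b n \<cdot> g (Suc n)))" for n
  proof (rule C_exactI[OF dH])
    show "SA (b n \<cdot> g (Suc n)) \<in> Hom T (SO (P (Suc n))) (SO (SO (P n)))" using dH[of n] by (simp add: in_Hom)
    fix C u assume C: "C \<in> \<C>" and u': "u \<in> Hom T C (SO (P (Suc n)))"
      and u: "SA (b n \<cdot> g (Suc n)) \<cdot> u = Zero T C (SO (SO (P n)))"
    have gu: "SA (g (Suc n)) \<cdot> u \<in> Hom T C (SO (W (Suc n)))" using u' d[of "Suc n"] by (simp add: in_Hom)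
    have "SA (b n) \<cdot> SA (g (Suc n)) \<cdot> u = Zero T C (SO (SO (P n)))"
      using u u' d[of n] d[of "Suc n"] unfolding SAd by (simp add: in_Hom)
    then obtain y where y: "y \<in> Hom T C (SO (W n))" "SA (t n) \<cdot> y = SA (g (Suc n)) \<cdot> u"
      using tri_susp_lift2[OF tri[of n] gu] by blast
    have "C_phantom (SA (t n))" using phantom_susp[OF cone_of_cover_phantom[OF tri sg]] .
    then have "SA (g (Suc n)) \<cdot> u = Zero T C (SO (W (Suc n)))"
      using y C d[of n] unfolding phantom_iff by (simp add: in_Hom)
    then show "\<exists>x \<in> Hom T C (P (Suc (Suc n))). (b (Suc n) \<cdot> g (Suc (Suc n))) \<cdot> x = u" using lift_d[OF C u'] by blast
  qed
  have zS: "SA (b n \<cdot> g (Suc n)) \<cdot> (b (Suc n) \<cdot> g (Suc (Suc n))) = Zero T (P (Suc (Suc n))) (SO (SO (P n)))" for n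
  proof -
    have "SA (g (Suc n)) \<cdot> b (Suc n) \<cdot> g (Suc (Suc n)) = Zero T (P (Suc (Suc n))) (SO (W (Suc n)))"
      using comp_extend[OF tri_comp3[OF tri[of "Suc n"]], of "g (Suc (Suc n))"] d[of "Suc n"] d[of "Suc (Suc n)"] by (simp add: in_Hom)
    then show ?thesis unfolding SAd using d[of n] d[of "Suc n"] d[of "Suc (Suc n)"] by (simp add: in_Hom)
  qed
  have "graded_projective_resolution T \<kappa> \<alpha> \<C> X P e (\<lambda>n. q n \<cdot> f (Suc n))"
    unfolding graded_projective_resolution_def dn
  proof (intro conjI allI)
    show "Mod_epi \<C> (yonedaO T (P 0)) (yonedaO T X) (yonedaA T e)" using Mod_epi_yoneda_iff[OF e] epi by simp
    show "Mod_exact \<C> (yonedaO T (P 1)) (yonedaA T (b 0 \<cdot> g (Suc 0)))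
       (yonedaO T (SO (P 0))) (yonedaA T (SA e)) (yonedaO T (SO X))"
      using Mod_exactI[OF ex0 dH _ z0] e by (simp add: in_Hom)
    show "Mod_exact \<C> (yonedaO T (P (Suc (Suc n)))) (yonedaA T (b (Suc n) \<cdot> g (Suc (Suc n))))
       (yonedaO T (SO (P (Suc n)))) (yonedaA T (SA (b n \<cdot> g (Suc n)))) (yonedaO T (SO (SO (P n))))" for n
      by (rule Mod_exactI[OF exS dH _ zS]) (use dH[of n] in \<open>simp add: in_Hom\<close>)
  qed (use e dH PA X Add_Mod_projective is_Mod_yoneda in auto)
  then have "resolution R"
    unfolding is_postnikov_def pv using X PA tf v(3) pi eSA by (auto simp: R_def)
  moreover have "pk_base R = X" by (simp add: R_def)
  ultimately show ?thesis by blast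
qed

end

section \<open>Exactness along a Postnikov resolution\<close>

lemma prevX_simps [simp]: "prevX T R 0 = zero_ob T" "prevX T R (Suc n) = pk_X R n"
  by (simp_all add: prevX_def)

context resolution_setting
begin

lemma postnikovD:
  assumes "resolution R"
  shows "pk_base R \<in> Ob T" "pk_P R n \<in> AddC"
    and "exact_triangle T (pk_P R n) (prevX T R n) (pk_X R n) (pk_f R n) (pk_i R n) (pk_q R n)"
    and "pk_p R n \<in> Hom T (pk_X R n) (SO (pk_base R))"
    and "pk_p R (Suc n) \<cdot> pk_i R (Suc n) = pk_p R n"
proof -
  note c = assms[unfolded is_postnikov_def]
  show "pk_base R \<in> Ob T" by (rule c[THEN conjunct1])
  show "pk_P R n \<in> AddC" by (rule c[THEN conjunct2, THEN conjunct1, THEN spec])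
  show "exact_triangle T (pk_P R n) (prevX T R n) (pk_X R n) (pk_f R n) (pk_i R n) (pk_q R n)"
    by (rule c[THEN conjunct2, THEN conjunct2, THEN conjunct1, THEN spec])
  show "pk_p R n \<in> Hom T (pk_X R n) (SO (pk_base R))"
    by (rule c[THEN conjunct2, THEN conjunct2, THEN conjunct2, THEN conjunct1, THEN spec])
  show "pk_p R (Suc n) \<cdot> pk_i R (Suc n) = pk_p R n"
    by (rule c[THEN conjunct2, THEN conjunct2, THEN conjunct2, THEN conjunct2, THEN conjunct1, THEN spec, symmetric])
qed

lemma postnikov_Hom:
  assumes "resolution R"
  shows "pk_f R n \<in> Hom T (pk_P R n) (prevX T R n)" "pk_i R n \<in> Hom T (prevX T R n) (pk_X R n)"
    "pk_q R n \<in> Hom T (pk_X R n) (SO (pk_P R n))" "pk_P R n \<in> Ob T" "prevX T R n \<in> Ob T" "pk_X R n \<in> Ob T"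
    "pk_p R n \<in> Hom T (pk_X R n) (SO (pk_base R))" "pk_base R \<in> Ob T"
  using triD[OF postnikovD(3)[OF assms, of n]] postnikovD[OF assms] by blast+

lemma postnikov_augmentation:
  assumes R: "resolution R"
  obtains e r where "e \<in> Hom T (pk_P R 0) (pk_base R)" "pk_p R 0 = SA e \<cdot> pk_q R 0"
    "r \<in> Hom T (SO (pk_P R 0)) (pk_X R 0)" "r \<cdot> pk_q R 0 = Idn T (pk_X R 0)" "pk_q R 0 \<cdot> r = Idn T (SO (pk_P R 0))"
    "C_epi e" "C_exact (pk_q R 0 \<cdot> pk_f R (Suc 0)) (SA e)"
    "\<And>n. C_exact (pk_q R (Suc n) \<cdot> pk_f R (Suc (Suc n))) (SA (pk_q R n \<cdot> pk_f R (Suc n)))"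
proof -
  note h = postnikov_Hom[OF R]
  obtain e where e: "SA e = pk_p R 0 \<cdot> inverse_arr T (pk_q R 0)"
    and gr: "graded_projective_resolution T \<kappa> \<alpha> \<C> (pk_base R) (pk_P R) e (\<lambda>n. pk_q R n \<cdot> pk_f R (Suc n))"
    using R unfolding is_postnikov_def by blast
  have eH: "e \<in> Hom T (pk_P R 0) (pk_base R)" using gr unfolding graded_projective_resolution_def by simp
  obtain r where r: "r \<in> Hom T (SO (pk_P R 0)) (pk_X R 0)" "r \<cdot> pk_q R 0 = Idn T (pk_X R 0)"
    "pk_q R 0 \<cdot> r = Idn T (SO (pk_P R 0))"
    using tri_zero_middle_iso[OF postnikovD(3)[OF R, of 0]] zero_ob_is_zero by auto
  have inv: "inverse_arr T (pk_q R 0) = r" using inverse_arr_eq[OF h(3) r] .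
  have "SA e \<cdot> pk_q R 0 = pk_p R 0 \<cdot> r \<cdot> pk_q R 0" unfolding e inv using h(3,7)[of 0] r(1) by (simp add: in_Hom)
  also have "\<dots> = pk_p R 0" using h(7)[of 0] r(2) by (simp add: in_Hom)
  finally have p0: "pk_p R 0 = SA e \<cdot> pk_q R 0" by simp
  have dH: "pk_q R n \<cdot> pk_f R (Suc n) \<in> Hom T (pk_P R (Suc n)) (SO (pk_P R n))" for n
    using h(3)[of n] h(1)[of "Suc n"] by (simp add: in_Hom)
  have s: "C_epi e"
    using gr Mod_epi_yoneda_iff[OF eH] unfolding graded_projective_resolution_def by simp
  have x0: "C_exact (pk_q R 0 \<cdot> pk_f R (Suc 0)) (SA e)"
    using gr eH dH[of 0] unfolding graded_projective_resolution_def
    by (intro Mod_exactD[of "pk_P R (Suc 0)" _ "SO (pk_P R 0)" _ "SO (pk_base R)"]) (simp_all add: in_Hom)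
  have xS: "C_exact (pk_q R (Suc n) \<cdot> pk_f R (Suc (Suc n))) (SA (pk_q R n \<cdot> pk_f R (Suc n)))" for n
  proof (rule Mod_exactD[OF _ dH])
    show "Mod_exact \<C> (yonedaO T (pk_P R (Suc (Suc n)))) (yonedaA T (pk_q R (Suc n) \<cdot> pk_f R (Suc (Suc n))))
       (yonedaO T (SO (pk_P R (Suc n)))) (yonedaA T (SA (pk_q R n \<cdot> pk_f R (Suc n)))) (yonedaO T (SO (SO (pk_P R n))))"
      using gr unfolding graded_projective_resolution_def by blast
    show "SA (pk_q R n \<cdot> pk_f R (Suc n)) \<in> Hom T (SO (pk_P R (Suc n))) (SO (SO (pk_P R n)))"
      using dH[of n] by (simp add: in_Hom)
  qed
  show ?thesis using that[OF eH p0 r s x0 xS] .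
qed

text \<open>
  For \<open>n = 0\<close> the map \<open>p\<^sub>0\<close> is the suspended augmentation up to the isomorphism \<open>q\<^sub>0\<close>, and lifts
  through \<open>p\<^sub>n\<close> are pushed forward along \<open>i\<^bsub>n+1\<^esub>\<close>.
\<close>

lemma lift_through_p:
  assumes R: "resolution R" and P: "P \<in> AddC" and u: "u \<in> Hom T P (SO (pk_base R))"
  shows "\<exists>y \<in> Hom T P (pk_X R n). pk_p R n \<cdot> y = u"
proof (induction n)
  case 0
  obtain e r where e: "e \<in> Hom T (pk_P R 0) (pk_base R)" "pk_p R 0 = SA e \<cdot> pk_q R 0"
    and r: "r \<in> Hom T (SO (pk_P R 0)) (pk_X R 0)" "pk_q R 0 \<cdot> r = Idn T (SO (pk_P R 0))"
    and s: "C_epi e" by (rule postnikov_augmentation[OF R])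
  have "SA e \<in> Hom T (SO (pk_P R 0)) (SO (pk_base R))" using e(1) by (simp add: in_Hom)
  then obtain x where x: "x \<in> Hom T P (SO (pk_P R 0))" "SA e \<cdot> x = u"
    by (rule Add_projective[OF surjective_susp[OF s e(1)] _ P u])
  have "pk_p R 0 \<cdot> r \<cdot> x = SA e \<cdot> pk_q R 0 \<cdot> r \<cdot> x"
    unfolding e(2) using e(1) r(1) x(1) postnikov_Hom(3)[OF R, of 0] by (simp add: in_Hom)
  also have "pk_q R 0 \<cdot> r \<cdot> x = x"
    using comp_extend[OF r(2), of x] r(1) x(1) postnikov_Hom(3)[OF R, of 0] by (simp add: in_Hom)
  finally show ?case using x r(1) by (intro bexI[of _ "r \<cdot> x"]) (simp_all add: in_Hom)
next
  case (Suc n)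
  then obtain y where y: "y \<in> Hom T P (pk_X R n)" "pk_p R n \<cdot> y = u" by blast
  note i = postnikov_Hom(2)[OF R, of "Suc n"] and p = postnikov_Hom(7)[OF R, of "Suc n"]
  have "pk_p R (Suc n) \<cdot> pk_i R (Suc n) \<cdot> y = u"
    using comp_extend[OF postnikovD(5)[OF R, of n], of y] y i p by (simp add: in_Hom)
  then show ?case using y(1) i by (intro bexI[of _ "pk_i R (Suc n) \<cdot> y"]) (simp_all add: in_Hom)
qed

lemma pi_Hom:
  assumes R: "resolution R"
  shows "pk_p R n \<cdot> pk_i R n \<in> Hom T (prevX T R n) (SO (pk_base R))"
  using postnikov_Hom(1-7)[OF R, of n] by (simp add: in_Hom)

text \<open>
  Here \<open>p\<^sub>n \<cdot> i\<^sub>n\<close> stands for \<open>p\<^bsub>n-1\<^esub>\<close>, which makes sense for \<open>n = 0\<close> as well, where the source is zero.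
  In the induction step let \<open>u : C \<rightarrow> X\<^sub>n\<close> be killed by \<open>p\<^sub>n\<close>. Its image in \<open>\<Sigma> P\<^sub>n\<close> is a cycle of the
  resolution, hence a boundary, so \<open>u\<close> differs from some \<open>f\<^bsub>n+1\<^esub> \<cdot> x\<close> by a map that comes from
  \<open>X\<^bsub>n-1\<^esub>\<close> and is killed by \<open>p\<^bsub>n-1\<^esub>\<close>. By induction this map passes through \<open>f\<^sub>n\<close>, and so it vanishes in \<open>X\<^sub>n\<close>.
\<close>

lemma exact_at_X:
  assumes R: "resolution R"
  shows "C_exact (pk_f R n) (pk_p R n \<cdot> pk_i R n)"
proof (induction n)
  case 0
  note h = postnikov_Hom[OF R]
  show ?case
  proof (rule C_exactI[OF h(1) pi_Hom[OF R]])
    fix C u assume C: "C \<in> \<C>" and "u \<in> Hom T C (prevX T R 0)"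
    then have "u = Zero T C (zero_ob T)" using zero_ob_Hom[OF zero_ob_is_zero] by simp
    then show "\<exists>x \<in> Hom T C (pk_P R 0). pk_f R 0 \<cdot> x = u"
      using h(1)[of 0] h(4)[of 0] C_Ob[OF C] by (intro bexI[of _ "Zero T C (pk_P R 0)"]) (simp_all add: in_Hom)
  qed
next
  case (Suc n)
  note h = postnikov_Hom[OF R]
  obtain e r where e: "e \<in> Hom T (pk_P R 0) (pk_base R)" "pk_p R 0 = SA e \<cdot> pk_q R 0"
    and x0: "C_exact (pk_q R 0 \<cdot> pk_f R (Suc 0)) (SA e)"
    and xS: "\<And>n. C_exact (pk_q R (Suc n) \<cdot> pk_f R (Suc (Suc n))) (SA (pk_q R n \<cdot> pk_f R (Suc n)))"
    by (rule postnikov_augmentation[OF R]) blast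
  have dH: "pk_q R n \<cdot> pk_f R (Suc n) \<in> Hom T (pk_P R (Suc n)) (SO (pk_P R n))" for n
    using h(3)[of n] h(1)[of "Suc n"] by (simp add: in_Hom)
  have f: "pk_f R (Suc n) \<in> Hom T (pk_P R (Suc n)) (pk_X R n)" using h(1)[of "Suc n"] by simp
  show ?case unfolding postnikovD(5)[OF R]
  proof (rule C_exactI[OF f h(7)])
    fix C u assume C: "C \<in> \<C>" and u: "u \<in> Hom T C (pk_X R n)" "pk_p R n \<cdot> u = Zero T C (SO (pk_base R))"
    have CA: "C \<in> AddC" using Add_closure.base[OF C] .
    have qu: "pk_q R n \<cdot> u \<in> Hom T C (SO (pk_P R n))" using h(3)[of n] u by (simp add: in_Hom)
    obtain x where x: "x \<in> Hom T C (pk_P R (Suc n))" "(pk_q R n \<cdot> pk_f R (Suc n)) \<cdot> x = pk_q R n \<cdot> u"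
    proof (cases n)
      case 0
      have eS: "SA e \<in> Hom T (SO (pk_P R 0)) (SO (pk_base R))" using e(1) by (simp add: in_Hom)
      have "SA e \<cdot> pk_q R 0 \<cdot> u = Zero T C (SO (pk_base R))"
        using u eS h(3)[of 0] unfolding 0 e(2) by (simp add: in_Hom)
      then show ?thesis using C_exact_lift[OF x0 dH eS CA] qu that unfolding 0 by blast
    next
      case (Suc m)
      have dS: "SA (pk_q R m \<cdot> pk_f R (Suc m)) \<in> Hom T (SO (pk_P R (Suc m))) (SO (SO (pk_P R m)))"
        using dH[of m] by (simp add: in_Hom)
      have "SA (pk_f R (Suc m)) \<cdot> pk_q R (Suc m) \<cdot> u = Zero T C (SO (pk_X R m))"
        using comp_extend[OF tri_comp3[OF postnikovD(3)[OF R, of "Suc m"]], of u] u(1) h(1,3,6)[of "Suc m"] h(6)[of m]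
        unfolding Suc by (simp add: in_Hom)
      then have "SA (pk_q R m \<cdot> pk_f R (Suc m)) \<cdot> pk_q R (Suc m) \<cdot> u = Zero T C (SO (SO (pk_P R m)))"
        using u(1) h(1,3)[of "Suc m"] h(3,6)[of m] C_Ob[OF C] unfolding Suc by (simp add: in_Hom)
      then show ?thesis using C_exact_lift[OF xS dH dS CA] qu that unfolding Suc by blast
    qed
    \<comment> \<open>The difference \<open>v\<close> comes from \<open>X\<^bsub>n-1\<^esub>\<close>, and it turns out to be zero.\<close>
    define v where "v = u \<ominus> (pk_f R (Suc n) \<cdot> x)"
    have fx: "pk_f R (Suc n) \<cdot> x \<in> Hom T C (pk_X R n)" using f x(1) by (simp add: in_Hom)
    have v: "v \<in> Hom T C (pk_X R n)" unfolding v_def using u fx by (simp add: in_Hom)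
    have "pk_q R n \<cdot> pk_f R (Suc n) \<cdot> x = pk_q R n \<cdot> u" using x f h(3)[of n] by (simp add: in_Hom)
    then have "pk_q R n \<cdot> v = Zero T C (SO (pk_P R n))" unfolding v_def using u fx qu h(3)[of n] by (simp add: in_Hom)
    then obtain y where y: "y \<in> Hom T C (prevX T R n)" "pk_i R n \<cdot> y = v"
      using tri_lift2[OF postnikovD(3)[OF R] v] by blast
    have "pk_i R (Suc n) \<cdot> pk_f R (Suc n) \<cdot> x = Zero T C (pk_X R (Suc n))"
      using comp_extend[OF tri_comp1[OF postnikovD(3)[OF R, of "Suc n"]], of x] x(1) f h(2,6)[of "Suc n"] by (simp add: in_Hom)
    then have "pk_p R (Suc n) \<cdot> pk_i R (Suc n) \<cdot> pk_f R (Suc n) \<cdot> x = Zero T C (SO (pk_base R))"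
      using h(7)[of "Suc n"] C_Ob[OF C] by (simp add: in_Hom)
    then have "pk_p R n \<cdot> pk_f R (Suc n) \<cdot> x = Zero T C (SO (pk_base R))"
      using comp_extend[OF postnikovD(5)[OF R, of n], of "pk_f R (Suc n) \<cdot> x"] fx h(2,7)[of "Suc n"] by (simp add: in_Hom)
    then have "pk_p R n \<cdot> v = Zero T C (SO (pk_base R))"
      unfolding v_def using u fx h(7)[of n] h(8) C_Ob[OF C] by (simp add: in_Hom)
    then have "(pk_p R n \<cdot> pk_i R n) \<cdot> y = Zero T C (SO (pk_base R))"
      using y h(2,7)[of n] by (simp add: in_Hom)
    then obtain z where z: "z \<in> Hom T C (pk_P R n)" "pk_f R n \<cdot> z = y"
      using C_exact_lift[OF Suc.IH h(1) pi_Hom[OF R] CA y(1)] by blast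
    have "pk_i R n \<cdot> pk_f R n \<cdot> z = Zero T C (pk_X R n)"
      using comp_extend[OF tri_comp1[OF postnikovD(3)[OF R, of n]], of z] z(1) h(1,2,6)[of n] by (simp add: in_Hom)
    then have "v = Zero T C (pk_X R n)" using y z by simp
    then have "u = pk_f R (Suc n) \<cdot> x" unfolding v_def using sub_eq_Zero_iff[OF u(1) fx] by simp
    then show "\<exists>x \<in> Hom T C (pk_P R (Suc n)). pk_f R (Suc n) \<cdot> x = u" using x(1) by blast
  qed
qed

text \<open>
  The length of the source is matched by the length of the tower through which one lifts. A lift
  \<open>\<rho>\<close> of the restriction to \<open>\<Sigma> X\<^bsub>k-1\<^esub>\<close> extends over \<open>\<Sigma> X\<^sub>k\<close> after one more step in the target, since the obstruction, a map
  out of \<open>\<Sigma> P\<^sub>k\<close>, passes through the next cell. The extension has the right restriction, and the remaining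
  error is a map out of \<open>\<Sigma>\<^sup>2 P\<^sub>k\<close>, which lifts because the source is projective.
\<close>

lemma lift_from_suspended_X:
  assumes R: "resolution R" and R': "resolution R'"
    and s: "s \<in> Hom T (SO (prevX T R k)) (SO (pk_base R'))"
  shows "\<exists>\<rho> \<in> Hom T (SO (prevX T R k)) (prevX T R' k). (pk_p R' k \<cdot> pk_i R' k) \<cdot> \<rho> = s"
  using s
proof (induction k arbitrary: s)
  case 0
  have z: "is_zero_ob T (SO (zero_ob T))" using SO_zero zero_ob_is_zero by blast
  let ?\<rho> = "Zero T (SO (zero_ob T)) (zero_ob T)"
  have "(pk_p R' 0 \<cdot> pk_i R' 0) \<cdot> ?\<rho> \<in> Hom T (SO (zero_ob T)) (SO (pk_base R'))"
    using pi_Hom[OF R', of 0] postnikov_Hom(8)[OF R'] by (simp add: in_Hom)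
  then have "(pk_p R' 0 \<cdot> pk_i R' 0) \<cdot> ?\<rho> = s" using zero_ob_unique(1)[OF z] 0 by simp
  then show ?case by (intro bexI[of _ ?\<rho>]) (simp_all add: in_Hom)
next
  case (Suc k)
  note h = postnikov_Hom(1-7)[OF R, of k] and h' = postnikov_Hom(1-7)[OF R', of k]
  note t = postnikovD(3)[OF R, of k]
  have s: "s \<in> Hom T (SO (pk_X R k)) (SO (pk_base R'))" using Suc.prems by simp
  have "s \<cdot> SA (pk_i R k) \<in> Hom T (SO (prevX T R k)) (SO (pk_base R'))" using s h by (simp add: in_Hom)
  from Suc.IH[OF this] obtain \<rho> where \<rho>: "\<rho> \<in> Hom T (SO (prevX T R k)) (prevX T R' k)"
    "(pk_p R' k \<cdot> pk_i R' k) \<cdot> \<rho> = s \<cdot> SA (pk_i R k)" by blast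
  have SP: "SO (pk_P R k) \<in> AddC" using Add_susp[OF postnikovD(2)[OF R]] .
  have \<rho>f: "\<rho> \<cdot> SA (pk_f R k) \<in> Hom T (SO (pk_P R k)) (prevX T R' k)" using \<rho> h by (simp add: in_Hom)
  have if0: "SA (pk_i R k) \<cdot> SA (pk_f R k) = Zero T (SO (pk_P R k)) (SO (pk_X R k))"
    using SA_comp_eq[OF tri_comp1[OF t]] h by (simp add: in_Hom)
  have "(pk_p R' k \<cdot> pk_i R' k) \<cdot> \<rho> \<cdot> SA (pk_f R k) = (s \<cdot> SA (pk_i R k)) \<cdot> SA (pk_f R k)"
    by (rule comp_extend[OF \<rho>(2)]) (use \<rho>(1) pi_Hom[OF R', of k] h in \<open>simp_all add: in_Hom\<close>)
  also have "\<dots> = Zero T (SO (pk_P R k)) (SO (pk_base R'))" using if0 s h by (simp add: in_Hom)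
  finally obtain z where z: "z \<in> Hom T (SO (pk_P R k)) (pk_P R' k)" "pk_f R' k \<cdot> z = \<rho> \<cdot> SA (pk_f R k)"
    using C_exact_lift[OF exact_at_X[OF R'] h'(1) pi_Hom[OF R'] SP \<rho>f] by blast
  have "pk_i R' k \<cdot> pk_f R' k \<cdot> z = Zero T (SO (pk_P R k)) (pk_X R' k)"
    using comp_extend[OF tri_comp1[OF postnikovD(3)[OF R', of k]], of z] z(1) h' by (simp add: in_Hom)
  then have "(pk_i R' k \<cdot> \<rho>) \<cdot> SA (pk_f R k) = Zero T (SO (pk_P R k)) (pk_X R' k)"
    using z(2) \<rho>(1) h h' by (simp add: in_Hom)
  moreover have i\<rho>: "pk_i R' k \<cdot> \<rho> \<in> Hom T (SO (prevX T R k)) (pk_X R' k)" using \<rho>(1) h' by (simp add: in_Hom)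
  ultimately obtain \<rho>1 where \<rho>1: "\<rho>1 \<in> Hom T (SO (pk_X R k)) (pk_X R' k)" "\<rho>1 \<cdot> SA (pk_i R k) = pk_i R' k \<cdot> \<rho>"
    using tri_susp_colift1[OF t] by blast
  define \<delta> where "\<delta> = s \<ominus> (pk_p R' k \<cdot> \<rho>1)"
  have p\<rho>1: "pk_p R' k \<cdot> \<rho>1 \<in> Hom T (SO (pk_X R k)) (SO (pk_base R'))" using \<rho>1(1) h' by (simp add: in_Hom)
  have \<delta>: "\<delta> \<in> Hom T (SO (pk_X R k)) (SO (pk_base R'))" unfolding \<delta>_def using s p\<rho>1 by (simp add: in_Hom)
  have "(pk_p R' k \<cdot> \<rho>1) \<cdot> SA (pk_i R k) = s \<cdot> SA (pk_i R k)" using \<rho>1 \<rho> h h' by (simp add: in_Hom)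
  then have "\<delta> \<cdot> SA (pk_i R k) = Zero T (SO (prevX T R k)) (SO (pk_base R'))"
    unfolding \<delta>_def using s p\<rho>1 h by (simp add: in_Hom)
  then obtain \<tau> where \<tau>: "\<tau> \<in> Hom T (SO (SO (pk_P R k))) (SO (pk_base R'))" "\<tau> \<cdot> SA (pk_q R k) = \<delta>"
    using tri_susp_colift2[OF t \<delta>] by blast
  obtain \<tau>' where \<tau>': "\<tau>' \<in> Hom T (SO (SO (pk_P R k))) (pk_X R' k)" "pk_p R' k \<cdot> \<tau>' = \<tau>"
    using lift_through_p[OF R' Add_susp[OF SP] \<tau>(1)] by blast
  define \<sigma> where "\<sigma> = \<tau>' \<cdot> SA (pk_q R k) \<oplus> \<rho>1"
  have \<tau>q: "\<tau>' \<cdot> SA (pk_q R k) \<in> Hom T (SO (pk_X R k)) (pk_X R' k)" using \<tau>'(1) h by (simp add: in_Hom)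
  have \<sigma>: "\<sigma> \<in> Hom T (SO (pk_X R k)) (pk_X R' k)" unfolding \<sigma>_def using \<tau>q \<rho>1(1) by (simp add: in_Hom)
  have "pk_p R' k \<cdot> \<tau>' \<cdot> SA (pk_q R k) = \<delta>" using comp_extend[OF \<tau>'(2), of "SA (pk_q R k)"] \<tau>' \<tau>(2) h h' by (simp add: in_Hom)
  then have "pk_p R' k \<cdot> \<sigma> = \<delta> \<oplus> (pk_p R' k \<cdot> \<rho>1)" unfolding \<sigma>_def using \<tau>q \<rho>1(1) h' by (simp add: in_Hom)
  also have "\<dots> = s" unfolding \<delta>_def using sub_Add_cancel[OF s p\<rho>1] .
  finally have "pk_p R' k \<cdot> \<sigma> = s" .
  then show ?case using \<sigma> postnikovD(5)[OF R', of k] by (intro bexI[of _ \<sigma>]) simp_all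
qed

end

section \<open>Lifting morphisms, null-homotopies and infinite phantoms\<close>

lemma prevpsi_simps [simp]: "prevpsi T m 0 = Zero T (zero_ob T) (zero_ob T)" "prevpsi T m (Suc n) = pm_psi m n"
  by (simp_all add: prevpsi_def)

context resolution_setting
begin

text \<open>
  The argument \<open>\<psi>p\<close> is the map \<open>\<psi>\<^bsub>n-1\<^esub>\<close> constructed before; its compatibility with \<open>p\<^bsub>n-1\<^esub>\<close> is
  what is needed to find \<open>\<phi>\<close>. The map \<open>\<psi>\<close> given by the triangulated structure may fail to commute
  with \<open>p\<^sub>n\<close>. The failure \<open>\<delta>\<close> vanishes on \<open>X\<^bsub>n-1\<^esub>\<close>, hence factors through \<open>\<Sigma> P\<^sub>n\<close>, where it lifts to \<open>\<theta>\<close> and can be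
  subtracted from \<open>\<psi>\<close>; subtracting the corresponding \<open>\<rho>\<close> from \<open>\<phi>\<close> restores the other relations.
\<close>

lemma lift_step:
  assumes R: "resolution R" and R': "resolution R'"
    and h: "h \<in> Hom T (pk_base R) (pk_base R')"
    and \<psi>p: "\<psi>p \<in> Hom T (prevX T R n) (prevX T R' n)"
    and cp: "(pk_p R' n \<cdot> pk_i R' n) \<cdot> \<psi>p = SA h \<cdot> pk_p R n \<cdot> pk_i R n"
  shows "\<exists>\<psi> \<phi>. \<psi> \<in> Hom T (pk_X R n) (pk_X R' n) \<and> \<phi> \<in> Hom T (pk_P R n) (pk_P R' n) \<and>
    \<psi>p \<cdot> pk_f R n = pk_f R' n \<cdot> \<phi> \<and> \<psi> \<cdot> pk_i R n = pk_i R' n \<cdot> \<psi>p \<and>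
    SA \<phi> \<cdot> pk_q R n = pk_q R' n \<cdot> \<psi> \<and> SA h \<cdot> pk_p R n = pk_p R' n \<cdot> \<psi>"
proof -
  note a = postnikov_Hom(1-7)[OF R, of n] and a' = postnikov_Hom(1-7)[OF R', of n]
  note t = postnikovD(3)[OF R, of n] and t' = postnikovD(3)[OF R', of n]
  have PA: "pk_P R n \<in> AddC" using postnikovD(2)[OF R] .
  have hS: "SA h \<in> Hom T (SO (pk_base R)) (SO (pk_base R'))" using h by (simp add: in_Hom)
  have \<psi>f: "\<psi>p \<cdot> pk_f R n \<in> Hom T (pk_P R n) (prevX T R' n)" using \<psi>p a by (simp add: in_Hom)
  have bO: "pk_base R' \<in> Ob T" using postnikovD(1)[OF R'] .
  have if0: "pk_i R n \<cdot> pk_f R n = Zero T (pk_P R n) (pk_X R n)" using tri_comp1[OF t] .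
  have "(pk_p R' n \<cdot> pk_i R' n) \<cdot> \<psi>p \<cdot> pk_f R n = (SA h \<cdot> pk_p R n \<cdot> pk_i R n) \<cdot> pk_f R n"
    by (rule comp_extend[OF cp]) (use \<psi>p a a' in \<open>simp_all add: in_Hom\<close>)
  also have "\<dots> = Zero T (pk_P R n) (SO (pk_base R'))" using if0 hS a by (simp add: in_Hom)
  finally obtain \<phi> where \<phi>: "\<phi> \<in> Hom T (pk_P R n) (pk_P R' n)" "pk_f R' n \<cdot> \<phi> = \<psi>p \<cdot> pk_f R n"
    using C_exact_lift[OF exact_at_X[OF R'] a'(1) pi_Hom[OF R'] PA \<psi>f] by blast
  obtain \<psi> where \<psi>: "\<psi> \<in> Hom T (pk_X R n) (pk_X R' n)" "\<psi> \<cdot> pk_i R n = pk_i R' n \<cdot> \<psi>p"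
    "SA \<phi> \<cdot> pk_q R n = pk_q R' n \<cdot> \<psi>"
    using triangle_morphism[OF t t' \<phi>(1) \<psi>p \<phi>(2)[symmetric]] by blast
  have p\<psi>: "pk_p R' n \<cdot> \<psi> \<in> Hom T (pk_X R n) (SO (pk_base R'))" using \<psi>(1) a' by (simp add: in_Hom)
  have hp: "SA h \<cdot> pk_p R n \<in> Hom T (pk_X R n) (SO (pk_base R'))" using hS a by (simp add: in_Hom)
  define \<delta> where "\<delta> = (pk_p R' n \<cdot> \<psi>) \<ominus> (SA h \<cdot> pk_p R n)"
  have \<delta>: "\<delta> \<in> Hom T (pk_X R n) (SO (pk_base R'))" unfolding \<delta>_def using p\<psi> hp by (simp add: in_Hom)
  have "(pk_p R' n \<cdot> \<psi>) \<cdot> pk_i R n = (SA h \<cdot> pk_p R n) \<cdot> pk_i R n"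
    using cp \<psi> \<psi>p hS a a' by (simp add: in_Hom)
  then have "\<delta> \<cdot> pk_i R n = Zero T (prevX T R n) (SO (pk_base R'))"
    unfolding \<delta>_def using p\<psi> hp hS a(2) by (simp add: in_Hom del: assoc)
  then obtain \<delta>' where \<delta>': "\<delta>' \<in> Hom T (SO (pk_P R n)) (SO (pk_base R'))" "\<delta>' \<cdot> pk_q R n = \<delta>"
    using tri_colift2[OF t \<delta>] by blast
  obtain \<theta> where \<theta>: "\<theta> \<in> Hom T (SO (pk_P R n)) (pk_X R' n)" "pk_p R' n \<cdot> \<theta> = \<delta>'"
    using lift_through_p[OF R' Add_susp[OF PA] \<delta>'(1)] by blast
  have "pk_q R' n \<cdot> \<theta> \<in> Hom T (SO (pk_P R n)) (SO (pk_P R' n))" using \<theta>(1) a' by (simp add: in_Hom)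
  then obtain \<rho> where \<rho>: "\<rho> \<in> Hom T (pk_P R n) (pk_P R' n)" "SA \<rho> = pk_q R' n \<cdot> \<theta>" using SA_full a(4) a'(4) by metis
  have \<theta>q: "\<theta> \<cdot> pk_q R n \<in> Hom T (pk_X R n) (pk_X R' n)" using \<theta>(1) a by (simp add: in_Hom)
  have f\<rho>: "pk_f R' n \<cdot> \<rho> = Zero T (pk_P R n) (prevX T R' n)"
  proof (rule SA_faithful[of _ "pk_P R n" "prevX T R' n"])
    have "SA (pk_f R' n \<cdot> \<rho>) = SA (pk_f R' n) \<cdot> SA \<rho>" using \<rho>(1) a' by (simp add: in_Hom)
    also have "\<dots> = Zero T (SO (pk_P R n)) (SO (prevX T R' n))"
      unfolding \<rho>(2) using comp_extend[OF tri_comp3[OF t'], of \<theta>] \<theta>(1) a' by (simp add: in_Hom)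
    finally show "SA (pk_f R' n \<cdot> \<rho>) = SA (Zero T (pk_P R n) (prevX T R' n))" using a a' by simp
  qed (use \<rho>(1) a a' in \<open>simp_all add: in_Hom\<close>)
  define \<psi>1 where "\<psi>1 = \<psi> \<ominus> (\<theta> \<cdot> pk_q R n)"
  define \<phi>1 where "\<phi>1 = \<phi> \<ominus> \<rho>"
  have \<psi>1: "\<psi>1 \<in> Hom T (pk_X R n) (pk_X R' n)" unfolding \<psi>1_def using \<psi>(1) \<theta>q by (simp add: in_Hom)
  have \<phi>1: "\<phi>1 \<in> Hom T (pk_P R n) (pk_P R' n)" unfolding \<phi>1_def using \<phi>(1) \<rho>(1) by (simp add: in_Hom)
  have 1: "\<psi>p \<cdot> pk_f R n = pk_f R' n \<cdot> \<phi>1"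
  proof -
    have "pk_f R' n \<cdot> \<phi>1 = (pk_f R' n \<cdot> \<phi>) \<ominus> (pk_f R' n \<cdot> \<rho>)"
      unfolding \<phi>1_def using \<phi>(1) \<rho>(1) a' by (simp add: in_Hom)
    also have "\<dots> = \<psi>p \<cdot> pk_f R n" unfolding \<phi>(2) f\<rho> using \<psi>f a a' by (simp add: in_Hom)
    finally show ?thesis by simp
  qed
  have 2: "\<psi>1 \<cdot> pk_i R n = pk_i R' n \<cdot> \<psi>p"
  proof -
    have "\<theta> \<cdot> pk_q R n \<cdot> pk_i R n = Zero T (prevX T R n) (pk_X R' n)"
      using tri_comp2[OF t] \<theta>(1) a by (simp add: in_Hom)
    moreover have "\<psi>1 \<cdot> pk_i R n = (\<psi> \<cdot> pk_i R n) \<ominus> (\<theta> \<cdot> pk_q R n \<cdot> pk_i R n)"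
      unfolding \<psi>1_def using \<psi>(1) \<theta>(1) a by (simp add: in_Hom)
    ultimately show ?thesis unfolding \<psi>(2) using \<psi>p a a' by (simp add: in_Hom)
  qed
  have 3: "SA \<phi>1 \<cdot> pk_q R n = pk_q R' n \<cdot> \<psi>1"
  proof -
    have "SA \<phi>1 = SA \<phi> \<ominus> (pk_q R' n \<cdot> \<theta>)" unfolding \<phi>1_def \<rho>(2)[symmetric] using \<phi>(1) \<rho>(1) by (simp add: in_Hom)
    then have "SA \<phi>1 \<cdot> pk_q R n = (SA \<phi> \<cdot> pk_q R n) \<ominus> (pk_q R' n \<cdot> \<theta> \<cdot> pk_q R n)"
      using \<phi>(1) \<theta>(1) a a' by (simp add: in_Hom)
    also have "\<dots> = pk_q R' n \<cdot> \<psi>1" unfolding \<psi>(3) \<psi>1_def using \<psi>(1) \<theta>(1) a a' by (simp add: in_Hom)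
    finally show ?thesis .
  qed
  have 4: "SA h \<cdot> pk_p R n = pk_p R' n \<cdot> \<psi>1"
  proof -
    have "pk_p R' n \<cdot> \<theta> \<cdot> pk_q R n = \<delta>" using comp_extend[OF \<theta>(2), of "pk_q R n"] \<theta>(1) \<delta>'(2) a a' by (simp add: in_Hom)
    then have "pk_p R' n \<cdot> \<psi>1 = (pk_p R' n \<cdot> \<psi>) \<ominus> \<delta>"
      unfolding \<psi>1_def using \<psi>(1) \<theta>q a' by (simp add: in_Hom)
    also have "\<dots> = SA h \<cdot> pk_p R n" unfolding \<delta>_def using sub_left_cancel[OF p\<psi> hp] .
    finally show ?thesis by simp
  qed
  show ?thesis using \<psi>1 \<phi>1 1 2 3 4 by blast
qed

lemma resolution_mapI:
  assumes "resolution (pm_src m)" "resolution (pm_tgt m)"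
    and "pm_h m \<in> Hom T (pk_base (pm_src m)) (pk_base (pm_tgt m))"
    and "\<And>n. pm_psi m n \<in> Hom T (pk_X (pm_src m) n) (pk_X (pm_tgt m) n)"
    and "\<And>n. pm_phi m n \<in> Hom T (pk_P (pm_src m) n) (pk_P (pm_tgt m) n)"
    and "\<And>n. prevpsi T m n \<cdot> pk_f (pm_src m) n = pk_f (pm_tgt m) n \<cdot> pm_phi m n"
    and "\<And>n. pm_psi m n \<cdot> pk_i (pm_src m) n = pk_i (pm_tgt m) n \<cdot> prevpsi T m n"
    and "\<And>n. SA (pm_phi m n) \<cdot> pk_q (pm_src m) n = pk_q (pm_tgt m) n \<cdot> pm_psi m n"
    and "\<And>n. SA (pm_h m) \<cdot> pk_p (pm_src m) n = pk_p (pm_tgt m) n \<cdot> pm_psi m n"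
  shows "resolution_map m"
  unfolding is_postnikov_map_def Let_def using assms by simp

lemma postnikov_mapD:
  assumes "resolution_map m"
  shows "resolution (pm_src m)" "resolution (pm_tgt m)"
    "pm_h m \<in> Hom T (pk_base (pm_src m)) (pk_base (pm_tgt m))"
    "pm_psi m n \<in> Hom T (pk_X (pm_src m) n) (pk_X (pm_tgt m) n)"
    "pm_phi m n \<in> Hom T (pk_P (pm_src m) n) (pk_P (pm_tgt m) n)"
    "prevpsi T m n \<cdot> pk_f (pm_src m) n = pk_f (pm_tgt m) n \<cdot> pm_phi m n"
    "pm_psi m n \<cdot> pk_i (pm_src m) n = pk_i (pm_tgt m) n \<cdot> prevpsi T m n"
    "SA (pm_phi m n) \<cdot> pk_q (pm_src m) n = pk_q (pm_tgt m) n \<cdot> pm_psi m n"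
    "SA (pm_h m) \<cdot> pk_p (pm_src m) n = pk_p (pm_tgt m) n \<cdot> pm_psi m n"
  using assms by (simp_all add: is_postnikov_map_def Let_def)

lemma prevpsi_Hom:
  assumes "resolution_map m"
  shows "prevpsi T m n \<in> Hom T (prevX T (pm_src m) n) (prevX T (pm_tgt m) n)"
  by (cases n) (use postnikov_mapD(4)[OF assms] in \<open>simp_all add: in_Hom\<close>)

text \<open>
  The components are chosen one after the other, starting from the zero map of the zero objects
  in degree \<open>-1\<close>. All that the choice in degree \<open>n + 1\<close> requires of \<open>\<psi>\<^sub>n\<close> is its relation with \<open>p\<^sub>n\<close>.
\<close>

theorem ex_postnikov_map:
  assumes R: "resolution R" and R': "resolution R'"
    and h: "h \<in> Hom T (pk_base R) (pk_base R')"
  shows "\<exists>m. resolution_map m \<and> pm_src m = R \<and> pm_tgt m = R' \<and> pm_h m = h"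
proof -
  define L where "L n \<psi>p \<psi> \<phi> \<longleftrightarrow> \<psi> \<in> Hom T (pk_X R n) (pk_X R' n) \<and> \<phi> \<in> Hom T (pk_P R n) (pk_P R' n) \<and>
    \<psi>p \<cdot> pk_f R n = pk_f R' n \<cdot> \<phi> \<and> \<psi> \<cdot> pk_i R n = pk_i R' n \<cdot> \<psi>p \<and>
    SA \<phi> \<cdot> pk_q R n = pk_q R' n \<cdot> \<psi> \<and> SA h \<cdot> pk_p R n = pk_p R' n \<cdot> \<psi>" for n \<psi>p \<psi> \<phi>
  define G where "G n x \<longleftrightarrow> (\<exists>\<psi>p. L n \<psi>p (fst x) (snd x) \<and> (n = 0 \<longrightarrow> \<psi>p = Zero T (zero_ob T) (zero_ob T)))" for n x
  have "\<exists>x. G 0 x"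
  proof -
    let ?z = "Zero T (zero_ob T) (zero_ob T)"
    have z: "?z \<in> Hom T (prevX T R 0) (prevX T R' 0)" by (simp add: in_Hom)
    have "(pk_p R' 0 \<cdot> pk_i R' 0) \<cdot> ?z \<in> Hom T (zero_ob T) (SO (pk_base R'))"
      using pi_Hom[OF R', of 0] postnikovD(1)[OF R'] by (simp add: in_Hom)
    moreover have "SA h \<cdot> pk_p R 0 \<cdot> pk_i R 0 \<in> Hom T (zero_ob T) (SO (pk_base R'))"
      using pi_Hom[OF R, of 0] h by (simp add: in_Hom)
    ultimately have "(pk_p R' 0 \<cdot> pk_i R' 0) \<cdot> ?z = SA h \<cdot> pk_p R 0 \<cdot> pk_i R 0"
      by (rule zero_ob_unique(1)[OF zero_ob_is_zero])
    then obtain \<psi> \<phi> where "L 0 ?z \<psi> \<phi>" using lift_step[OF R R' h z] unfolding L_def by blast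
    then show ?thesis unfolding G_def by (intro exI[of _ "(\<psi>, \<phi>)"] exI[of _ ?z]) simp
  qed
  moreover have "\<exists>y. G (Suc n) y \<and> L (Suc n) (fst x) (fst y) (snd y)" if "G n x" for x n
  proof -
    have x: "fst x \<in> Hom T (pk_X R n) (pk_X R' n)" "SA h \<cdot> pk_p R n = pk_p R' n \<cdot> fst x"
      using that unfolding G_def L_def by blast+
    have "fst x \<in> Hom T (prevX T R (Suc n)) (prevX T R' (Suc n))" using x(1) by simp
    moreover have "(pk_p R' (Suc n) \<cdot> pk_i R' (Suc n)) \<cdot> fst x = SA h \<cdot> pk_p R (Suc n) \<cdot> pk_i R (Suc n)"
      unfolding postnikovD(5)[OF R'] postnikovD(5)[OF R] using x(2) by simp
    ultimately obtain \<psi> \<phi> where "L (Suc n) (fst x) \<psi> \<phi>" using lift_step[OF R R' h] unfolding L_def by blast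
    then show ?thesis unfolding G_def by (intro exI[of _ "(\<psi>, \<phi>)"]) auto
  qed
  ultimately obtain F where F: "\<And>n. G n (F n)" "\<And>n. L (Suc n) (fst (F n)) (fst (F (Suc n))) (snd (F (Suc n)))"
    using dependent_nat_choice[of G "\<lambda>n x y. L (Suc n) (fst x) (fst y) (snd y)"] by blast
  define m where "m = \<lparr>pm_src = R, pm_tgt = R', pm_h = h, pm_psi = \<lambda>n. fst (F n), pm_phi = \<lambda>n. snd (F n)\<rparr>"
  have m_simps: "pm_src m = R" "pm_tgt m = R'" "pm_h m = h" "pm_psi m n = fst (F n)" "pm_phi m n = snd (F n)" for n
    by (simp_all add: m_def)
  have L: "L n (prevpsi T m n) (fst (F n)) (snd (F n))" for n
    using F(1)[of 0] F(2) unfolding G_def by (cases n) (auto simp: m_simps)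
  have "resolution_map m"
    by (rule resolution_mapI; unfold m_simps; use R R' h L in \<open>(unfold L_def)?, blast?\<close>)
  then show ?thesis by (intro exI[of _ m]) (simp add: m_def)
qed

text \<open>
  By induction \<open>\<psi>\<^sub>n\<close> vanishes on \<open>X\<^bsub>n-1\<^esub>\<close>, so it is \<open>r \<cdot> q\<^sub>n\<close> for some \<open>r\<close> on \<open>\<Sigma> P\<^sub>n\<close>. If \<open>p\<^sub>n \<cdot> r\<close> were
  zero, \<open>r\<close> would pass through the next cell and vanish in the next stage. It is only known that \<open>p\<^sub>n \<cdot> r \<cdot> q\<^sub>n = 0\<close>,
  so \<open>p\<^sub>n \<cdot> r = s \<cdot> \<Sigma> f\<^sub>n\<close>. The map \<open>s\<close>, defined on \<open>\<Sigma> X\<^bsub>n-1\<^esub>\<close>, lifts through the target tower, and this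
  allows \<open>r\<close> to be corrected without changing \<open>r \<cdot> q\<^sub>n\<close>.
\<close>

lemma null_homotopic:
  assumes m: "resolution_map m"
    and null: "\<And>n. SA (pm_h m) \<cdot> pk_p (pm_src m) n = Zero T (pk_X (pm_src m) n) (SO (pk_base (pm_tgt m)))"
  shows "pk_i (pm_tgt m) n \<cdot> prevpsi T m n = Zero T (prevX T (pm_src m) n) (pk_X (pm_tgt m) n)"
proof (induction n)
  case 0
  have "Zero T (zero_ob T) (zero_ob T) \<in> Hom T (zero_ob T) (zero_ob T)" by (simp add: in_Hom)
  then show ?case using postnikov_Hom(2,6)[OF postnikov_mapD(2)[OF m], of 0] by (simp add: in_Hom)
next
  case (Suc n)
  define R where "R = pm_src m"
  define R' where "R' = pm_tgt m"
  have R: "resolution R" and R': "resolution R'"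
    using postnikov_mapD(1,2)[OF m] unfolding R_def R'_def by auto
  note a = postnikov_Hom(1-7)[OF R, of n] and a' = postnikov_Hom(1-7)[OF R', of n] and aS = postnikov_Hom(1-7)[OF R', of "Suc n"]
  note t = postnikovD(3)[OF R, of n] and bO = postnikovD(1)[OF R']
  let ?\<psi> = "pm_psi m n"
  have \<psi>: "?\<psi> \<in> Hom T (pk_X R n) (pk_X R' n)" using postnikov_mapD(4)[OF m] unfolding R_def R'_def .
  have "?\<psi> \<cdot> pk_i R n = Zero T (prevX T R n) (pk_X R' n)"
    using Suc.IH postnikov_mapD(7)[OF m, of n] unfolding R_def R'_def by simp
  then obtain r where r: "r \<in> Hom T (SO (pk_P R n)) (pk_X R' n)" "r \<cdot> pk_q R n = ?\<psi>" using tri_colift2[OF t \<psi>] by blast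
  have p\<psi>: "pk_p R' n \<cdot> ?\<psi> = Zero T (pk_X R n) (SO (pk_base R'))"
    using null[of n] postnikov_mapD(9)[OF m, of n] unfolding R_def R'_def by simp
  have pr: "pk_p R' n \<cdot> r \<in> Hom T (SO (pk_P R n)) (SO (pk_base R'))" using r(1) a' by (simp add: in_Hom)
  have "(pk_p R' n \<cdot> r) \<cdot> pk_q R n = Zero T (pk_X R n) (SO (pk_base R'))" using p\<psi> r a a' by (simp add: in_Hom)
  then obtain s where s: "s \<in> Hom T (SO (prevX T R n)) (SO (pk_base R'))" "s \<cdot> SA (pk_f R n) = pk_p R' n \<cdot> r"
    using tri_colift3[OF t pr] by blast
  obtain \<rho> where \<rho>: "\<rho> \<in> Hom T (SO (prevX T R n)) (prevX T R' n)" "(pk_p R' n \<cdot> pk_i R' n) \<cdot> \<rho> = s"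
    using lift_from_suspended_X[OF R R' s(1)] by blast
  \<comment> \<open>The correction term: it vanishes after precomposition with \<open>q\<^sub>n\<close> and has the same image under \<open>p\<^sub>n\<close> as \<open>r\<close>.\<close>
  define w where "w = pk_i R' n \<cdot> \<rho> \<cdot> SA (pk_f R n)"
  have w: "w \<in> Hom T (SO (pk_P R n)) (pk_X R' n)" unfolding w_def using \<rho>(1) a a' by (simp add: in_Hom)
  define r' where "r' = r \<ominus> w"
  have r': "r' \<in> Hom T (SO (pk_P R n)) (pk_X R' n)" unfolding r'_def using r(1) w by (simp add: in_Hom)
  have "w \<cdot> pk_q R n = Zero T (pk_X R n) (pk_X R' n)"
    unfolding w_def using tri_comp3[OF t] \<rho>(1) a a' by (simp add: in_Hom)
  then have r'q: "r' \<cdot> pk_q R n = ?\<psi>" unfolding r'_def using r w a \<psi> a' by (simp add: in_Hom)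
  have "pk_p R' n \<cdot> w = s \<cdot> SA (pk_f R n)"
    unfolding w_def \<rho>(2)[symmetric] using \<rho>(1) a a' by (simp add: in_Hom)
  then have "pk_p R' n \<cdot> r' = Zero T (SO (pk_P R n)) (SO (pk_base R'))"
    unfolding r'_def using r(1) w s(2) pr a' bO a by (simp add: in_Hom)
  then have "(pk_p R' (Suc n) \<cdot> pk_i R' (Suc n)) \<cdot> r' = Zero T (SO (pk_P R n)) (SO (pk_base R'))"
    using postnikovD(5)[OF R', of n] by simp
  moreover have "r' \<in> Hom T (SO (pk_P R n)) (prevX T R' (Suc n))" using r' by simp
  ultimately obtain z where z: "z \<in> Hom T (SO (pk_P R n)) (pk_P R' (Suc n))" "pk_f R' (Suc n) \<cdot> z = r'"
    using C_exact_lift[OF exact_at_X[OF R'] aS(1) pi_Hom[OF R'] Add_susp[OF postnikovD(2)[OF R]]] by blast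
  have "pk_i R' (Suc n) \<cdot> r' = Zero T (SO (pk_P R n)) (pk_X R' (Suc n))"
    unfolding z(2)[symmetric] using comp_extend[OF tri_comp1[OF postnikovD(3)[OF R', of "Suc n"]], of z] z(1) aS by (simp add: in_Hom)
  then have "(pk_i R' (Suc n) \<cdot> r') \<cdot> pk_q R n = Zero T (pk_X R n) (pk_X R' (Suc n))" using a aS by (simp add: in_Hom)
  then have "pk_i R' (Suc n) \<cdot> ?\<psi> = Zero T (pk_X R n) (pk_X R' (Suc n))" using r' r'q a aS by (simp add: in_Hom)
  then show ?case unfolding R_def R'_def by simp
qed

text \<open>
  One direction is \<open>null_homotopic\<close>. For the other one, \<open>\<Sigma> h \<cdot> p\<^sub>n = p\<^bsub>n+1\<^esub> \<cdot> \<psi>\<^bsub>n+1\<^esub> \<cdot> i\<^bsub>n+1\<^esub>\<close>.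
\<close>

lemma null_homotopic_iff:
  assumes m: "resolution_map m"
  shows "(\<forall>n>0. pm_psi m n \<cdot> pk_i (pm_src m) n = Zero T (prevX T (pm_src m) n) (pk_X (pm_tgt m) n)) \<longleftrightarrow>
    (\<forall>n. SA (pm_h m) \<cdot> pk_p (pm_src m) n = Zero T (pk_X (pm_src m) n) (SO (pk_base (pm_tgt m))))"
proof
  note R = postnikov_mapD(1)[OF m] and R' = postnikov_mapD(2)[OF m]
  assume z: "\<forall>n>0. pm_psi m n \<cdot> pk_i (pm_src m) n = Zero T (prevX T (pm_src m) n) (pk_X (pm_tgt m) n)"
  show "\<forall>n. SA (pm_h m) \<cdot> pk_p (pm_src m) n = Zero T (pk_X (pm_src m) n) (SO (pk_base (pm_tgt m)))"
  proof
    fix n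
    note a = postnikov_Hom(1-7)[OF R, of "Suc n"] and a' = postnikov_Hom(1-7)[OF R', of "Suc n"]
    have hS: "SA (pm_h m) \<in> Hom T (SO (pk_base (pm_src m))) (SO (pk_base (pm_tgt m)))"
      using postnikov_mapD(3)[OF m] by (simp add: in_Hom)
    have "SA (pm_h m) \<cdot> pk_p (pm_src m) n = SA (pm_h m) \<cdot> pk_p (pm_src m) (Suc n) \<cdot> pk_i (pm_src m) (Suc n)"
      unfolding postnikovD(5)[OF R] ..
    also have "\<dots> = (pk_p (pm_tgt m) (Suc n) \<cdot> pm_psi m (Suc n)) \<cdot> pk_i (pm_src m) (Suc n)"
      unfolding postnikov_mapD(9)[OF m, symmetric] using hS a by (simp add: in_Hom)
    also have "\<dots> = Zero T (pk_X (pm_src m) n) (SO (pk_base (pm_tgt m)))"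
      using z a a' postnikov_mapD(4)[OF m, of "Suc n"] by (simp add: in_Hom)
    finally show "SA (pm_h m) \<cdot> pk_p (pm_src m) n = Zero T (pk_X (pm_src m) n) (SO (pk_base (pm_tgt m)))" .
  qed
next
  assume "\<forall>n. SA (pm_h m) \<cdot> pk_p (pm_src m) n = Zero T (pk_X (pm_src m) n) (SO (pk_base (pm_tgt m)))"
  then show "\<forall>n>0. pm_psi m n \<cdot> pk_i (pm_src m) n = Zero T (prevX T (pm_src m) n) (pk_X (pm_tgt m) n)"
    using null_homotopic[OF m] postnikov_mapD(7)[OF m] by simp
qed

lemma n_phantom_Arr: "n_phantom T \<C> n f \<Longrightarrow> f \<in> Arr T"
  by (induction rule: n_phantom.induct) (auto simp: phantom_iff)

lemma phantom_post:
  assumes f: "C_phantom f" and k: "k \<in> Arr T" "Dom T k = Cod T f"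
  shows "C_phantom (k \<cdot> f)"
  unfolding phantom_iff
proof (intro conjI ballI)
  have fA: "f \<in> Arr T" using f unfolding phantom_iff by simp
  then show "k \<cdot> f \<in> Arr T" using k by simp
  fix C x assume C: "C \<in> \<C>" and "x \<in> Hom T C (Dom T (k \<cdot> f))"
  then have x: "x \<in> Hom T C (Dom T f)" using fA k by simp
  then have "f \<cdot> x = Zero T C (Cod T f)" using f C unfolding phantom_iff by blast
  then show "(k \<cdot> f) \<cdot> x = Zero T C (Cod T (k \<cdot> f))" using x fA k C_Ob[OF C] by (simp add: in_Hom)
qed

lemma n_phantom_post:
  assumes "n_phantom T \<C> n f" and k: "k \<in> Arr T" "Dom T k = Cod T f"
  shows "n_phantom T \<C> n (k \<cdot> f)"
  using assms(1)
proof cases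
  case one
  then show ?thesis using n_phantom.one[OF phantom_post[OF one(2) k]] by simp
next
  case (step j f' g)
  have A: "f' \<in> Arr T" "g \<in> Arr T" using n_phantom_Arr[OF step(3)] step(4) unfolding phantom_iff by auto
  have kg: "Dom T k = Cod T g" using k step A by simp
  have "n_phantom T \<C> (Suc j) ((k \<cdot> g) \<cdot> f')"
    by (rule n_phantom.step[OF step(3) phantom_post[OF step(4) k(1) kg]]) (use k(1) kg A step(5) in simp)
  then show ?thesis using step A k(1) kg by simp
qed

text \<open>
  If \<open>\<Sigma> f \<cdot> p\<^bsub>n-1\<^esub> = 0\<close>, then \<open>\<Sigma> f \<cdot> p\<^sub>n\<close> factors through \<open>\<Sigma> P\<^sub>n\<close>, and the next phantom map kills
  everything that comes from there.
\<close>

lemma n_phantom_kills_p: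
  assumes "n_phantom T \<C> n f" and R: "resolution R" and "Dom T f = pk_base R"
  shows "SA f \<cdot> pk_p R (n - 1) = Zero T (pk_X R (n - 1)) (SO (Cod T f))"
  using assms(1,3)
proof (induction rule: n_phantom.induct)
  case (one f)
  have fA: "f \<in> Arr T" using one unfolding phantom_iff by simp
  obtain e r where e: "e \<in> Hom T (pk_P R 0) (pk_base R)" "pk_p R 0 = SA e \<cdot> pk_q R 0"
    by (rule postnikov_augmentation[OF R])
  have "f \<cdot> e = Zero T (pk_P R 0) (Cod T f)" using phantom_Add[OF one(1) postnikovD(2)[OF R]] e(1) one(2) by simp
  then have "SA f \<cdot> SA e = Zero T (SO (pk_P R 0)) (SO (Cod T f))"
    using SA_comp_eq[of f e] e(1) fA one(2) Hom_Ob[OF e(1)] by (simp add: in_Hom)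
  then have "SA f \<cdot> SA e \<cdot> pk_q R 0 = Zero T (pk_X R 0) (SO (Cod T f))"
    using comp_extend[of "SA f" "SA e" _ "pk_q R 0"] e(1) fA one(2) postnikov_Hom(3)[OF R, of 0] by (simp add: in_Hom)
  then show ?case using e(2) by simp
next
  case (step n f g)
  have A: "f \<in> Arr T" "g \<in> Arr T" using n_phantom_Arr[OF step(1)] step(2) unfolding phantom_iff by auto
  have fd: "Dom T f = pk_base R" using step A by simp
  have "n \<noteq> 0" using step(1) by cases auto
  then obtain k where k: "n = Suc k" by (cases n) auto
  note t = postnikovD(3)[OF R, of n] and a = postnikov_Hom(1-7)[OF R, of n]
  have Sfp: "SA f \<cdot> pk_p R n \<in> Hom T (pk_X R n) (SO (Cod T f))" using A fd a by (simp add: in_Hom)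
  have "(SA f \<cdot> pk_p R n) \<cdot> pk_i R n = SA f \<cdot> pk_p R k"
    unfolding postnikovD(5)[OF R, of k, symmetric] k using A fd a k by (simp add: in_Hom)
  also have "\<dots> = Zero T (prevX T R n) (SO (Cod T f))" using step.IH[OF fd] k by simp
  finally obtain r where r: "r \<in> Hom T (SO (pk_P R n)) (SO (Cod T f))" "r \<cdot> pk_q R n = SA f \<cdot> pk_p R n"
    using tri_colift2[OF t Sfp] by blast
  have "SA g \<cdot> r = Zero T (SO (pk_P R n)) (Cod T (SA g))"
    by (rule phantom_Add[OF phantom_susp[OF step(2)] Add_susp[OF postnikovD(2)[OF R]]]) (use r(1) A step(3) in simp)
  then have "(SA g \<cdot> r) \<cdot> pk_q R n = Zero T (pk_X R n) (SO (Cod T g))" using a A by (simp add: in_Hom)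
  then have "SA g \<cdot> SA f \<cdot> pk_p R n = Zero T (pk_X R n) (SO (Cod T g))" using r A a step(3) by (simp add: in_Hom)
  then show ?case using A step(3) fd a by (simp add: in_Hom)
qed

text \<open>
  Maps into \<open>\<Sigma> X\<close> lift through \<open>p\<^sub>n\<close>, and \<open>\<Sigma> w \<cdot> p\<^sub>n = 0\<close>.
\<close>

lemma fibre_of_p_phantom:
  assumes R: "resolution R" and t: "exact_triangle T (pk_base R) W (pk_X R n) w a (pk_p R n)"
  shows "C_phantom w"
  unfolding phantom_iff
proof (intro conjI ballI)
  note d = triD[OF t]
  show wA: "w \<in> Arr T" using d by (simp add: in_Hom)
  fix C x assume C: "C \<in> \<C>" and "x \<in> Hom T C (Dom T w)"
  then have x: "x \<in> Hom T C (pk_base R)" using d by (simp add: in_Hom)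
  have "SA x \<in> Hom T (SO C) (SO (pk_base R))" using x by (simp add: in_Hom)
  then obtain y where y: "y \<in> Hom T (SO C) (pk_X R n)" "pk_p R n \<cdot> y = SA x"
    using lift_through_p[OF R Add_susp[OF Add_closure.base[OF C]]] by blast
  have "SA w \<cdot> pk_p R n \<cdot> y = Zero T (SO C) (SO W)" using comp_extend[OF tri_comp3[OF t], of y] y(1) d by (simp add: in_Hom)
  then have e: "SA (w \<cdot> x) = SA (Zero T C W)" using y(2) x d C_Ob[OF C] by (simp add: in_Hom)
  have "w \<cdot> x = Zero T C W" by (rule SA_faithful[OF _ _ e, of C W]) (use x d C_Ob[OF C] in \<open>simp_all add: in_Hom\<close>)
  then show "w \<cdot> x = Zero T C (Cod T w)" using d by (simp add: in_Hom)
qed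

text \<open>
  The map \<open>i\<^bsub>n+1\<^esub>\<close> induces a map \<open>k\<close> between the fibres of \<open>p\<^sub>n\<close> and \<open>p\<^bsub>n+1\<^esub>\<close>, through which \<open>w\<close>
  factors. It is a phantom map: a map \<open>u\<close> from \<open>C\<close> to the first fibre reaches \<open>X\<^sub>n\<close> through the cell \<open>P\<^bsub>n+1\<^esub>\<close>, which dies in
  \<open>X\<^bsub>n+1\<^esub>\<close>; so \<open>k \<cdot> u\<close> comes from \<open>X\<close> along the phantom map \<open>w\<close>.
\<close>

lemma fibre_of_p_n_phantom:
  assumes R: "resolution R" and t: "exact_triangle T (pk_base R) W (pk_X R n) w a (pk_p R n)"
  shows "n_phantom T \<C> (Suc n) w"
  using t
proof (induction n arbitrary: W w a)
  case 0
  then show ?case using n_phantom.one[OF fibre_of_p_phantom[OF R 0]] by simp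
next
  case (Suc n)
  note t' = Suc.prems
  note d' = triD[OF t']
  note h = postnikov_Hom(1-7)[OF R, of "Suc n"]
  obtain W0 w0 a0 where t0: "exact_triangle T (pk_base R) W0 (pk_X R n) w0 a0 (pk_p R n)"
    using ex_triangle_third[OF postnikov_Hom(7,8)[OF R]] by metis
  note d = triD[OF t0]
  have i: "pk_i R (Suc n) \<in> Hom T (pk_X R n) (pk_X R (Suc n))" using h by simp
  have bO: "pk_base R \<in> Ob T" using postnikovD(1)[OF R] .
  have I: "Idn T (SO (pk_base R)) \<in> Hom T (SO (pk_base R)) (SO (pk_base R))" using bO by (simp add: in_Hom)
  have "Idn T (SO (pk_base R)) \<cdot> pk_p R n = pk_p R (Suc n) \<cdot> pk_i R (Suc n)"
    using d postnikovD(5)[OF R, of n] by (simp add: in_Hom)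
  from triangle_morphism[OF tri_rot[OF tri_rot[OF t0]] tri_rot[OF tri_rot[OF t']] i I this]
  obtain c where c: "c \<in> Hom T (SO W0) (SO W)" "c \<cdot> neg T (SA w0) = neg T (SA w) \<cdot> Idn T (SO (pk_base R))"
    "SA (pk_i R (Suc n)) \<cdot> neg T (SA a0) = neg T (SA a) \<cdot> c" by blast
  obtain k where k: "k \<in> Hom T W0 W" "SA k = c" using SA_full[OF c(1)] d d' by metis
  have kw: "k \<cdot> w0 = w"
  proof (rule SA_faithful[of _ "pk_base R" W])
    have "neg T (SA (k \<cdot> w0)) = neg T (SA w)" using c(1,2) k d d' by (simp add: in_Hom)
    then show "SA (k \<cdot> w0) = SA w" by (rule neg_inject) (use k(1) d(1) d'(1) in \<open>simp_all add: in_Hom\<close>)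
  qed (use k(1) d d' in \<open>simp_all add: in_Hom\<close>)
  have ak: "a \<cdot> k = pk_i R (Suc n) \<cdot> a0"
  proof (rule SA_faithful[of _ W0 "pk_X R (Suc n)"])
    have "neg T (SA (a \<cdot> k)) = neg T (SA (pk_i R (Suc n) \<cdot> a0))" using c(1,3) k d d' i by (simp add: in_Hom)
    then show "SA (a \<cdot> k) = SA (pk_i R (Suc n) \<cdot> a0)"
      by (rule neg_inject) (use k(1) d(2) d'(2) i in \<open>simp_all add: in_Hom\<close>)
  qed (use k(1) d d' i in \<open>simp_all add: in_Hom\<close>)
  have "C_phantom k"
    unfolding phantom_iff
  proof (intro conjI ballI)
    show "k \<in> Arr T" using k by (simp add: in_Hom)
    fix C u assume C: "C \<in> \<C>" and "u \<in> Hom T C (Dom T k)"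
    then have u: "u \<in> Hom T C W0" using k by (simp add: in_Hom)
    have au: "a0 \<cdot> u \<in> Hom T C (prevX T R (Suc n))" using u d by (simp add: in_Hom)
    have "pk_p R n \<cdot> a0 \<cdot> u = Zero T C (SO (pk_base R))"
      using comp_extend[OF tri_comp2[OF t0], of u] u d by (simp add: in_Hom)
    then have "(pk_p R (Suc n) \<cdot> pk_i R (Suc n)) \<cdot> a0 \<cdot> u = Zero T C (SO (pk_base R))"
      using postnikovD(5)[OF R, of n] by simp
    then obtain x where x: "x \<in> Hom T C (pk_P R (Suc n))" "pk_f R (Suc n) \<cdot> x = a0 \<cdot> u"
      using C_exact_lift[OF exact_at_X[OF R] h(1) pi_Hom[OF R] Add_closure.base[OF C] au] by blast
    have "a \<cdot> k \<cdot> u = pk_i R (Suc n) \<cdot> a0 \<cdot> u"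
      by (rule comp_extend2[OF ak]) (use k(1) u d d' i in \<open>simp_all add: in_Hom\<close>)
    also have "\<dots> = Zero T C (pk_X R (Suc n))"
      unfolding x(2)[symmetric]
      using comp_extend[OF tri_comp1[OF postnikovD(3)[OF R, of "Suc n"]], of x] x(1) h by (simp add: in_Hom)
    finally have ku0: "a \<cdot> (k \<cdot> u) = Zero T C (pk_X R (Suc n))" .
    have ku: "k \<cdot> u \<in> Hom T C W" using k(1) u by (simp add: in_Hom)
    obtain y where y: "y \<in> Hom T C (pk_base R)" "w \<cdot> y = k \<cdot> u" using tri_lift1[OF t' ku ku0] .
    have "w \<cdot> y = Zero T C W" using fibre_of_p_phantom[OF R t'] C y(1) d' unfolding phantom_iff by (simp add: in_Hom)
    then show "k \<cdot> u = Zero T C (Cod T k)" using y(2) k(1) by (simp add: in_Hom)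
  qed
  then have "n_phantom T \<C> (Suc (Suc n)) (k \<cdot> w0)"
    by (rule n_phantom.step[OF Suc.IH[OF t0]]) (use k(1) d(1) in \<open>simp add: in_Hom\<close>)
  then show ?case using kw by simp
qed

text \<open>
  If \<open>\<Sigma> h\<close> kills \<open>p\<^sub>n\<close>, then \<open>h\<close> factors through the fibre of \<open>p\<^sub>n\<close>, which is an
  \<open>(n + 1)\<close>-phantom map.
\<close>

theorem infinite_phantoms_iff:
  assumes R: "resolution R" and h: "h \<in> Hom T (pk_base R) Y"
  shows "h \<in> infinite_phantoms T \<C> \<longleftrightarrow> (\<forall>n. SA h \<cdot> pk_p R n = Zero T (pk_X R n) (SO Y))"
proof
  assume "h \<in> infinite_phantoms T \<C>"
  then have "n_phantom T \<C> (Suc n) h" for n unfolding infinite_phantoms_def by simp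
  from n_phantom_kills_p[OF this R] h show "\<forall>n. SA h \<cdot> pk_p R n = Zero T (pk_X R n) (SO Y)" by (simp add: in_Hom)
next
  assume z: "\<forall>n. SA h \<cdot> pk_p R n = Zero T (pk_X R n) (SO Y)"
  have "n_phantom T \<C> (Suc n) h" for n
  proof -
    obtain W w a where t: "exact_triangle T (pk_base R) W (pk_X R n) w a (pk_p R n)"
      using ex_triangle_third[OF postnikov_Hom(7,8)[OF R]] by metis
    note d = triD[OF t]
    have hS: "SA h \<in> Hom T (SO (pk_base R)) (SO Y)" using h by (simp add: in_Hom)
    obtain y where y: "y \<in> Hom T (SO W) (SO Y)" "y \<cdot> SA w = SA h" using tri_colift3[OF t hS] z by blast
    obtain k where k: "k \<in> Hom T W Y" "SA k = y" using SA_full[OF y(1) d(5) Hom_Ob(2)[OF h]] .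
    have e: "SA (k \<cdot> w) = SA h" using k y d by (simp add: in_Hom)
    have "k \<cdot> w = h" by (rule SA_faithful[OF _ h e]) (use k(1) d in \<open>simp add: in_Hom\<close>)
    moreover have "n_phantom T \<C> (Suc n) (k \<cdot> w)"
      by (rule n_phantom_post[OF fibre_of_p_n_phantom[OF R t]]) (use k(1) d in \<open>simp_all add: in_Hom\<close>)
    ultimately show ?thesis by simp
  qed
  then have "n_phantom T \<C> n h" if "n > 0" for n using that by (metis Suc_pred)
  then show "h \<in> infinite_phantoms T \<C>" unfolding infinite_phantoms_def by simp
qed

end

section \<open>The homotopy category of Postnikov resolutions\<close>

context resolution_setting
begin

abbreviation "PR \<equiv> Pres T \<kappa> \<alpha> \<C>"
abbreviation "HR \<equiv> homotopy_rel T \<kappa> \<alpha> \<C>"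
abbreviation "PH \<equiv> Pres_homotopy T \<kappa> \<alpha> \<C>"

lemma Pres_simps [simp]:
  "R \<in> Ob PR \<longleftrightarrow> resolution R" "m \<in> Arr PR \<longleftrightarrow> resolution_map m"
  "Dom PR m = pm_src m" "Cod PR m = pm_tgt m"
  "pm_src (Idn PR R) = R" "pm_tgt (Idn PR R) = R" "pm_h (Idn PR R) = Idn T (pk_base R)"
  "pm_psi (Idn PR R) n = Idn T (pk_X R n)" "pm_phi (Idn PR R) n = Idn T (pk_P R n)"
  "pm_src (m' \<cdot>\<^bsub>PR\<^esub> m) = pm_src m" "pm_tgt (m' \<cdot>\<^bsub>PR\<^esub> m) = pm_tgt m'" "pm_h (m' \<cdot>\<^bsub>PR\<^esub> m) = pm_h m' \<cdot> pm_h m"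
  "pm_psi (m' \<cdot>\<^bsub>PR\<^esub> m) n = pm_psi m' n \<cdot> pm_psi m n" "pm_phi (m' \<cdot>\<^bsub>PR\<^esub> m) n = pm_phi m' n \<cdot> pm_phi m n"
  "pm_src (m \<oplus>\<^bsub>PR\<^esub> m') = pm_src m" "pm_tgt (m \<oplus>\<^bsub>PR\<^esub> m') = pm_tgt m" "pm_h (m \<oplus>\<^bsub>PR\<^esub> m') = pm_h m \<oplus> pm_h m'"
  "pm_psi (m \<oplus>\<^bsub>PR\<^esub> m') n = pm_psi m n \<oplus> pm_psi m' n" "pm_phi (m \<oplus>\<^bsub>PR\<^esub> m') n = pm_phi m n \<oplus> pm_phi m' n"
  "pm_src (Zero PR R R') = R" "pm_tgt (Zero PR R R') = R'" "pm_h (Zero PR R R') = Zero T (pk_base R) (pk_base R')"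
  "pm_psi (Zero PR R R') n = Zero T (pk_X R n) (pk_X R' n)" "pm_phi (Zero PR R R') n = Zero T (pk_P R n) (pk_P R' n)"
  by (simp_all add: Pres_def)

lemma postnikov_map_eqI:
  assumes "pm_src m = pm_src m'" "pm_tgt m = pm_tgt m'" "pm_h m = pm_h m'"
    and "\<And>n. pm_psi m n = pm_psi m' n" "\<And>n. pm_phi m n = pm_phi m' n"
  shows "m = (m' :: ('o, 'm) postnikov_map)"
  using assms by (intro postnikov_map.equality) (auto simp: fun_eq_iff)

text \<open>
  Source, target and object facts as rewrite rules, so that the simplifier can discharge the
  side conditions of associativity and distributivity.
\<close>

lemma pk_simps:
  assumes "resolution R"
  shows "pk_f R n \<in> Arr T" "Dom T (pk_f R n) = pk_P R n" "Cod T (pk_f R n) = prevX T R n"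
    "pk_i R n \<in> Arr T" "Dom T (pk_i R n) = prevX T R n" "Cod T (pk_i R n) = pk_X R n"
    "pk_q R n \<in> Arr T" "Dom T (pk_q R n) = pk_X R n" "Cod T (pk_q R n) = SO (pk_P R n)"
    "pk_p R n \<in> Arr T" "Dom T (pk_p R n) = pk_X R n" "Cod T (pk_p R n) = SO (pk_base R)"
    "pk_P R n \<in> Ob T" "prevX T R n \<in> Ob T" "pk_X R n \<in> Ob T" "pk_base R \<in> Ob T"
  using postnikov_Hom[OF assms] by (simp_all add: in_Hom)

lemma pm_simps:
  assumes "resolution_map m"
  shows "pm_h m \<in> Arr T" "Dom T (pm_h m) = pk_base (pm_src m)" "Cod T (pm_h m) = pk_base (pm_tgt m)"
    "pm_psi m n \<in> Arr T" "Dom T (pm_psi m n) = pk_X (pm_src m) n" "Cod T (pm_psi m n) = pk_X (pm_tgt m) n"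
    "pm_phi m n \<in> Arr T" "Dom T (pm_phi m n) = pk_P (pm_src m) n" "Cod T (pm_phi m n) = pk_P (pm_tgt m) n"
    "prevpsi T m n \<in> Arr T" "Dom T (prevpsi T m n) = prevX T (pm_src m) n" "Cod T (prevpsi T m n) = prevX T (pm_tgt m) n"
    "resolution (pm_src m)" "resolution (pm_tgt m)"
  using postnikov_mapD(1-5)[OF assms] prevpsi_Hom[OF assms, of n] by (simp_all add: in_Hom)

lemma Idn_postnikov_map:
  assumes R: "resolution R"
  shows "resolution_map (Idn PR R)"
proof -
  have pv: "prevpsi T (Idn PR R) n = Idn T (prevX T R n)" for n
    by (cases n) (simp_all add: zero_ob_Idn[OF zero_ob_is_zero])
  show ?thesis by (rule resolution_mapI) (use R in \<open>simp_all add: pv pk_simps in_Hom\<close>)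
qed

lemma Zero_postnikov_map:
  assumes R: "resolution R" and R': "resolution R'"
  shows "resolution_map (Zero PR R R')"
proof -
  have pv: "prevpsi T (Zero PR R R') n = Zero T (prevX T R n) (prevX T R' n)" for n by (cases n) simp_all
  show ?thesis by (rule resolution_mapI) (use R R' in \<open>simp_all add: pv pk_simps in_Hom\<close>)
qed

lemma Comp_postnikov_map:
  assumes m: "resolution_map m" and m': "resolution_map m'" and e: "pm_src m' = pm_tgt m"
  shows "resolution_map (m' \<cdot>\<^bsub>PR\<^esub> m)"
proof -
  have pv: "prevpsi T (m' \<cdot>\<^bsub>PR\<^esub> m) n = prevpsi T m' n \<cdot> prevpsi T m n" for n by (cases n) simp_all
  note s = pm_simps[OF m] pm_simps[OF m', unfolded e] pk_simps
  note d = postnikov_mapD[OF m] and d' = postnikov_mapD[OF m', unfolded e]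
  show ?thesis
  proof (rule resolution_mapI)
    fix n
    show "prevpsi T (m' \<cdot>\<^bsub>PR\<^esub> m) n \<cdot> pk_f (pm_src (m' \<cdot>\<^bsub>PR\<^esub> m)) n = pk_f (pm_tgt (m' \<cdot>\<^bsub>PR\<^esub> m)) n \<cdot> pm_phi (m' \<cdot>\<^bsub>PR\<^esub> m) n"
      using comp_extend2[OF d'(6)[of n], of "pm_phi m n"] d(6)[of n] by (simp add: pv s)
    show "pm_psi (m' \<cdot>\<^bsub>PR\<^esub> m) n \<cdot> pk_i (pm_src (m' \<cdot>\<^bsub>PR\<^esub> m)) n = pk_i (pm_tgt (m' \<cdot>\<^bsub>PR\<^esub> m)) n \<cdot> prevpsi T (m' \<cdot>\<^bsub>PR\<^esub> m) n"
      using comp_extend2[OF d'(7)[of n], of "prevpsi T m n"] d(7)[of n] by (simp add: pv s)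
    show "SA (pm_phi (m' \<cdot>\<^bsub>PR\<^esub> m) n) \<cdot> pk_q (pm_src (m' \<cdot>\<^bsub>PR\<^esub> m)) n = pk_q (pm_tgt (m' \<cdot>\<^bsub>PR\<^esub> m)) n \<cdot> pm_psi (m' \<cdot>\<^bsub>PR\<^esub> m) n"
      using comp_extend2[OF d'(8)[of n], of "pm_psi m n"] d(8)[of n] by (simp add: pv s)
    show "SA (pm_h (m' \<cdot>\<^bsub>PR\<^esub> m)) \<cdot> pk_p (pm_src (m' \<cdot>\<^bsub>PR\<^esub> m)) n = pk_p (pm_tgt (m' \<cdot>\<^bsub>PR\<^esub> m)) n \<cdot> pm_psi (m' \<cdot>\<^bsub>PR\<^esub> m) n"
      using comp_extend2[OF d'(9)[of n], of "pm_psi m n"] d(9)[of n] by (simp add: pv s)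
  qed (simp_all add: s in_Hom)
qed

lemma Add_postnikov_map:
  assumes m: "resolution_map m" and m': "resolution_map m'"
    and e: "pm_src m' = pm_src m" "pm_tgt m' = pm_tgt m"
  shows "resolution_map (m \<oplus>\<^bsub>PR\<^esub> m')"
proof -
  have pv: "prevpsi T (m \<oplus>\<^bsub>PR\<^esub> m') n = prevpsi T m n \<oplus> prevpsi T m' n" for n by (cases n) simp_all
  note s = pm_simps[OF m] pm_simps[OF m', unfolded e] pk_simps
  show ?thesis
    by (rule resolution_mapI)
      (use postnikov_mapD(6-)[OF m] postnikov_mapD(6-)[OF m', unfolded e] in \<open>simp_all add: pv s in_Hom\<close>)
qed

definition neg_map :: "('o, 'm) postnikov_map \<Rightarrow> ('o, 'm) postnikov_map" where
  "neg_map m = \<lparr>pm_src = pm_src m, pm_tgt = pm_tgt m, pm_h = neg T (pm_h m),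
     pm_psi = \<lambda>n. neg T (pm_psi m n), pm_phi = \<lambda>n. neg T (pm_phi m n)\<rparr>"

lemma neg_map_simps [simp]:
  "pm_src (neg_map m) = pm_src m" "pm_tgt (neg_map m) = pm_tgt m" "pm_h (neg_map m) = neg T (pm_h m)"
  "pm_psi (neg_map m) n = neg T (pm_psi m n)" "pm_phi (neg_map m) n = neg T (pm_phi m n)"
  by (simp_all add: neg_map_def)

lemma neg_postnikov_map:
  assumes m: "resolution_map m"
  shows "resolution_map (neg_map m)"
proof -
  have pv: "prevpsi T (neg_map m) n = neg T (prevpsi T m n)" for n by (cases n) simp_all
  show ?thesis
    by (rule resolution_mapI)
      (use postnikov_mapD(6-)[OF m] in \<open>simp_all add: pv pm_simps[OF m] pk_simps in_Hom\<close>)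
qed

lemma Pres_preadditive: "preadditive_category PR"
proof (intro preadditive_category.intro category.intro preadditive_category_axioms.intro)
  fix m assume "m \<in> Arr PR"
  then show "Dom PR m \<in> Ob PR \<and> Cod PR m \<in> Ob PR" by (simp add: pm_simps)
next
  fix R assume "R \<in> Ob PR"
  then show "Idn PR R \<in> Hom PR R R" by (simp add: in_Hom Idn_postnikov_map)
next
  fix f g X Y Z assume "f \<in> Hom PR X Y" "g \<in> Hom PR Y Z"
  then show "g \<cdot>\<^bsub>PR\<^esub> f \<in> Hom PR X Z" by (simp add: in_Hom Comp_postnikov_map)
next
  fix f X Y assume "f \<in> Hom PR X Y"
  then show "f \<cdot>\<^bsub>PR\<^esub> Idn PR X = f" "Idn PR Y \<cdot>\<^bsub>PR\<^esub> f = f"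
    by (auto intro!: postnikov_map_eqI simp: in_Hom pm_simps pk_simps)
next
  fix f g h W X Y Z assume "f \<in> Hom PR W X" "g \<in> Hom PR X Y" "h \<in> Hom PR Y Z"
  then show "(h \<cdot>\<^bsub>PR\<^esub> g) \<cdot>\<^bsub>PR\<^esub> f = h \<cdot>\<^bsub>PR\<^esub> (g \<cdot>\<^bsub>PR\<^esub> f)"
    by (intro postnikov_map_eqI) (simp_all add: in_Hom pm_simps)
next
  fix X Y assume XY: "X \<in> Ob PR" "Y \<in> Ob PR"
  show "comm_group (Hom_group PR X Y)"
  proof (rule comm_groupI, unfold Hom_group_def, simp_all)
    fix f g assume fg: "f \<in> Hom PR X Y" "g \<in> Hom PR X Y"
    then show "f \<oplus>\<^bsub>PR\<^esub> g \<in> Hom PR X Y" by (simp add: in_Hom Add_postnikov_map)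
    show "f \<oplus>\<^bsub>PR\<^esub> g = g \<oplus>\<^bsub>PR\<^esub> f"
      using fg by (intro postnikov_map_eqI) (simp_all add: in_Hom pm_simps Add_commute')
  next
    fix f g h assume "f \<in> Hom PR X Y" "g \<in> Hom PR X Y" "h \<in> Hom PR X Y"
    then show "f \<oplus>\<^bsub>PR\<^esub> g \<oplus>\<^bsub>PR\<^esub> h = f \<oplus>\<^bsub>PR\<^esub> (g \<oplus>\<^bsub>PR\<^esub> h)"
      by (intro postnikov_map_eqI) (simp_all add: in_Hom pm_simps Add_assoc')
  next
    show "Zero PR X Y \<in> Hom PR X Y" using XY by (simp add: in_Hom Zero_postnikov_map)
  next
    fix f assume f: "f \<in> Hom PR X Y"
    then show "Zero PR X Y \<oplus>\<^bsub>PR\<^esub> f = f" by (intro postnikov_map_eqI) (simp_all add: in_Hom pm_simps)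
    show "\<exists>g \<in> Hom PR X Y. g \<oplus>\<^bsub>PR\<^esub> f = Zero PR X Y"
    proof
      show "neg_map f \<in> Hom PR X Y" using f by (simp add: in_Hom neg_postnikov_map)
      show "neg_map f \<oplus>\<^bsub>PR\<^esub> f = Zero PR X Y"
        using f by (intro postnikov_map_eqI) (simp_all add: in_Hom pm_simps neg_Add[OF HomI])
    qed
  qed
next
  fix f g g' X Y Z assume "f \<in> Hom PR X Y" "g \<in> Hom PR Y Z" "g' \<in> Hom PR Y Z"
  then show "(g \<oplus>\<^bsub>PR\<^esub> g') \<cdot>\<^bsub>PR\<^esub> f = (g \<cdot>\<^bsub>PR\<^esub> f) \<oplus>\<^bsub>PR\<^esub> (g' \<cdot>\<^bsub>PR\<^esub> f)"
    by (intro postnikov_map_eqI) (simp_all add: in_Hom pm_simps)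
next
  fix f f' g X Y Z assume "f \<in> Hom PR X Y" "f' \<in> Hom PR X Y" "g \<in> Hom PR Y Z"
  then show "g \<cdot>\<^bsub>PR\<^esub> (f \<oplus>\<^bsub>PR\<^esub> f') = (g \<cdot>\<^bsub>PR\<^esub> f) \<oplus>\<^bsub>PR\<^esub> (g \<cdot>\<^bsub>PR\<^esub> f')"
    by (intro postnikov_map_eqI) (simp_all add: in_Hom pm_simps)
qed

lemma homotopy_rel_iff: "(m, m') \<in> HR \<longleftrightarrow> resolution_map m \<and> resolution_map m' \<and>
    pm_src m = pm_src m' \<and> pm_tgt m = pm_tgt m' \<and>
    (\<forall>n > 0. pm_psi m n \<cdot> pk_i (pm_src m) n = pm_psi m' n \<cdot> pk_i (pm_src m) n)"
  by (simp add: homotopy_rel_def)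

text \<open>
  For precomposition, a homotopy is compatible since \<open>\<psi>\<^sub>n \<cdot> i\<^sub>n = i\<^sub>n \<cdot> \<psi>\<^bsub>n-1\<^esub>\<close> moves \<open>i\<^sub>n\<close> past the first
  morphism.
\<close>

lemma homotopy_congruence: "additive_congruence PR HR"
proof (intro additive_congruence.intro additive_congruence_axioms.intro Pres_preadditive)
  show "equiv (Arr PR) HR"
    by (rule equivI) (auto simp: homotopy_rel_iff refl_on_def sym_def trans_def)
  show "Dom PR f = Dom PR g \<and> Cod PR f = Cod PR g" if "(f, g) \<in> HR" for f g
    using that by (simp add: homotopy_rel_iff)
  show "(g \<cdot>\<^bsub>PR\<^esub> f, g' \<cdot>\<^bsub>PR\<^esub> f') \<in> HR" if f: "(f, f') \<in> HR" and g: "(g, g') \<in> HR" and e: "Dom PR g = Cod PR f" for f f' g g'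
  proof -
    have m: "resolution_map f" "resolution_map f'" "resolution_map g" "resolution_map g'"
      and st: "pm_src f' = pm_src f" "pm_tgt f' = pm_tgt f" "pm_src g = pm_tgt f" "pm_src g' = pm_tgt f" "pm_tgt g' = pm_tgt g"
      using f g e by (simp_all add: homotopy_rel_iff)
    have s: "(pm_psi g n \<cdot> pm_psi f n) \<cdot> pk_i (pm_src f) n = (pm_psi g' n \<cdot> pm_psi f' n) \<cdot> pk_i (pm_src f) n" if n: "n > 0" for n
    proof -
      note t = pm_simps[OF m(1)] pm_simps[OF m(2)] pm_simps[OF m(3)] pm_simps[OF m(4)] pk_simps
      have ff: "pm_psi f n \<cdot> pk_i (pm_src f) n = pm_psi f' n \<cdot> pk_i (pm_src f) n" using f n unfolding homotopy_rel_iff by blast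
      have gg: "pm_psi g n \<cdot> pk_i (pm_tgt f) n = pm_psi g' n \<cdot> pk_i (pm_tgt f) n"
        using g n unfolding homotopy_rel_iff st(3) by blast
      have fi: "pm_psi f' n \<cdot> pk_i (pm_src f) n = pk_i (pm_tgt f) n \<cdot> prevpsi T f' n"
        using postnikov_mapD(7)[OF m(2), of n] st by simp
      have "(pm_psi g n \<cdot> pm_psi f n) \<cdot> pk_i (pm_src f) n = pm_psi g n \<cdot> pk_i (pm_tgt f) n \<cdot> prevpsi T f' n"
        using ff fi st by (simp add: t)
      also have "\<dots> = pm_psi g' n \<cdot> pk_i (pm_tgt f) n \<cdot> prevpsi T f' n"
        by (rule comp_extend2[OF gg]) (simp_all add: t st)
      also have "\<dots> = (pm_psi g' n \<cdot> pm_psi f' n) \<cdot> pk_i (pm_src f) n"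
        using fi st by (simp add: t)
      finally show ?thesis .
    qed
    show ?thesis using m st s by (simp add: homotopy_rel_iff Comp_postnikov_map)
  qed
  show "(f \<oplus>\<^bsub>PR\<^esub> g, f' \<oplus>\<^bsub>PR\<^esub> g') \<in> HR" if f: "(f, f') \<in> HR" and g: "(g, g') \<in> HR"
    and e: "Dom PR g = Dom PR f" "Cod PR g = Cod PR f" for f f' g g'
  proof -
    have m: "resolution_map f" "resolution_map f'" "resolution_map g" "resolution_map g'"
      and st: "pm_src f' = pm_src f" "pm_tgt f' = pm_tgt f" "pm_src g = pm_src f" "pm_tgt g = pm_tgt f"
        "pm_src g' = pm_src f" "pm_tgt g' = pm_tgt f"
      using f g e by (simp_all add: homotopy_rel_iff)
    note t = pm_simps[OF m(1)] pm_simps[OF m(2), unfolded st] pm_simps[OF m(3), unfolded st] pm_simps[OF m(4), unfolded st] pk_simps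
    have "(pm_psi f n \<oplus> pm_psi g n) \<cdot> pk_i (pm_src f) n = (pm_psi f' n \<oplus> pm_psi g' n) \<cdot> pk_i (pm_src f) n" if n: "n > 0" for n
    proof -
      have "pm_psi f n \<cdot> pk_i (pm_src f) n = pm_psi f' n \<cdot> pk_i (pm_src f) n" using f n unfolding homotopy_rel_iff by blast
      moreover have "pm_psi g n \<cdot> pk_i (pm_src f) n = pm_psi g' n \<cdot> pk_i (pm_src f) n"
        using g n unfolding homotopy_rel_iff st(3) by blast
      ultimately show ?thesis by (simp add: t st)
    qed
    then show ?thesis using m st by (simp add: homotopy_rel_iff Add_postnikov_map)
  qed
qed

lemma PH_eq: "PH = quotient_cat PR HR"
  by (simp add: Pres_homotopy_def)

text \<open>
  Homotopy is additive, so the statement reduces to the difference of the two morphisms, where it combines the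
  criterion for null-homotopies with the one for \<open>\<infinity>\<close>-phantom maps. Homotopic morphisms may have different first
  coordinates, and this measures by how much.
\<close>

lemma homotopic_iff:
  assumes m: "resolution_map m" and m': "resolution_map m'"
    and e: "pm_src m' = pm_src m" "pm_tgt m' = pm_tgt m"
  shows "(m, m') \<in> HR \<longleftrightarrow> pm_h m \<ominus> pm_h m' \<in> infinite_phantoms T \<C>"
proof -
  let ?d = "m \<oplus>\<^bsub>PR\<^esub> neg_map m'"
  have d: "resolution_map ?d" using Add_postnikov_map[OF m neg_postnikov_map[OF m']] e by simp
  note s = pm_simps[OF m] pm_simps[OF m', unfolded e] pk_simps
  have "(pm_psi m n \<cdot> pk_i (pm_src m) n = pm_psi m' n \<cdot> pk_i (pm_src m) n) \<longleftrightarrow>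
      pm_psi ?d n \<cdot> pk_i (pm_src ?d) n = Zero T (prevX T (pm_src ?d) n) (pk_X (pm_tgt ?d) n)" for n
    using sub_eq_Zero_iff[of "pm_psi m n \<cdot> pk_i (pm_src m) n" "prevX T (pm_src m) n" "pk_X (pm_tgt m) n"
        "pm_psi m' n \<cdot> pk_i (pm_src m) n"] by (simp add: s in_Hom)
  then have "(m, m') \<in> HR \<longleftrightarrow> (\<forall>n>0. pm_psi ?d n \<cdot> pk_i (pm_src ?d) n = Zero T (prevX T (pm_src ?d) n) (pk_X (pm_tgt ?d) n))"
    using m m' e by (simp add: homotopy_rel_iff)
  also have "\<dots> \<longleftrightarrow> pm_h ?d \<in> infinite_phantoms T \<C>"
    unfolding null_homotopic_iff[OF d] using infinite_phantoms_iff[OF postnikov_mapD(1,3)[OF d]] by simp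
  finally show ?thesis by simp
qed

lemma Zero_infinite_phantom:
  assumes X: "X \<in> Ob T" and Y: "Y \<in> Ob T"
  shows "Zero T X Y \<in> infinite_phantoms T \<C>"
proof -
  obtain R where R: "resolution R" "pk_base R = X" using ex_postnikov[OF X] by blast
  have z: "Zero T X Y \<in> Hom T (pk_base R) Y" using R(2) X Y by (simp add: in_Hom)
  show ?thesis unfolding infinite_phantoms_iff[OF R(1) z] using pk_simps[OF R(1)] R(2) X Y by simp
qed

lemma homotopic_of_eq_base:
  assumes m: "resolution_map m" and m': "resolution_map m'"
    and e: "pm_src m' = pm_src m" "pm_tgt m' = pm_tgt m" "pm_h m' = pm_h m"
  shows "(m, m') \<in> HR"
  using homotopic_iff[OF m m' e(1,2)] e(3) Zero_infinite_phantom pm_simps[OF m] pk_simps by simp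

end

section \<open>The resolution functor\<close>

text \<open>
  The kernel of an additive functor, in the form in which the quotient by it is a preadditive category.
\<close>

lemma functor_congruence:
  assumes F: "is_additive_functor C D F"
  shows "additive_congruence C {(f, g). f \<in> Arr C \<and> g \<in> Hom C (Dom C f) (Cod C f) \<and> FArr F f = FArr F g}"
    (is "additive_congruence C ?K")
proof -
  interpret preadditive_category C using F unfolding is_additive_functor_def by simp
  have fF: "is_functor C D F" using F unfolding is_additive_functor_def by simp
  have add: "FArr F (f \<oplus>\<^bsub>C\<^esub> g) = FArr F f \<oplus>\<^bsub>D\<^esub> FArr F g"
    if "f \<in> Arr C" "g \<in> Arr C" "Dom C g = Dom C f" "Cod C g = Cod C f" for f g
    using F that Dom_Ob[OF that(1)] Cod_Ob[OF that(1)] HomI[of f C] HomI[of g C]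
    unfolding is_additive_functor_def by metis
  have comp: "FArr F (g \<cdot>\<^bsub>C\<^esub> f) = FArr F g \<cdot>\<^bsub>D\<^esub> FArr F f"
    if "f \<in> Arr C" "g \<in> Arr C" "Dom C g = Cod C f" for f g
    using fF that unfolding is_functor_def by blast
  show ?thesis
  proof (intro additive_congruence.intro additive_congruence_axioms.intro)
    show "preadditive_category C" ..
    show "equiv (Arr C) ?K" by (rule equivI) (auto simp: refl_on_def sym_def trans_def in_Hom)
    show "Dom C f = Dom C g \<and> Cod C f = Cod C g" if "(f, g) \<in> ?K" for f g using that by (simp add: in_Hom)
    show "(g \<cdot>\<^bsub>C\<^esub> f, g' \<cdot>\<^bsub>C\<^esub> f') \<in> ?K" if "(f, f') \<in> ?K" "(g, g') \<in> ?K" "Dom C g = Cod C f" for f f' g g'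
      using that by (simp add: in_Hom comp)
    show "(f \<oplus>\<^bsub>C\<^esub> g, f' \<oplus>\<^bsub>C\<^esub> g') \<in> ?K"
      if "(f, f') \<in> ?K" "(g, g') \<in> ?K" "Dom C g = Dom C f" "Cod C g = Cod C f" for f f' g g'
      using that by (simp add: in_Hom add)
  qed
qed

context resolution_setting
begin

interpretation H: additive_congruence PR HR
  by (rule homotopy_congruence)

abbreviation "hc m \<equiv> HR `` {m}"

lemma PH_preadditive: "preadditive_category PH"
  unfolding PH_eq by (rule H.Q_preadditive)

lemma PH_Ob [simp]: "R \<in> Ob PH \<longleftrightarrow> resolution R"
  unfolding PH_eq by simp

lemma PH_HomE:
  assumes "A \<in> Hom PH R R'"
  obtains m where "resolution_map m" "pm_src m = R" "pm_tgt m = R'" "A = hc m"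
  using assms unfolding PH_eq by (rule H.Q_HomE) (use that in simp)

lemma hc_Hom [simp]: "resolution_map m \<Longrightarrow> hc m \<in> Hom PH R R' \<longleftrightarrow> pm_src m = R \<and> pm_tgt m = R'"
  unfolding PH_eq by simp

lemma PH_Comp [simp]: "resolution_map m \<Longrightarrow> resolution_map m' \<Longrightarrow> pm_src m' = pm_tgt m
    \<Longrightarrow> hc m' \<cdot>\<^bsub>PH\<^esub> hc m = hc (m' \<cdot>\<^bsub>PR\<^esub> m)"
  unfolding PH_eq by (rule H.Q_Comp) simp_all

lemma PH_Add [simp]: "resolution_map m \<Longrightarrow> resolution_map m' \<Longrightarrow> pm_src m' = pm_src m
    \<Longrightarrow> pm_tgt m' = pm_tgt m \<Longrightarrow> hc m \<oplus>\<^bsub>PH\<^esub> hc m' = hc (m \<oplus>\<^bsub>PR\<^esub> m')"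
  unfolding PH_eq by (rule H.Q_Add) simp_all

lemma PH_Idn [simp]: "Idn PH R = hc (Idn PR R)"
  and PH_Zero [simp]: "Zero PH R R' = hc (Zero PR R R')"
  unfolding PH_eq by simp_all

lemma hc_eq_iff: "resolution_map m \<Longrightarrow> resolution_map m' \<Longrightarrow> hc m = hc m' \<longleftrightarrow> (m, m') \<in> HR"
  using H.cls_eq_iff by simp

lemma hc_eqI: "resolution_map m \<Longrightarrow> resolution_map m' \<Longrightarrow> pm_src m' = pm_src m
    \<Longrightarrow> pm_tgt m' = pm_tgt m \<Longrightarrow> pm_h m' = pm_h m \<Longrightarrow> hc m = hc m'"
  by (simp add: hc_eq_iff homotopic_of_eq_base)

text \<open>
  Two resolutions of the same object are homotopy equivalent: lift the identity in both directions.
\<close>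

lemma lift_of_Idn:
  assumes R: "resolution R" "resolution R'" "pk_base R = X" "pk_base R' = X"
  obtains m where "resolution_map m" "pm_src m = R" "pm_tgt m = R'" "pm_h m = Idn T X" "is_iso PH (hc m)"
proof -
  interpret PH: preadditive_category PH by (rule PH_preadditive)
  have X: "X \<in> Ob T" using postnikovD(1)[OF R(1)] R(3) by simp
  have id: "Idn T X \<in> Hom T (pk_base R) (pk_base R')" "Idn T X \<in> Hom T (pk_base R') (pk_base R)"
    using X R by (simp_all add: in_Hom)
  obtain m where m: "resolution_map m" "pm_src m = R" "pm_tgt m = R'" "pm_h m = Idn T X"
    using ex_postnikov_map[OF R(1,2) id(1)] by blast
  obtain k where k: "resolution_map k" "pm_src k = R'" "pm_tgt k = R" "pm_h k = Idn T X"
    using ex_postnikov_map[OF R(2,1) id(2)] by blast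
  have "is_iso PH (hc m)"
  proof (rule PH.is_isoI[of _ R R' "hc k"])
    show "hc k \<cdot>\<^bsub>PH\<^esub> hc m = Idn PH R"
      using m k R X by (simp, intro hc_eqI) (simp_all add: Comp_postnikov_map Idn_postnikov_map)
    show "hc m \<cdot>\<^bsub>PH\<^esub> hc k = Idn PH R'"
      using m k R X by (simp, intro hc_eqI) (simp_all add: Comp_postnikov_map Idn_postnikov_map)
  qed (use m k in simp_all)
  then show ?thesis using that m by blast
qed

lemma resolution_functor_Ob:
  assumes \<Psi>: "resolution_functor \<Psi>" and X: "X \<in> Ob T"
  shows "resolution (FOb \<Psi> X)" "pk_base (FOb \<Psi> X) = X"
proof -
  have "is_functor T PH \<Psi>" using \<Psi> unfolding is_resolution_functor_def by blast
  from functorD(3)[OF this X] show "resolution (FOb \<Psi> X)" by simp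
  show "pk_base (FOb \<Psi> X) = X" using \<Psi> X unfolding is_resolution_functor_def by blast
qed

text \<open>
  The definition only provides some lift of \<open>h\<close> in the class assigned to it; as all lifts of \<open>h\<close> are homotopic,
  every lift represents this class.
\<close>

lemma resolution_functor_Arr:
  assumes \<Psi>: "resolution_functor \<Psi>"
    and m: "resolution_map m" "pm_src m = FOb \<Psi> X" "pm_tgt m = FOb \<Psi> Y" and h: "pm_h m \<in> Hom T X Y"
  shows "FArr \<Psi> (pm_h m) = hc m"
proof -
  have F: "is_functor T PH \<Psi>" using \<Psi> unfolding is_resolution_functor_def by blast
  obtain m0 where m0: "resolution_map m0" "pm_src m0 = FOb \<Psi> X" "pm_tgt m0 = FOb \<Psi> Y" "FArr \<Psi> (pm_h m) = hc m0"
    using PH_HomE[OF functorD(4)[OF F h]] by metis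
  have "pm_h m \<in> Arr T" using h by (simp add: in_Hom)
  then obtain m1 where m1: "m1 \<in> FArr \<Psi> (pm_h m)" "pm_h m1 = pm_h m"
    using \<Psi> unfolding is_resolution_functor_def by blast
  then have r: "(m0, m1) \<in> HR" using m0(4) by simp
  then have m1': "resolution_map m1" "pm_src m1 = FOb \<Psi> X" "pm_tgt m1 = FOb \<Psi> Y"
    using m0(2,3) unfolding homotopy_rel_iff by auto
  have "hc m0 = hc m1" using hc_eq_iff[OF m0(1) m1'(1)] r by simp
  also have "\<dots> = hc m" by (rule hc_eqI) (use m1 m1' m in simp_all)
  finally show ?thesis using m0(4) by simp
qed

lemma resolution_functor_ArrE:
  assumes \<Psi>: "resolution_functor \<Psi>" and h: "h \<in> Hom T X Y"
  obtains m where "resolution_map m" "pm_src m = FOb \<Psi> X" "pm_tgt m = FOb \<Psi> Y" "pm_h m = h"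
    "FArr \<Psi> h = hc m"
proof -
  note X = resolution_functor_Ob[OF \<Psi> Hom_Ob(1)[OF h]] and Y = resolution_functor_Ob[OF \<Psi> Hom_Ob(2)[OF h]]
  have "h \<in> Hom T (pk_base (FOb \<Psi> X)) (pk_base (FOb \<Psi> Y))" using h X Y by simp
  then obtain m where m: "resolution_map m" "pm_src m = FOb \<Psi> X" "pm_tgt m = FOb \<Psi> Y" "pm_h m = h"
    using ex_postnikov_map[OF X(1) Y(1)] by blast
  then show ?thesis using that resolution_functor_Arr[OF \<Psi> m(1-3)] h by simp
qed

theorem ex_resolution_functor: "\<exists>\<Psi>. resolution_functor \<Psi>"
proof -
  have "\<forall>X. \<exists>R. X \<in> Ob T \<longrightarrow> resolution R \<and> pk_base R = X" using ex_postnikov by blast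
  from choice[OF this] obtain r where r: "\<And>X. X \<in> Ob T \<Longrightarrow> resolution (r X)" "\<And>X. X \<in> Ob T \<Longrightarrow> pk_base (r X) = X"
    by blast
  have "\<exists>m. h \<in> Arr T \<longrightarrow> resolution_map m \<and> pm_src m = r (Dom T h) \<and> pm_tgt m = r (Cod T h) \<and> pm_h m = h" for h
  proof (cases "h \<in> Arr T")
    case True
    then have "h \<in> Hom T (pk_base (r (Dom T h))) (pk_base (r (Cod T h)))" using r by (simp add: in_Hom)
    from ex_postnikov_map[OF r(1) r(1) this] True show ?thesis by auto
  qed simp
  then have "\<forall>h. \<exists>m. h \<in> Arr T \<longrightarrow> resolution_map m \<and> pm_src m = r (Dom T h) \<and> pm_tgt m = r (Cod T h) \<and> pm_h m = h"
    by blast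
  from choice[OF this] obtain L where L: "\<And>h. h \<in> Arr T \<Longrightarrow> resolution_map (L h)"
    "\<And>h. h \<in> Arr T \<Longrightarrow> pm_src (L h) = r (Dom T h)" "\<And>h. h \<in> Arr T \<Longrightarrow> pm_tgt (L h) = r (Cod T h)"
    "\<And>h. h \<in> Arr T \<Longrightarrow> pm_h (L h) = h" by blast
  define \<Psi> where "\<Psi> = \<lparr>FOb = r, FArr = \<lambda>h. hc (L h)\<rparr>"
  have "is_functor T PH \<Psi>"
    unfolding is_functor_def
  proof (intro conjI ballI impI)
    show "category T" ..
    show "category PH" using PH_preadditive by (rule preadditive_category.axioms(1))
    show "FOb \<Psi> X \<in> Ob PH" if "X \<in> Ob T" for X using r(1)[OF that] by (simp add: \<Psi>_def)
    show "FArr \<Psi> f \<in> Hom PH (FOb \<Psi> (Dom T f)) (FOb \<Psi> (Cod T f))" if "f \<in> Arr T" for f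
      using L that by (simp add: \<Psi>_def)
    show "FArr \<Psi> (Idn T X) = Idn PH (FOb \<Psi> X)" if X: "X \<in> Ob T" for X
      unfolding \<Psi>_def using L[of "Idn T X"] r X by (simp, intro hc_eqI) (simp_all add: Idn_postnikov_map)
    show "FArr \<Psi> (g \<cdot> f) = FArr \<Psi> g \<cdot>\<^bsub>PH\<^esub> FArr \<Psi> f" if fg: "f \<in> Arr T" "g \<in> Arr T" "Dom T g = Cod T f" for f g
      unfolding \<Psi>_def using L[of f] L[of g] L[of "g \<cdot> f"] fg
      by (simp, intro hc_eqI) (simp_all add: Comp_postnikov_map)
  qed
  moreover have "\<exists>m \<in> FArr \<Psi> h. pm_h m = h" if h: "h \<in> Arr T" for h
    using L h H.equiv_R by (intro bexI[of _ "L h"]) (simp_all add: \<Psi>_def homotopy_rel_iff)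
  ultimately have "resolution_functor \<Psi>"
    unfolding is_resolution_functor_def using r(2) by (simp add: \<Psi>_def)
  then show ?thesis by blast
qed

theorem resolution_functor_unique:
  assumes \<Psi>: "resolution_functor \<Psi>" and \<Psi>': "resolution_functor \<Psi>'"
  shows "naturally_isomorphic T PH \<Psi> \<Psi>'"
proof -
  have "\<exists>m. X \<in> Ob T \<longrightarrow> resolution_map m \<and> pm_src m = FOb \<Psi> X \<and> pm_tgt m = FOb \<Psi>' X \<and>
      pm_h m = Idn T X \<and> is_iso PH (hc m)" for X
    using lift_of_Idn[OF resolution_functor_Ob(1)[OF \<Psi>] resolution_functor_Ob(1)[OF \<Psi>']
        resolution_functor_Ob(2)[OF \<Psi>] resolution_functor_Ob(2)[OF \<Psi>']] by metis
  then have "\<forall>X. \<exists>m. X \<in> Ob T \<longrightarrow> resolution_map m \<and> pm_src m = FOb \<Psi> X \<and> pm_tgt m = FOb \<Psi>' X \<and>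
      pm_h m = Idn T X \<and> is_iso PH (hc m)" by blast
  from choice[OF this] obtain e where e: "\<And>X. X \<in> Ob T \<Longrightarrow> resolution_map (e X)"
    "\<And>X. X \<in> Ob T \<Longrightarrow> pm_src (e X) = FOb \<Psi> X" "\<And>X. X \<in> Ob T \<Longrightarrow> pm_tgt (e X) = FOb \<Psi>' X"
    "\<And>X. X \<in> Ob T \<Longrightarrow> pm_h (e X) = Idn T X" "\<And>X. X \<in> Ob T \<Longrightarrow> is_iso PH (hc (e X))" by blast
  show ?thesis unfolding naturally_isomorphic_def
  proof (intro exI[of _ "\<lambda>X. hc (e X)"] conjI ballI)
    fix X assume "X \<in> Ob T"
    then show "hc (e X) \<in> Hom PH (FOb \<Psi> X) (FOb \<Psi>' X)" "is_iso PH (hc (e X))" using e by simp_all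
  next
    fix f assume f: "f \<in> Arr T"
    obtain m where m: "resolution_map m" "pm_src m = FOb \<Psi> (Dom T f)" "pm_tgt m = FOb \<Psi> (Cod T f)" "pm_h m = f"
      "FArr \<Psi> f = hc m" using resolution_functor_ArrE[OF \<Psi> HomI[OF f refl refl]] .
    obtain m' where m': "resolution_map m'" "pm_src m' = FOb \<Psi>' (Dom T f)" "pm_tgt m' = FOb \<Psi>' (Cod T f)" "pm_h m' = f"
      "FArr \<Psi>' f = hc m'" using resolution_functor_ArrE[OF \<Psi>' HomI[OF f refl refl]] .
    show "hc (e (Cod T f)) \<cdot>\<^bsub>PH\<^esub> FArr \<Psi> f = FArr \<Psi>' f \<cdot>\<^bsub>PH\<^esub> hc (e (Dom T f))"
      using e[of "Dom T f"] e[of "Cod T f"] m m' f by (simp, intro hc_eqI) (simp_all add: Comp_postnikov_map)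
  qed
qed

theorem resolution_functor_additive:
  assumes \<Psi>: "resolution_functor \<Psi>"
  shows "is_additive_functor T PH \<Psi>"
  unfolding is_additive_functor_def
proof (intro conjI ballI)
  show "preadditive_category T" ..
  show "preadditive_category PH" by (rule PH_preadditive)
  show "is_functor T PH \<Psi>" using \<Psi> unfolding is_resolution_functor_def by blast
  fix X Y f g assume f: "f \<in> Hom T X Y" and g: "g \<in> Hom T X Y"
  obtain m where m: "resolution_map m" "pm_src m = FOb \<Psi> X" "pm_tgt m = FOb \<Psi> Y" "pm_h m = f"
    "FArr \<Psi> f = hc m" using resolution_functor_ArrE[OF \<Psi> f] .
  obtain k where k: "resolution_map k" "pm_src k = FOb \<Psi> X" "pm_tgt k = FOb \<Psi> Y" "pm_h k = g"
    "FArr \<Psi> g = hc k" using resolution_functor_ArrE[OF \<Psi> g] .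
  have "f \<oplus> g \<in> Hom T X Y" using f g by (simp add: in_Hom)
  then have "FArr \<Psi> (pm_h (m \<oplus>\<^bsub>PR\<^esub> k)) = hc (m \<oplus>\<^bsub>PR\<^esub> k)"
    using m k by (intro resolution_functor_Arr[OF \<Psi>, of _ X Y]) (simp_all add: Add_postnikov_map)
  then show "FArr \<Psi> (f \<oplus> g) = FArr \<Psi> f \<oplus>\<^bsub>PH\<^esub> FArr \<Psi> g" using m k by simp
qed

text \<open>
  A morphism of resolutions is a lift of its own first coordinate.
\<close>

theorem resolution_functor_full:
  assumes \<Psi>: "resolution_functor \<Psi>"
  shows "is_full T PH \<Psi>"
  unfolding is_full_def
proof (intro ballI)
  fix X Y A assume X: "X \<in> Ob T" and Y: "Y \<in> Ob T" and "A \<in> Hom PH (FOb \<Psi> X) (FOb \<Psi> Y)"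
  then obtain m where m: "resolution_map m" "pm_src m = FOb \<Psi> X" "pm_tgt m = FOb \<Psi> Y" "A = hc m"
    using PH_HomE by metis
  have h: "pm_h m \<in> Hom T X Y"
    using postnikov_mapD(3)[OF m(1)] m(2,3) resolution_functor_Ob(2)[OF \<Psi>] X Y by simp
  show "\<exists>f \<in> Hom T X Y. FArr \<Psi> f = A" using resolution_functor_Arr[OF \<Psi> m(1-3) h] m(4) h by blast
qed

theorem resolution_functor_ess_surj:
  assumes \<Psi>: "resolution_functor \<Psi>"
  shows "is_essentially_surjective T PH \<Psi>"
  unfolding is_essentially_surjective_def
proof
  fix R assume "R \<in> Ob PH"
  then have R: "resolution R" by simp
  have X: "pk_base R \<in> Ob T" using postnikovD(1)[OF R] .
  obtain m where "resolution_map m" "pm_src m = FOb \<Psi> (pk_base R)" "pm_tgt m = R" "is_iso PH (hc m)"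
    using lift_of_Idn[OF resolution_functor_Ob(1)[OF \<Psi> X] R resolution_functor_Ob(2)[OF \<Psi> X] refl] by metis
  then have "isomorphic PH (FOb \<Psi> (pk_base R)) R"
    unfolding isomorphic_def by (intro bexI[of _ "hc m"]) simp_all
  then show "\<exists>X \<in> Ob T. isomorphic PH (FOb \<Psi> X) R" using X by blast
qed

lemma resolution_functor_eq_iff:
  assumes \<Psi>: "resolution_functor \<Psi>" and f: "f \<in> Hom T X Y" and g: "g \<in> Hom T X Y"
  shows "FArr \<Psi> f = FArr \<Psi> g \<longleftrightarrow> f \<ominus> g \<in> infinite_phantoms T \<C>"
proof -
  obtain m where m: "resolution_map m" "pm_src m = FOb \<Psi> X" "pm_tgt m = FOb \<Psi> Y" "pm_h m = f"
    "FArr \<Psi> f = hc m" using resolution_functor_ArrE[OF \<Psi> f] .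
  obtain k where k: "resolution_map k" "pm_src k = FOb \<Psi> X" "pm_tgt k = FOb \<Psi> Y" "pm_h k = g"
    "FArr \<Psi> g = hc k" using resolution_functor_ArrE[OF \<Psi> g] .
  show ?thesis unfolding m(5) k(5) hc_eq_iff[OF m(1) k(1)] using homotopic_iff[OF m(1) k(1)] m k by simp
qed

lemma infinite_phantoms_Arr: "infinite_phantoms T \<C> \<subseteq> Arr T"
  unfolding infinite_phantoms_def using n_phantom_Arr by blast

theorem resolution_functor_kernel:
  assumes \<Psi>: "resolution_functor \<Psi>"
  shows "functor_kernel T PH \<Psi> = infinite_phantoms T \<C>"
proof -
  have "FArr \<Psi> f = Zero PH (FOb \<Psi> (Dom T f)) (FOb \<Psi> (Cod T f)) \<longleftrightarrow> f \<in> infinite_phantoms T \<C>" if f: "f \<in> Arr T" for f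
  proof -
    have z: "Zero T (Dom T f) (Cod T f) \<in> Hom T (Dom T f) (Cod T f)" using f by (simp add: in_Hom)
    have "FArr \<Psi> (Zero T (Dom T f) (Cod T f)) = Zero PH (FOb \<Psi> (Dom T f)) (FOb \<Psi> (Cod T f))"
      using additive_functor_Zero[OF resolution_functor_additive[OF \<Psi>]] f by (simp del: PH_Zero)
    then show ?thesis using resolution_functor_eq_iff[OF \<Psi> HomI[OF f refl refl] z] f by (simp del: PH_Zero)
  qed
  then show ?thesis unfolding functor_kernel_def using infinite_phantoms_Arr by auto
qed

text \<open>
  The equivalence is induced by \<open>\<Psi>\<close>. Its inverse \<open>G\<close> takes a resolution to the object which it resolves and a
  homotopy class to the class of its first coordinate, which is well defined by \<open>homotopic_iff\<close>. Then
  \<open>G \<circ> \<Phi>\<close> is the identity, and lifts of identities identify \<open>\<Phi> \<circ> G\<close> with the identity.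
\<close>

theorem resolution_functor_equivalence:
  assumes \<Psi>: "resolution_functor \<Psi>"
  defines "J \<equiv> ideal_rel T (infinite_phantoms T \<C>)"
  shows "\<exists>\<Phi>. (\<forall>X \<in> Ob T. FOb \<Phi> X = FOb \<Psi> X) \<and> (\<forall>h \<in> Arr T. FArr \<Phi> (J `` {h}) = FArr \<Psi> h) \<and>
    is_equivalence (quotient_cat T J) PH \<Phi>"
proof -
  have F: "is_functor T PH \<Psi>" using \<Psi> unfolding is_resolution_functor_def by blast
  have J_eq: "J = {(f, g). f \<in> Arr T \<and> g \<in> Hom T (Dom T f) (Cod T f) \<and> FArr \<Psi> f = FArr \<Psi> g}"
    unfolding J_def ideal_rel_def using resolution_functor_eq_iff[OF \<Psi> HomI[OF _ refl refl]] by blast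
  have J_D: "FArr \<Psi> f = FArr \<Psi> g" if "(f, g) \<in> J" for f g using that unfolding J_eq by blast
  interpret Q: additive_congruence T J
    unfolding J_eq using functor_congruence[OF resolution_functor_additive[OF \<Psi>]] .
  interpret QC: preadditive_category Q.Q by (rule Q.Q_preadditive)
  define \<Phi> where "\<Phi> = \<lparr>FOb = FOb \<Psi>, FArr = \<lambda>A. FArr \<Psi> (SOME f. f \<in> A)\<rparr>"
  have \<Phi>O: "FOb \<Phi> X = FOb \<Psi> X" for X by (simp add: \<Phi>_def)
  have \<Phi>A: "FArr \<Phi> (J `` {h}) = FArr \<Psi> h" if "h \<in> Arr T" for h
    using J_D[OF Q.rep[OF that]] by (simp add: \<Phi>_def)
  have \<Phi>: "is_functor Q.Q PH \<Phi>"
    unfolding is_functor_def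
  proof (intro conjI ballI impI)
    show "category Q.Q" ..
    show "category PH" by (rule functorD(2)[OF F])
    show "FOb \<Phi> X \<in> Ob PH" if "X \<in> Ob Q.Q" for X using functorD(3)[OF F, of X] that \<Phi>O by simp
    show "FArr \<Phi> A \<in> Hom PH (FOb \<Phi> (Dom Q.Q A)) (FOb \<Phi> (Cod Q.Q A))" if "A \<in> Arr Q.Q" for A
      using that functorD(4)[OF F HomI[OF _ refl refl]] by (auto simp: Q.Q_Arr \<Phi>A \<Phi>O)
    show "FArr \<Phi> (Idn Q.Q X) = Idn PH (FOb \<Phi> X)" if "X \<in> Ob Q.Q" for X
      using that functorD(5)[OF F, of X] by (simp add: \<Phi>A \<Phi>O)
    show "FArr \<Phi> (B \<cdot>\<^bsub>Q.Q\<^esub> A) = FArr \<Phi> B \<cdot>\<^bsub>PH\<^esub> FArr \<Phi> A"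
      if A: "A \<in> Arr Q.Q" and B: "B \<in> Arr Q.Q" and AB: "Dom Q.Q B = Cod Q.Q A" for A B
    proof -
      obtain f where f: "f \<in> Arr T" "A = J `` {f}" using A unfolding Q.Q_Arr by blast
      obtain g where g: "g \<in> Arr T" "B = J `` {g}" using B unfolding Q.Q_Arr by blast
      have "Dom T g = Cod T f" using AB f g by simp
      then show ?thesis using f g functorD(6)[OF F, of f "Dom T f" "Cod T f" g "Cod T g"] by (simp add: \<Phi>A in_Hom)
    qed
  qed
  define G :: "(('o, 'm) postnikov, ('o, 'm) postnikov_map set, 'o, 'm set) func" where "G = \<lparr>FOb = pk_base, FArr = \<lambda>M. J `` {pm_h (SOME m. m \<in> M)}\<rparr>"
  have GA: "FArr G (hc m) = J `` {pm_h m}" if m: "resolution_map m" for m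
  proof -
    define k where "k = (SOME k. k \<in> hc m)"
    have r: "(m, k) \<in> HR" using H.rep[of m] m unfolding k_def by simp
    then have k: "resolution_map k" "pm_src k = pm_src m" "pm_tgt k = pm_tgt m" unfolding homotopy_rel_iff by auto
    have "pm_h m \<ominus> pm_h k \<in> infinite_phantoms T \<C>" using homotopic_iff[OF m k] r by blast
    then have "(pm_h m, pm_h k) \<in> J"
      unfolding J_def ideal_rel_def using pm_simps[OF m] pm_simps[OF k(1)] k by (simp add: in_Hom)
    then show ?thesis using Q.cls_eqI unfolding G_def k_def by simp
  qed
  have GO: "FOb G R = pk_base R" for R by (simp add: G_def)
  have G: "is_functor PH Q.Q G"
    unfolding is_functor_def
  proof (intro conjI ballI impI)
    show "category Q.Q" ..
    show "category PH" by (rule functorD(2)[OF F])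
    show "FOb G R \<in> Ob Q.Q" if "R \<in> Ob PH" for R using that postnikovD(1) by (simp add: GO)
    show "FArr G A \<in> Hom Q.Q (FOb G (Dom PH A)) (FOb G (Cod PH A))" if A: "A \<in> Arr PH" for A
    proof -
      obtain m where m: "resolution_map m" "pm_src m = Dom PH A" "pm_tgt m = Cod PH A" "A = hc m"
        using PH_HomE[OF HomI[OF A refl refl]] by metis
      show ?thesis unfolding m(2,3)[symmetric] unfolding m(4) GA[OF m(1)] GO using pm_simps[OF m(1)] by simp
    qed
    show "FArr G (Idn PH R) = Idn Q.Q (FOb G R)" if "R \<in> Ob PH" for R
      using that by (simp add: GA Idn_postnikov_map GO)
    show "FArr G (B \<cdot>\<^bsub>PH\<^esub> A) = FArr G B \<cdot>\<^bsub>Q.Q\<^esub> FArr G A"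
      if A: "A \<in> Arr PH" and B: "B \<in> Arr PH" and AB: "Dom PH B = Cod PH A" for A B
    proof -
      obtain m where m: "resolution_map m" "pm_tgt m = Cod PH A" "A = hc m"
        using PH_HomE[OF HomI[OF A refl refl]] by metis
      obtain k where k: "resolution_map k" "pm_src k = Dom PH B" "B = hc k"
        using PH_HomE[OF HomI[OF B refl refl]] by metis
      have e: "pm_src k = pm_tgt m" using m k AB by simp
      show ?thesis unfolding m(3) k(3) PH_Comp[OF m(1) k(1) e] GA[OF m(1)] GA[OF k(1)] GA[OF Comp_postnikov_map[OF m(1) k(1) e]]
        using pm_simps[OF m(1)] pm_simps[OF k(1)] e by simp
    qed
  qed
  have 1: "naturally_isomorphic Q.Q Q.Q (comp_func G \<Phi>) id_func"
    unfolding naturally_isomorphic_def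
  proof (intro exI[of _ "\<lambda>X. Idn Q.Q X"] conjI ballI)
    fix X assume "X \<in> Ob Q.Q"
    then have X: "X \<in> Ob T" by simp
    show "Idn Q.Q X \<in> Hom Q.Q (FOb (comp_func G \<Phi>) X) (FOb id_func X)"
      using X resolution_functor_Ob(2)[OF \<Psi> X] by (simp add: comp_func_def id_func_def GO \<Phi>O)
    show "is_iso Q.Q (Idn Q.Q X)" using QC.is_iso_Idn X by (simp del: Q.Q_Idn)
  next
    fix A assume "A \<in> Arr Q.Q"
    then obtain f where f: "f \<in> Arr T" "A = J `` {f}" unfolding Q.Q_Arr by blast
    obtain m where m: "resolution_map m" "pm_h m = f" "FArr \<Psi> f = hc m"
      using resolution_functor_ArrE[OF \<Psi> HomI[OF f(1) refl refl]] by metis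
    have "FArr (comp_func G \<Phi>) A = A" using f m by (simp add: comp_func_def \<Phi>A GA)
    then show "Idn Q.Q (Cod Q.Q A) \<cdot>\<^bsub>Q.Q\<^esub> FArr (comp_func G \<Phi>) A = FArr id_func A \<cdot>\<^bsub>Q.Q\<^esub> Idn Q.Q (Dom Q.Q A)"
      using f by (simp add: id_func_def)
  qed
  have "\<exists>m. R \<in> Ob PH \<longrightarrow> resolution_map m \<and> pm_src m = FOb \<Psi> (pk_base R) \<and> pm_tgt m = R \<and>
      pm_h m = Idn T (pk_base R) \<and> is_iso PH (hc m)" for R
  proof (cases "R \<in> Ob PH")
    case True
    then have R: "resolution R" by simp
    note X = resolution_functor_Ob[OF \<Psi> postnikovD(1)[OF R]]
    show ?thesis using lift_of_Idn[OF X(1) R X(2) refl] by metis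
  qed simp
  then have "\<forall>R. \<exists>m. R \<in> Ob PH \<longrightarrow> resolution_map m \<and> pm_src m = FOb \<Psi> (pk_base R) \<and> pm_tgt m = R \<and>
      pm_h m = Idn T (pk_base R) \<and> is_iso PH (hc m)" by blast
  from choice[OF this] obtain e where e: "\<And>R. R \<in> Ob PH \<Longrightarrow> resolution_map (e R)"
    "\<And>R. R \<in> Ob PH \<Longrightarrow> pm_src (e R) = FOb \<Psi> (pk_base R)" "\<And>R. R \<in> Ob PH \<Longrightarrow> pm_tgt (e R) = R"
    "\<And>R. R \<in> Ob PH \<Longrightarrow> pm_h (e R) = Idn T (pk_base R)" "\<And>R. R \<in> Ob PH \<Longrightarrow> is_iso PH (hc (e R))" by blast
  have 2: "naturally_isomorphic PH PH (comp_func \<Phi> G) id_func"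
    unfolding naturally_isomorphic_def
  proof (intro exI[of _ "\<lambda>R. hc (e R)"] conjI ballI)
    fix R assume R: "R \<in> Ob PH"
    show "hc (e R) \<in> Hom PH (FOb (comp_func \<Phi> G) R) (FOb id_func R)"
      using e[OF R] by (simp add: comp_func_def id_func_def GO \<Phi>O)
    show "is_iso PH (hc (e R))" using e[OF R] by simp
  next
    fix A assume A: "A \<in> Arr PH"
    obtain m where m: "resolution_map m" "pm_src m = Dom PH A" "pm_tgt m = Cod PH A" "A = hc m"
      using PH_HomE[OF HomI[OF A refl refl]] by metis
    have O: "pm_src m \<in> Ob PH" "pm_tgt m \<in> Ob PH" using pm_simps[OF m(1)] by simp_all
    obtain k where k: "resolution_map k" "pm_src k = FOb \<Psi> (pk_base (pm_src m))"
      "pm_tgt k = FOb \<Psi> (pk_base (pm_tgt m))" "pm_h k = pm_h m" "FArr \<Psi> (pm_h m) = hc k"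
      using resolution_functor_ArrE[OF \<Psi> postnikov_mapD(3)[OF m(1)]] .
    have "FArr (comp_func \<Phi> G) A = hc k" using m k pm_simps[OF m(1)] by (simp add: comp_func_def GA \<Phi>A)
    moreover have "hc (e (pm_tgt m)) \<cdot>\<^bsub>PH\<^esub> hc k = hc m \<cdot>\<^bsub>PH\<^esub> hc (e (pm_src m))"
      using e[OF O(1)] e[OF O(2)] m(1) k pm_simps[OF m(1)]
      by (simp, intro hc_eqI) (simp_all add: Comp_postnikov_map)
    ultimately show "hc (e (Cod PH A)) \<cdot>\<^bsub>PH\<^esub> FArr (comp_func \<Phi> G) A = FArr id_func A \<cdot>\<^bsub>PH\<^esub> hc (e (Dom PH A))"
      using m by (simp add: id_func_def)
  qed
  have "is_equivalence Q.Q PH \<Phi>" unfolding is_equivalence_def using \<Phi> G 1 2 by blast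
  then show ?thesis using \<Phi>O \<Phi>A by blast
qed

end

theorem theorem6p3p3:
  fixes T :: "('o, 'm) tricat"
    and \<kappa> \<alpha> :: "'k rel"
    and \<C> :: "'o set"
  assumes "regular_cardinal \<kappa>"
    and "regular_cardinal \<alpha>" and "\<alpha> <o \<kappa>"
    and "triangulated_category T" and "has_coproducts T \<kappa>"
    and "well_generated T \<kappa>"
    and "\<exists>X \<in> Ob T. \<not> is_zero_ob T X"
    and "\<C> \<subseteq> compact_objects T \<kappa> \<alpha>"
    and "\<exists>C \<in> \<C>. \<not> is_zero_ob T C"
    and "essentially_small T \<kappa> \<C>"
    and "\<forall>C \<in> \<C>. \<forall>X \<in> Ob T. |Hom T C X| <o \<kappa>"
    and "closed_under_suspensions T \<C>"
    and "closed_under_coproducts T \<alpha> \<C>"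
    and "generates T \<C>"
    and "perfect T \<kappa> \<C>"
  shows "(\<exists>\<Psi>. is_resolution_functor T \<kappa> \<alpha> \<C> \<Psi>) \<and>
    (\<forall>\<Psi> \<Psi>'. is_resolution_functor T \<kappa> \<alpha> \<C> \<Psi> \<and> is_resolution_functor T \<kappa> \<alpha> \<C> \<Psi>' \<longrightarrow>
       naturally_isomorphic T (Pres_homotopy T \<kappa> \<alpha> \<C>) \<Psi> \<Psi>') \<and>
    (\<forall>\<Psi>. is_resolution_functor T \<kappa> \<alpha> \<C> \<Psi> \<longrightarrow>
       is_additive_functor T (Pres_homotopy T \<kappa> \<alpha> \<C>) \<Psi> \<and>
       is_full T (Pres_homotopy T \<kappa> \<alpha> \<C>) \<Psi> \<and>
       is_essentially_surjective T (Pres_homotopy T \<kappa> \<alpha> \<C>) \<Psi> \<and>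
       functor_kernel T (Pres_homotopy T \<kappa> \<alpha> \<C>) \<Psi> = infinite_phantoms T \<C> \<and>
       (\<exists>\<Phi>. (\<forall>X \<in> Ob T. FOb \<Phi> X = FOb \<Psi> X) \<and>
            (\<forall>h \<in> Arr T. FArr \<Phi> (ideal_rel T (infinite_phantoms T \<C>) `` {h}) = FArr \<Psi> h) \<and>
            is_equivalence (quotient_cat T (ideal_rel T (infinite_phantoms T \<C>))) (Pres_homotopy T \<kappa> \<alpha> \<C>) \<Phi>))"
proof -
  interpret resolution_setting T \<kappa> \<alpha> \<C>
    using assms by (intro resolution_setting.intro resolution_setting_axioms.intro) blast+
  show ?thesis
    using ex_resolution_functor resolution_functor_unique resolution_functor_additive resolution_functor_full
      resolution_functor_ess_surj resolution_functor_kernel resolution_functor_equivalence by blast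
qed

end
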